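(* Let $G$ be a hyperrigid subset of a unital $C^*$-algebra $\mathcal{A}$, and let $\chi$ be a character of $\mathcal{A}$ such that $G\subseteq\ker\chi$. Suppose that $\mathcal{H}$ and $\mathcal{K}$ are separable Hilbert spaces, $\pi\colon\mathcal{A}\to B(\mathcal{H})$ and $\rho\colon\mathcal{A}\to B(\mathcal{K})$ are representations, and $R\in B(\mathcal{H},\mathcal{K})$ is a non-isometric contraction such that $\pi(g)=R^*\rho(g)R$ for all $g\in G$. Then (i) $\triangle_R$ commutes with $\pi$ and $\triangle_{R^*}$ commutes with $\rho$; (ii) $(\pi,\rho,R)$ has an isometric $\chi$-decomposition relative to $(\mathcal{H}_0,\mathcal{H}_1,\mathcal{K}_0,\mathcal{K}_1)$, where $\mathcal{H}_1=\overline{\operatorname{ran}(\triangle_R)}$, $\mathcal{H}_0=\mathcal{H}_1^\perp$, $\mathcal{K}_1=\overline{\operatorname{ran}(\triangle_{R^*}R)}$ and $\mathcal{K}_0=\mathcal{K}_1^\perp$; (iii) the component $R_1\in B(\mathcal{H}_1,\mathcal{K}_1)$ of $R=R_0\oplus R_1$ in this decomposition is a pure contraction with dense range.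
   Context: All Hilbert spaces are complex. $B(\mathcal{H},\mathcal{K})$ is the space of bounded linear operators from $\mathcal{H}$ to $\mathcal{K}$, $B(\mathcal{H})=B(\mathcal{H},\mathcal{H})$, and $I$ is the identity operator. A representation of a unital $C^*$-algebra $\mathcal{A}$ is a unital $*$-homomorphism $\mathcal{A}\to B(\mathcal{H})$; a character is a one-dimensional representation $\chi\colon\mathcal{A}\to\mathbb{C}$. A contraction is an operator $R$ with $\|R\|\le 1$; $R$ is isometric if $R^*R=I$; $R$ is a pure contraction if $\|Rh\|<\|h\|$ for every nonzero $h$. Put $\triangle_R:=I-R^*R$ and $\triangle_{R^*}:=I-RR^*$. An operator commutes with $\pi$ if it commutes with every $\pi(a)$; a closed subspace reduces $\pi$ if it reduces every $\pi(a)$. UCP means unital completely positive. A set $G$ generates the unital $C^*$-algebra $\mathcal{A}$ if $\mathcal{A}$ is the smallest $C^*$-subalgebra of $\mathcal{A}$ containing $G$ and the unit. A finite or countably infinite set $G$ of generators of $\mathcal{A}$ is hyperrigid if for every faithful representation $\pi\colon\mathcal{A}\to B(\mathcal{H})$ on a separable Hilbert space $\mathcal{H}$ and every sequence of UCP maps $\Phi_k\colon B(\mathcal{H})\to B(\mathcal{H})$ ($k\in\mathbb{N}$): if $\lim_{k}\|\Phi_k(\pi(g))-\pi(g)\|=0$ for all $g\in G$, then $\lim_k\|\Phi_k(\pi(a))-\pi(a)\|=0$ for all $a\in\mathcal{A}$. A "hyperrigid subset" is always a finite or countably infinite generating set. Given a character $\chi$ of $\mathcal{A}$, representations $\pi\colon\mathcal{A}\to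 B(\mathcal{H})$, $\rho\colon\mathcal{A}\to B(\mathcal{K})$, a contraction $R\in B(\mathcal{H},\mathcal{K})$, closed subspaces $\mathcal{H}_0,\mathcal{H}_1$ of $\mathcal{H}$ and $\mathcal{K}_0,\mathcal{K}_1$ of $\mathcal{K}$ (possibly zero), the triple $(\pi,\rho,R)$ has an isometric $\chi$-decomposition relative to $(\mathcal{H}_0,\mathcal{H}_1,\mathcal{K}_0,\mathcal{K}_1)$ if: (1) $\mathcal{H}=\mathcal{H}_0\oplus\mathcal{H}_1$ and $\mathcal{K}=\mathcal{K}_0\oplus\mathcal{K}_1$ (orthogonal sums); (2) $\mathcal{H}_0,\mathcal{H}_1$ reduce $\pi$ and $\mathcal{K}_0,\mathcal{K}_1$ reduce $\rho$; (3) $\pi(a)|_{\mathcal{H}_1}=\chi(a)I_{\mathcal{H}_1}$ and $\rho(a)|_{\mathcal{K}_1}=\chi(a)I_{\mathcal{K}_1}$ for all $a\in\mathcal{A}$; (4) $R=R_0\oplus R_1$, where $R_0\in B(\mathcal{H}_0,\mathcal{K}_0)$ is isometric and $R_1\in B(\mathcal{H}_1,\mathcal{K}_1)$; (5) $\pi(a)|_{\mathcal{H}_0}=R_0^*\rho(a)|_{\mathcal{K}_0}R_0$ for all $a\in\mathcal{A}$. *)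

theory Defs
  imports "HOL-Analysis.Analysis"
begin

section \<open>Complex inner product spaces and C*-algebras\<close>

class complex_vector = real_vector +
  fixes scaleC :: "complex \<Rightarrow> 'a \<Rightarrow> 'a"  (infixr \<open>*\<^sub>C\<close> 75)
  assumes scaleC_add_right: "c *\<^sub>C (x + y) = c *\<^sub>C x + c *\<^sub>C y"
    and scaleC_add_left: "(c + d) *\<^sub>C x = c *\<^sub>C x + d *\<^sub>C x"
    and scaleC_scaleC: "c *\<^sub>C (d *\<^sub>C x) = (c * d) *\<^sub>C x"
    and scaleC_of_real: "complex_of_real r *\<^sub>C x = r *\<^sub>R x"

text \<open>The inner product is linear in the first argument; norm and topology come from
  the underlying real inner product space.\<close>

class complex_inner = complex_vector + real_inner +
  fixes cinner :: "'a \<Rightarrow> 'a \<Rightarrow> complex"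
  assumes cinner_commute: "cinner x y = cnj (cinner y x)"
    and cinner_add_left: "cinner (x + y) z = cinner x z + cinner y z"
    and cinner_scaleC_left: "cinner (c *\<^sub>C x) y = c * cinner x y"
    and inner_eq_Re_cinner: "inner x y = Re (cinner x y)"

text \<open>Unital C*-algebras. The superclass \<open>real_normed_algebra_1\<close> excludes only the zero
  algebra, which has no characters.\<close>

class cstar_algebra = complex_vector + real_normed_algebra_1 + banach +
  fixes star :: "'a \<Rightarrow> 'a"
  assumes norm_scaleC: "norm (c *\<^sub>C a) = cmod c * norm a"
    and mult_scaleC_left: "(c *\<^sub>C a) * b = c *\<^sub>C (a * b)"
    and mult_scaleC_right: "a * (c *\<^sub>C b) = c *\<^sub>C (a * b)"
    and star_star: "star (star a) = a"
    and star_add: "star (a + b) = star a + star b"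
    and star_scaleC: "star (c *\<^sub>C a) = cnj c *\<^sub>C star a"
    and star_mult: "star (a * b) = star b * star a"
    and cstar_identity: "norm (star a * a) = (norm a)\<^sup>2"


section \<open>Hilbert spaces and bounded operators\<close>

text \<open>A Hilbert space is a complete complex subspace of a (not necessarily complete) inner
  product space given by a type; in particular every Hilbert space type \<open>'h\<close> is covered by
  \<open>UNIV :: 'h set\<close>. This way Hilbert spaces and their closed subspaces are treated alike.\<close>

definition csubspace :: "'h::complex_vector set \<Rightarrow> bool" where
  "csubspace M \<longleftrightarrow> 0 \<in> M \<and> (\<forall>x\<in>M. \<forall>y\<in>M. x + y \<in> M) \<and> (\<forall>c. \<forall>x\<in>M. c *\<^sub>C x \<in> M)"

definition hilbert :: "'h::complex_inner set \<Rightarrow> bool" where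
  "hilbert H \<longleftrightarrow> csubspace H \<and> complete H"

definition separable_hilbert :: "'h::complex_inner set \<Rightarrow> bool" where
  "separable_hilbert H \<longleftrightarrow> hilbert H \<and> separable_space (top_of_set H)"

definition closed_csubspace :: "'h::complex_inner set \<Rightarrow> 'h set \<Rightarrow> bool" where
  "closed_csubspace H M \<longleftrightarrow> csubspace M \<and> closed M \<and> M \<subseteq> H"

definition orth_compl :: "'h::complex_inner set \<Rightarrow> 'h set \<Rightarrow> 'h set" where
  "orth_compl H M = {x \<in> H. \<forall>y\<in>M. cinner x y = 0}"

text \<open>Operators are extensional functions, so that equality of functions is equality
  of operators.\<close>

definition bop :: "'h::complex_inner set \<Rightarrow> 'k::complex_inner set \<Rightarrow> ('h \<Rightarrow> 'k) set" where
  "bop H K = {T \<in> H \<rightarrow>\<^sub>E K.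
     (\<forall>x\<in>H. \<forall>y\<in>H. T (x + y) = T x + T y) \<and>
     (\<forall>c. \<forall>x\<in>H. T (c *\<^sub>C x) = c *\<^sub>C T x) \<and>
     (\<exists>B. \<forall>x\<in>H. norm (T x) \<le> B * norm x)}"

definition op_norm :: "'h::complex_inner set \<Rightarrow> ('h \<Rightarrow> 'k::complex_inner) \<Rightarrow> real" where
  "op_norm H T = (SUP x\<in>{x \<in> H. norm x \<le> 1}. norm (T x))"

text \<open>Existence and uniqueness of the adjoint of \<open>T \<in> bop H K\<close>, for Hilbert spaces \<open>H\<close> and
  \<open>K\<close>, is the Riesz representation theorem.\<close>

definition adj ::
  "'h::complex_inner set \<Rightarrow> 'k::complex_inner set \<Rightarrow> ('h \<Rightarrow> 'k) \<Rightarrow> 'k \<Rightarrow> 'h" where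
  "adj H K T = (THE S. S \<in> bop K H \<and> (\<forall>x\<in>H. \<forall>y\<in>K. cinner (T x) y = cinner x (S y)))"

definition contraction where
  "contraction H K R \<longleftrightarrow> R \<in> bop H K \<and> op_norm H R \<le> 1"

definition isometric where
  "isometric H K R \<longleftrightarrow> R \<in> bop H K \<and> (\<forall>h\<in>H. adj H K R (R h) = h)"

definition pure_contraction where
  "pure_contraction H K R \<longleftrightarrow>
     contraction H K R \<and> (\<forall>h\<in>H. h \<noteq> 0 \<longrightarrow> norm (R h) < norm h)"

text \<open>The operators \<open>I - R*R\<close> on \<open>H\<close> and \<open>I - RR*\<close> on \<open>K\<close>.\<close>

definition defect ::
  "'h::complex_inner set \<Rightarrow> 'k::complex_inner set \<Rightarrow> ('h \<Rightarrow> 'k) \<Rightarrow> 'h \<Rightarrow> 'h" where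
  "defect H K R = (\<lambda>h\<in>H. h - adj H K R (R h))"

definition codefect ::
  "'h::complex_inner set \<Rightarrow> 'k::complex_inner set \<Rightarrow> ('h \<Rightarrow> 'k) \<Rightarrow> 'k \<Rightarrow> 'k" where
  "codefect H K R = (\<lambda>k\<in>K. k - R (adj H K R k))"


section \<open>Representations and characters\<close>

definition star_representation ::
  "'h::complex_inner set \<Rightarrow> ('a::cstar_algebra \<Rightarrow> 'h \<Rightarrow> 'h) \<Rightarrow> bool" where
  "star_representation H \<pi> \<longleftrightarrow>
     (\<forall>a. \<pi> a \<in> bop H H) \<and>
     (\<forall>a b. \<forall>h\<in>H. \<pi> (a + b) h = \<pi> a h + \<pi> b h) \<and>
     (\<forall>c a. \<forall>h\<in>H. \<pi> (c *\<^sub>C a) h = c *\<^sub>C \<pi> a h) \<and>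
     (\<forall>a b. \<forall>h\<in>H. \<pi> (a * b) h = \<pi> a (\<pi> b h)) \<and>
     (\<forall>a. \<pi> (star a) = adj H H (\<pi> a)) \<and>
     (\<forall>h\<in>H. \<pi> 1 h = h)"

definition faithful_representation ::
  "'h::complex_inner set \<Rightarrow> ('a::cstar_algebra \<Rightarrow> 'h \<Rightarrow> 'h) \<Rightarrow> bool" where
  "faithful_representation H \<pi> \<longleftrightarrow> star_representation H \<pi> \<and> inj \<pi>"

definition character :: "('a::cstar_algebra \<Rightarrow> complex) \<Rightarrow> bool" where
  "character chi \<longleftrightarrow>
     (\<forall>a b. chi (a + b) = chi a + chi b) \<and>
     (\<forall>c a. chi (c *\<^sub>C a) = c * chi a) \<and>
     (\<forall>a b. chi (a * b) = chi a * chi b) \<and>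
     (\<forall>a. chi (star a) = cnj (chi a)) \<and>
     chi 1 = 1"

definition commutes_with ::
  "'h::complex_inner set \<Rightarrow> ('h \<Rightarrow> 'h) \<Rightarrow> ('a::cstar_algebra \<Rightarrow> 'h \<Rightarrow> 'h) \<Rightarrow> bool" where
  "commutes_with H T \<pi> \<longleftrightarrow> (\<forall>a. \<forall>h\<in>H. T (\<pi> a h) = \<pi> a (T h))"

definition reduces ::
  "'h::complex_inner set \<Rightarrow> 'h set \<Rightarrow> ('a::cstar_algebra \<Rightarrow> 'h \<Rightarrow> 'h) \<Rightarrow> bool" where
  "reduces H M \<pi> \<longleftrightarrow>
     (\<forall>a. \<pi> a ` M \<subseteq> M \<and> \<pi> a ` orth_compl H M \<subseteq> orth_compl H M)"


section \<open>Hyperrigidity\<close>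

definition cstar_subalgebra :: "'a::cstar_algebra set \<Rightarrow> bool" where
  "cstar_subalgebra B \<longleftrightarrow> csubspace B \<and> closed B \<and>
     (\<forall>a\<in>B. \<forall>b\<in>B. a * b \<in> B) \<and> (\<forall>a\<in>B. star a \<in> B)"

definition generates :: "'a::cstar_algebra set \<Rightarrow> bool" where
  "generates G \<longleftrightarrow> (\<Inter>{B. cstar_subalgebra B \<and> G \<subseteq> B \<and> 1 \<in> B}) = UNIV"

text \<open>Positivity of an \<open>n \<times> n\<close> matrix of operators, as an operator on the \<open>n\<close>-fold
  orthogonal sum of \<open>H\<close>.\<close>

definition positive_matrix ::
  "'h::complex_inner set \<Rightarrow> nat \<Rightarrow> (nat \<Rightarrow> nat \<Rightarrow> 'h \<Rightarrow> 'h) \<Rightarrow> bool" where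
  "positive_matrix H n T \<longleftrightarrow>
     (\<forall>h. (\<forall>i<n. h i \<in> H) \<longrightarrow>
        (let q = (\<Sum>i<n. \<Sum>j<n. cinner (T i j (h j)) (h i)) in q \<in> \<real> \<and> 0 \<le> Re q))"

definition ucp :: "'h::complex_inner set \<Rightarrow> (('h \<Rightarrow> 'h) \<Rightarrow> 'h \<Rightarrow> 'h) \<Rightarrow> bool" where
  "ucp H \<Phi> \<longleftrightarrow>
     (\<forall>T\<in>bop H H. \<Phi> T \<in> bop H H) \<and>
     (\<forall>S\<in>bop H H. \<forall>T\<in>bop H H. \<Phi> (\<lambda>x\<in>H. S x + T x) = (\<lambda>x\<in>H. \<Phi> S x + \<Phi> T x)) \<and>
     (\<forall>c. \<forall>T\<in>bop H H. \<Phi> (\<lambda>x\<in>H. c *\<^sub>C T x) = (\<lambda>x\<in>H. c *\<^sub>C \<Phi> T x)) \<and>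
     \<Phi> (\<lambda>x\<in>H. x) = (\<lambda>x\<in>H. x) \<and>
     (\<forall>n T. (\<forall>i<n. \<forall>j<n. T i j \<in> bop H H) \<longrightarrow> positive_matrix H n T \<longrightarrow>
        positive_matrix H n (\<lambda>i j. \<Phi> (T i j)))"

text \<open>The sequence space \<open>\<ell>\<^sup>2\<close> with its inner product. It serves as the universe of separable
  Hilbert spaces: each of them, finite- or infinite-dimensional, is unitarily equivalent to
  a complete subspace of \<open>\<ell>\<^sup>2\<close>.\<close>

typedef ell2 = "{f :: nat \<Rightarrow> complex. summable (\<lambda>n. (cmod (f n))\<^sup>2)}"
  morphisms ell2_nth Abs_ell2
  by (rule exI[of _ "\<lambda>_. 0"]) simp

setup_lifting type_definition_ell2

lemma summable_ell2_mult:
  assumes "summable (\<lambda>n. (cmod (f n))\<^sup>2)" "summable (\<lambda>n. (cmod (g n))\<^sup>2)"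
  shows "summable (\<lambda>n. f n * cnj (g n))"
proof (rule summable_comparison_test')
  show "summable (\<lambda>n. (cmod (f n))\<^sup>2 + (cmod (g n))\<^sup>2)"
    using assms by (rule summable_add)
  show "norm (f n * cnj (g n)) \<le> (cmod (f n))\<^sup>2 + (cmod (g n))\<^sup>2" for n
  proof -
    have "2 * (cmod (f n) * cmod (g n)) \<le> (cmod (f n))\<^sup>2 + (cmod (g n))\<^sup>2"
      using sum_squares_bound[of "cmod (f n)" "cmod (g n)"] by simp
    moreover have "0 \<le> cmod (f n) * cmod (g n)" by simp
    ultimately show ?thesis unfolding norm_mult complex_mod_cnj by linarith
  qed
qed

lemma summable_ell2_add:
  assumes "summable (\<lambda>n. (cmod (f n))\<^sup>2)" "summable (\<lambda>n. (cmod (g n))\<^sup>2)"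
  shows "summable (\<lambda>n. (cmod (f n + g n))\<^sup>2)"
proof (rule summable_comparison_test')
  show "summable (\<lambda>n. 2 * (cmod (f n))\<^sup>2 + 2 * (cmod (g n))\<^sup>2)"
    using assms by (intro summable_add summable_mult)
  show "norm ((cmod (f n + g n))\<^sup>2) \<le> 2 * (cmod (f n))\<^sup>2 + 2 * (cmod (g n))\<^sup>2" for n
  proof -
    have "(cmod (f n + g n))\<^sup>2 \<le> (cmod (f n) + cmod (g n))\<^sup>2"
      by (intro power_mono norm_triangle_ineq) simp
    also have "\<dots> \<le> 2 * (cmod (f n))\<^sup>2 + 2 * (cmod (g n))\<^sup>2"
      using sum_squares_bound[of "cmod (f n)" "cmod (g n)"] by (simp add: power2_sum)
    finally show ?thesis by simp
  qed
qed

instantiation ell2 :: complex_inner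
begin

lift_definition zero_ell2 :: ell2 is "\<lambda>_. 0" by simp
lift_definition uminus_ell2 :: "ell2 \<Rightarrow> ell2" is "\<lambda>f n. - f n" by simp
lift_definition plus_ell2 :: "ell2 \<Rightarrow> ell2 \<Rightarrow> ell2" is "\<lambda>f g n. f n + g n"
  by (rule summable_ell2_add)
lift_definition minus_ell2 :: "ell2 \<Rightarrow> ell2 \<Rightarrow> ell2" is "\<lambda>f g n. f n - g n"
  using summable_ell2_add[of _ "\<lambda>n. - _ n"] by simp
lift_definition scaleC_ell2 :: "complex \<Rightarrow> ell2 \<Rightarrow> ell2" is "\<lambda>c f n. c * f n"
  by (simp add: norm_mult power_mult_distrib summable_mult)
definition scaleR_ell2 :: "real \<Rightarrow> ell2 \<Rightarrow> ell2" where
  "scaleR_ell2 r x = complex_of_real r *\<^sub>C x"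
definition cinner_ell2 :: "ell2 \<Rightarrow> ell2 \<Rightarrow> complex" where
  "cinner_ell2 x y = (\<Sum>n. ell2_nth x n * cnj (ell2_nth y n))"
definition inner_ell2 :: "ell2 \<Rightarrow> ell2 \<Rightarrow> real" where
  "inner_ell2 x y = Re (cinner x y)"
definition norm_ell2 :: "ell2 \<Rightarrow> real" where
  "norm_ell2 x = sqrt (inner x x)"
definition sgn_ell2 :: "ell2 \<Rightarrow> ell2" where
  "sgn_ell2 x = inverse (norm x) *\<^sub>R x"
definition dist_ell2 :: "ell2 \<Rightarrow> ell2 \<Rightarrow> real" where
  "dist_ell2 x y = norm (x - y)"
definition uniformity_ell2 :: "(ell2 \<times> ell2) filter" where
  "uniformity_ell2 = (INF e\<in>{0<..}. principal {(x, y). dist x y < e})"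
definition open_ell2 :: "ell2 set \<Rightarrow> bool" where
  "open_ell2 U \<longleftrightarrow> (\<forall>x\<in>U. \<forall>\<^sub>F (x', y) in uniformity. x' = x \<longrightarrow> y \<in> U)"

instance
proof
  have summ: "summable (\<lambda>n. ell2_nth x n * cnj (ell2_nth y n))" for x y
    using ell2_nth[of x] ell2_nth[of y] by (intro summable_ell2_mult) auto
  have nth_scaleC: "ell2_nth (c *\<^sub>C x) = (\<lambda>n. c * ell2_nth x n)" for c x
    by transfer simp
  have nth_add: "ell2_nth (x + y) = (\<lambda>n. ell2_nth x n + ell2_nth y n)" for x y
    by transfer simp
  have nth_0: "ell2_nth 0 = (\<lambda>n. 0)"
    by transfer simp
  fix x y z :: ell2 and c d :: complex and r s :: real
  show "x + y + z = x + (y + z)" "x + y = y + x" "0 + x = x" "- x + x = 0" "x - y = x + - y"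
    by (transfer; simp add: fun_eq_iff algebra_simps)+
  show sC1: "c *\<^sub>C (x + y) = c *\<^sub>C x + c *\<^sub>C y" for c and x y :: ell2
    by transfer (simp add: fun_eq_iff algebra_simps)
  show sC2: "(c + d) *\<^sub>C x = c *\<^sub>C x + d *\<^sub>C x" for c d and x :: ell2
    by transfer (simp add: fun_eq_iff algebra_simps)
  show sC3: "c *\<^sub>C d *\<^sub>C x = (c * d) *\<^sub>C x" for c d and x :: ell2
    by transfer (simp add: fun_eq_iff algebra_simps)
  show "complex_of_real r *\<^sub>C x = r *\<^sub>R x"
    by (simp add: scaleR_ell2_def)
  show "r *\<^sub>R (x + y) = r *\<^sub>R x + r *\<^sub>R y" "(r + s) *\<^sub>R x = r *\<^sub>R x + s *\<^sub>R x"
    "r *\<^sub>R s *\<^sub>R x = (r * s) *\<^sub>R x"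
    by (simp_all add: scaleR_ell2_def sC1 sC2 sC3)
  show "1 *\<^sub>R x = x"
    unfolding scaleR_ell2_def by transfer (simp add: fun_eq_iff)
  show "dist x y = norm (x - y)" by (fact dist_ell2_def)
  show "sgn x = inverse (norm x) *\<^sub>R x" by (fact sgn_ell2_def)
  show "uniformity = (INF e\<in>{0<..}. principal {(x :: ell2, y). dist x y < e})"
    by (fact uniformity_ell2_def)
  show "open U \<longleftrightarrow> (\<forall>x\<in>U. \<forall>\<^sub>F (x', y) in uniformity. x' = x \<longrightarrow> y \<in> U)" for U :: "ell2 set"
    by (fact open_ell2_def)
  show comm: "cinner x y = cnj (cinner y x)" for x y :: ell2
  proof -
    have "cnj (cinner y x) = (\<Sum>n. cnj (ell2_nth y n * cnj (ell2_nth x n)))"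
      unfolding cinner_ell2_def
      by (rule bounded_linear.suminf[OF bounded_linear_cnj summ])
    then show ?thesis by (simp add: cinner_ell2_def mult.commute)
  qed
  show add: "cinner (x + y) z = cinner x z + cinner y z" for x y z :: ell2
    unfolding cinner_ell2_def
    by (simp add: nth_add distrib_right suminf_add summ)
  show scale: "cinner (c *\<^sub>C x) y = c * cinner x y" for c and x y :: ell2
    unfolding cinner_ell2_def
    by (simp add: nth_scaleC mult.assoc suminf_mult summ)
  show "inner x y = Re (cinner x y)" by (fact inner_ell2_def)
  show "inner x y = inner y x"
    by (simp add: inner_ell2_def comm[of x y])
  show "inner (x + y) z = inner x z + inner y z"
    by (simp add: inner_ell2_def add)
  show "inner (r *\<^sub>R x) y = r * inner x y"
    by (simp add: inner_ell2_def scaleR_ell2_def scale)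
  show "norm x = sqrt (inner x x)" by (fact norm_ell2_def)
  have sq: "summable (\<lambda>n. (cmod (ell2_nth x n))\<^sup>2)" for x
    using ell2_nth[of x] by simp
  have inner_sq: "inner x x = (\<Sum>n. (cmod (ell2_nth x n))\<^sup>2)" for x :: ell2
  proof -
    have "inner x x = (\<Sum>n. Re (ell2_nth x n * cnj (ell2_nth x n)))"
      unfolding inner_ell2_def cinner_ell2_def
      by (rule bounded_linear.suminf[OF bounded_linear_Re summ])
    then show ?thesis
      by (simp add: complex_mult_cnj cmod_power2 del: complex_cnj_cancel_iff)
  qed
  show "0 \<le> inner x x"
    unfolding inner_sq by (rule suminf_nonneg[OF sq]) simp
  show "inner x x = 0 \<longleftrightarrow> x = 0"
  proof -
    have "inner x x = 0 \<longleftrightarrow> (\<forall>n. ell2_nth x n = 0)"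
      unfolding inner_sq using suminf_eq_zero_iff[OF sq[of x]] by simp
    also have "\<dots> \<longleftrightarrow> ell2_nth x = ell2_nth 0"
      by (simp add: nth_0 fun_eq_iff)
    finally show ?thesis by (simp add: ell2_nth_inject)
  qed
qed

end

definition hyperrigid :: "'a::cstar_algebra set \<Rightarrow> bool" where
  "hyperrigid G \<longleftrightarrow> countable G \<and> generates G \<and>
     (\<forall>(H :: ell2 set) (\<pi> :: 'a \<Rightarrow> ell2 \<Rightarrow> ell2) (\<Phi> :: nat \<Rightarrow> (ell2 \<Rightarrow> ell2) \<Rightarrow> ell2 \<Rightarrow> ell2).
        separable_hilbert H \<longrightarrow> faithful_representation H \<pi> \<longrightarrow> (\<forall>k. ucp H (\<Phi> k)) \<longrightarrow>
        (\<forall>g\<in>G. (\<lambda>k. op_norm H (\<lambda>x\<in>H. \<Phi> k (\<pi> g) x - \<pi> g x)) \<longlonglongrightarrow> 0) \<longrightarrow>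
        (\<forall>a. (\<lambda>k. op_norm H (\<lambda>x\<in>H. \<Phi> k (\<pi> a) x - \<pi> a x)) \<longlonglongrightarrow> 0))"


section \<open>Isometric decompositions relative to a character\<close>

definition orth_sum :: "'h::complex_inner set \<Rightarrow> 'h set \<Rightarrow> 'h set \<Rightarrow> bool" where
  "orth_sum H H0 H1 \<longleftrightarrow>
     H = {x + y |x y. x \<in> H0 \<and> y \<in> H1} \<and> (\<forall>x\<in>H0. \<forall>y\<in>H1. cinner x y = 0)"

text \<open>\<open>R = R0 \<oplus> R1\<close> with respect to \<open>H = H0 \<oplus> H1\<close> and \<open>K = K0 \<oplus> K1\<close>.\<close>

definition op_direct_sum ::
  "'h::complex_inner set \<Rightarrow> 'h set \<Rightarrow> 'k::complex_inner set \<Rightarrow> 'k set \<Rightarrow>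
   ('h \<Rightarrow> 'k) \<Rightarrow> ('h \<Rightarrow> 'k) \<Rightarrow> ('h \<Rightarrow> 'k) \<Rightarrow> bool" where
  "op_direct_sum H0 H1 K0 K1 R R0 R1 \<longleftrightarrow>
     R0 \<in> bop H0 K0 \<and> R1 \<in> bop H1 K1 \<and> (\<forall>x\<in>H0. \<forall>y\<in>H1. R (x + y) = R0 x + R1 y)"

definition isometric_decomposition ::
  "('a::cstar_algebra \<Rightarrow> complex) \<Rightarrow> 'h::complex_inner set \<Rightarrow> 'k::complex_inner set \<Rightarrow>
   ('a \<Rightarrow> 'h \<Rightarrow> 'h) \<Rightarrow> ('a \<Rightarrow> 'k \<Rightarrow> 'k) \<Rightarrow> ('h \<Rightarrow> 'k) \<Rightarrow>
   'h set \<Rightarrow> 'h set \<Rightarrow> 'k set \<Rightarrow> 'k set \<Rightarrow> bool" where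
  "isometric_decomposition chi H K \<pi> \<rho> R H0 H1 K0 K1 \<longleftrightarrow>
     closed_csubspace H H0 \<and> closed_csubspace H H1 \<and>
     closed_csubspace K K0 \<and> closed_csubspace K K1 \<and>
     orth_sum H H0 H1 \<and> orth_sum K K0 K1 \<and>
     reduces H H0 \<pi> \<and> reduces H H1 \<pi> \<and> reduces K K0 \<rho> \<and> reduces K K1 \<rho> \<and>
     (\<forall>a. \<forall>h\<in>H1. \<pi> a h = chi a *\<^sub>C h) \<and>
     (\<forall>a. \<forall>k\<in>K1. \<rho> a k = chi a *\<^sub>C k) \<and>
     (\<exists>R0 R1. op_direct_sum H0 H1 K0 K1 R R0 R1 \<and> isometric H0 K0 R0 \<and>
        (\<forall>a. \<forall>h\<in>H0. \<pi> a h = adj H0 K0 R0 (\<rho> a (R0 h))))"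

end

theory Submission
  imports Defs
begin

text \<open>
  Write \<open>\<Delta> = I - R* R\<close>. Everything rests on the formula \<open>\<pi> a = R* \<rho>(a) R + \<chi>(a) \<Delta>\<close> for all
  \<open>a\<close>, not only on \<open>G\<close> (lemma \<open>hyperrigid_dilation_formula\<close>). Its right-hand side is a
  unital completely positive map; on \<open>G\<close> it reduces to \<open>R* \<rho>(g) R = \<pi> g\<close> because \<open>\<chi>\<close>
  vanishes there; and a hyperrigid set has the unique extension property (lemma
  \<open>unique_extension_property\<close>): a UCP map that agrees with a representation on \<open>G\<close> agrees
  with it everywhere.

  Given the formula, \<open>V h = (R h, sqrt \<Delta> h)\<close> is an isometry that compresses \<open>\<rho> \<oplus> \<chi>\<close> to
  \<open>\<pi>\<close>. As \<open>\<pi>\<close> is multiplicative, the range of \<open>V\<close> is invariant, that is \<open>\<rho>(a) R = R \<pi>(a)\<close>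
  and \<open>\<Delta> \<pi>(a) = \<chi>(a) \<Delta>\<close> (lemmas \<open>intertwine\<close> and \<open>defect_rep\<close>). Taking adjoints gives the
  two commutation relations, and shows that \<open>\<pi>\<close> acts by \<open>\<chi>\<close> on \<open>H1\<close>, the closed range of
  \<open>\<Delta>\<close>, and \<open>\<rho>\<close> on \<open>K1\<close>, the closure of \<open>R (\<Delta> H)\<close>. The orthogonal complement \<open>H0\<close> is the
  kernel of \<open>\<Delta>\<close>, where \<open>R\<close> is isometric; on \<open>H1\<close> no non-zero vector keeps its norm, and
  the image of \<open>H1\<close> under \<open>R\<close> is dense in \<open>K1\<close> by the choice of \<open>K1\<close>.

  The unique extension property needs preparation, since hyperrigidity is a statement
  about faithful representations on subspaces of \<open>\<ell>\<^sup>2\<close>. The UCP map is embedded as a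
  corner of a UCP map on the space of \<open>\<pi> \<oplus> \<rho> \<oplus> \<chi> \<oplus> \<tau>\<close> with a faithful representation \<open>\<tau>\<close>.
  It is given by an explicit formula there, so Arveson's extension theorem can be avoided.
  That \<open>\<tau>\<close> exists on a separable space is the theorem of Gelfand and Naimark for separable
  algebras (theorem \<open>faithful_separable_representation\<close>). Its proof uses no spectral
  theory: square roots come from the binomial series, and \<open>a* a\<close> is shown to be positive
  by estimating norms of powers (theorem \<open>positive_star_mult\<close>); the states come from the
  Hahn--Banach theorem, and on a separable algebra countably many of them add up to a
  faithful one.

  One lemma serves three times: a positive semidefinite form on a separable space can be
  realised in \<open>\<ell>\<^sup>2\<close> by iterated Schur complements (lemma \<open>ell2_realisation\<close>). Applied to
  the inner product, it embeds a separable Hilbert space; applied to the form \<open>\<langle>a, b\<rangle> = F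
  (b* a)\<close> of a positive functional \<open>F\<close>, it is the GNS construction; applied to the form of
  \<open>\<Delta>\<close>, it replaces the square root of \<open>\<Delta>\<close>.
\<close>


section \<open>Complex vector spaces and inner products\<close>

lemma scaleC_zero_left [simp]: "0 *\<^sub>C x = (0 :: 'a::complex_vector)"
  using scaleC_of_real[of 0 x] by simp

lemma scaleC_one [simp]: "1 *\<^sub>C x = (x :: 'a::complex_vector)"
  using scaleC_of_real[of 1 x] by simp

lemma scaleC_zero_right [simp]: "c *\<^sub>C 0 = (0 :: 'a::complex_vector)"
  using scaleC_add_right[of c 0 0] by simp

lemma scaleC_minus_one: "(-1) *\<^sub>C x = - (x :: 'a::complex_vector)"
  using scaleC_of_real[of "-1" x] by simp

lemma scaleC_minus_left: "(- c) *\<^sub>C x = - (c *\<^sub>C (x :: 'a::complex_vector))"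
  by (simp add: scaleC_scaleC flip: scaleC_minus_one)

lemma scaleC_minus_right: "c *\<^sub>C (- x) = - (c *\<^sub>C (x :: 'a::complex_vector))"
  by (simp add: scaleC_scaleC mult.commute flip: scaleC_minus_one)

lemma scaleC_diff_right: "c *\<^sub>C (x - y) = c *\<^sub>C x - c *\<^sub>C (y :: 'a::complex_vector)"
  using scaleC_add_right[of c x "- y"] by (simp add: scaleC_minus_right)

lemma scaleC_diff_left: "(c - d) *\<^sub>C x = c *\<^sub>C x - d *\<^sub>C (x :: 'a::complex_vector)"
  using scaleC_add_left[of c "- d" x] by (simp add: scaleC_minus_left)

lemmas scaleC_simps = scaleC_add_left scaleC_add_right scaleC_diff_left scaleC_diff_right
  scaleC_minus_left scaleC_minus_right

lemma scaleC_scaleR: "c *\<^sub>C (r *\<^sub>R x) = r *\<^sub>R (c *\<^sub>C (x :: 'a::complex_vector))"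
  by (simp add: scaleC_scaleC mult.commute flip: scaleC_of_real)

lemma csubspaceD:
  assumes "csubspace M"
  shows "0 \<in> M" "x \<in> M \<Longrightarrow> y \<in> M \<Longrightarrow> x + y \<in> M" "x \<in> M \<Longrightarrow> c *\<^sub>C x \<in> M"
    "x \<in> M \<Longrightarrow> - x \<in> M" "x \<in> M \<Longrightarrow> y \<in> M \<Longrightarrow> x - y \<in> M" "x \<in> M \<Longrightarrow> r *\<^sub>R x \<in> M"
proof -
  show *: "0 \<in> M" "x \<in> M \<Longrightarrow> y \<in> M \<Longrightarrow> x + y \<in> M" "x \<in> M \<Longrightarrow> c *\<^sub>C x \<in> M" for c x y
    using assms by (auto simp: csubspace_def)
  show **: "x \<in> M \<Longrightarrow> - x \<in> M" for x
    using *(3)[of x "-1"] by (simp add: scaleC_minus_one)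
  show "x \<in> M \<Longrightarrow> y \<in> M \<Longrightarrow> x - y \<in> M"
    using *(2)[of x "- y"] **[of y] by simp
  show "x \<in> M \<Longrightarrow> r *\<^sub>R x \<in> M"
    using *(3)[of x "complex_of_real r"] by (simp add: scaleC_of_real)
qed

lemma csubspace_UNIV [simp]: "csubspace UNIV"
  by (simp add: csubspace_def)

lemma mult_cnj_self: "z * cnj z = (complex_of_real (cmod z))\<^sup>2"
  using complex_norm_square[of z] by simp


section \<open>Positive semidefinite sesquilinear forms\<close>

locale psd_form =
  fixes V :: "'v::complex_vector set" and B :: "'v \<Rightarrow> 'v \<Rightarrow> complex"
  assumes csub: "csubspace V"
    and add_left: "x \<in> V \<Longrightarrow> y \<in> V \<Longrightarrow> z \<in> V \<Longrightarrow> B (x + y) z = B x z + B y z"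
    and scale_left: "x \<in> V \<Longrightarrow> z \<in> V \<Longrightarrow> B (c *\<^sub>C x) z = c * B x z"
    and herm: "x \<in> V \<Longrightarrow> y \<in> V \<Longrightarrow> B x y = cnj (B y x)"
    and nonneg: "x \<in> V \<Longrightarrow> 0 \<le> Re (B x x)"
begin

lemma add_right: "x \<in> V \<Longrightarrow> y \<in> V \<Longrightarrow> z \<in> V \<Longrightarrow> B x (y + z) = B x y + B x z"
  using herm[of x "y + z"] herm[of x y] herm[of x z] add_left[of y z x] csubspaceD[OF csub] by simp

lemma scale_right: "x \<in> V \<Longrightarrow> y \<in> V \<Longrightarrow> B x (c *\<^sub>C y) = cnj c * B x y"
  using herm[of x "c *\<^sub>C y"] herm[of x y] scale_left[of y x c] csubspaceD[OF csub] by simp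

lemma minus_left: "x \<in> V \<Longrightarrow> y \<in> V \<Longrightarrow> B (- x) y = - B x y"
  using scale_left[of x y "-1"] by (simp add: scaleC_minus_one)

lemma minus_right: "x \<in> V \<Longrightarrow> y \<in> V \<Longrightarrow> B x (- y) = - B x y"
  using scale_right[of x y "-1"] by (simp add: scaleC_minus_one)

lemma diff_left: "x \<in> V \<Longrightarrow> y \<in> V \<Longrightarrow> z \<in> V \<Longrightarrow> B (x - y) z = B x z - B y z"
  using add_left[of x "- y" z] minus_left[of y z] csubspaceD[OF csub] by simp

lemma diff_right: "x \<in> V \<Longrightarrow> y \<in> V \<Longrightarrow> z \<in> V \<Longrightarrow> B x (y - z) = B x y - B x z"
  using add_right[of x y "- z"] minus_right[of x z] csubspaceD[OF csub] by simp

lemma diag_real: "x \<in> V \<Longrightarrow> B x x = complex_of_real (Re (B x x))"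
  using herm[of x x] by (simp add: complex_eq_iff)

lemma Re_diff_diff:
  assumes "x \<in> V" "y \<in> V"
  shows "Re (B (x - y) (x - y)) = Re (B x x) - 2 * Re (B x y) + Re (B y y)"
  using assms herm[of y x] csubspaceD[OF csub]
  by (simp add: diff_left diff_right)

lemma cauchy_schwarz:
  assumes "x \<in> V" "y \<in> V"
  shows "(cmod (B x y))\<^sup>2 \<le> Re (B x x) * Re (B y y)"
proof -
  let ?b = "B x y" and ?a = "Re (B x x)" and ?c = "Re (B y y)"
  have *: "0 \<le> ?a - 2 * s * (cmod ?b)\<^sup>2 + s\<^sup>2 * (cmod ?b)\<^sup>2 * ?c" for s :: real
  proof -
    let ?t = "complex_of_real s * ?b"
    have m: "?t *\<^sub>C y \<in> V" using assms csubspaceD[OF csub] by auto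
    have "B x (?t *\<^sub>C y) = complex_of_real (s * (cmod ?b)\<^sup>2)"
      using assms by (simp add: scale_right mult.assoc mult.commute[of "cnj _"] mult_cnj_self)
    moreover have "B (?t *\<^sub>C y) (?t *\<^sub>C y) = ?t * cnj ?t * B y y"
      using assms m by (simp add: scale_left scale_right)
    moreover have "?t * cnj ?t = complex_of_real (s\<^sup>2 * (cmod ?b)\<^sup>2)"
      using mult_cnj_self[of "B x y"] by (simp add: power2_eq_square algebra_simps)
    ultimately show ?thesis
      using nonneg[of "x - ?t *\<^sub>C y"] Re_diff_diff[OF assms(1) m] assms m csubspaceD[OF csub]
      by simp
  qed
  show ?thesis
  proof (cases "?c = 0")
    case True
    \<comment> \<open>The quadratic bound degenerates to a linear one, so its slope must vanish.\<close>
    have "?b = 0"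
    proof (rule ccontr)
      assume "?b \<noteq> 0"
      then have "0 < (cmod ?b)\<^sup>2" by simp
      then show False
        using *[of "(?a + 1) / (2 * (cmod ?b)\<^sup>2)"] True by (simp add: field_simps)
    qed
    then show ?thesis using True by simp
  next
    case False
    then have c: "?c > 0" using nonneg[OF assms(2)] by simp
    have "0 \<le> ?a - (cmod ?b)\<^sup>2 / ?c"
      using *[of "1 / ?c"] c by (simp add: field_simps power2_eq_square)
    then show ?thesis using c by (simp add: field_simps)
  qed
qed

lemma null_left: "x \<in> V \<Longrightarrow> y \<in> V \<Longrightarrow> Re (B x x) = 0 \<Longrightarrow> B x y = 0"
  using cauchy_schwarz[of x y] by simp

end

lemma psd_formI:
  assumes "csubspace V"
    and "\<And>x y z. x \<in> V \<Longrightarrow> y \<in> V \<Longrightarrow> z \<in> V \<Longrightarrow> B (x + y) z = B x z + B y z"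
    and "\<And>x z c. x \<in> V \<Longrightarrow> z \<in> V \<Longrightarrow> B (c *\<^sub>C x) z = c * B x z"
    and "\<And>x y. x \<in> V \<Longrightarrow> y \<in> V \<Longrightarrow> B x y = cnj (B y x)"
    and "\<And>x. x \<in> V \<Longrightarrow> 0 \<le> Re (B x x)"
  shows "psd_form V B"
  using assms by unfold_locales

lemma psd_form_cinner: "csubspace H \<Longrightarrow> psd_form H (cinner :: 'h::complex_inner \<Rightarrow> 'h \<Rightarrow> complex)"
  by (rule psd_formI)
     (auto simp: cinner_add_left cinner_scaleC_left intro: cinner_commute simp flip: inner_eq_Re_cinner)

interpretation cinner: psd_form UNIV "cinner :: 'h::complex_inner \<Rightarrow> 'h \<Rightarrow> complex"
  by (rule psd_form_cinner) simp

lemma cinner_self: "cinner x x = complex_of_real ((norm x)\<^sup>2)" for x :: "'h::complex_inner"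
  using cinner.diag_real[of x] by (simp add: power2_norm_eq_inner inner_eq_Re_cinner)

lemma cinner_simps [simp]:
  fixes x y z :: "'h::complex_inner"
  shows "cinner (x + y) z = cinner x z + cinner y z" "cinner x (y + z) = cinner x y + cinner x z"
    "cinner (x - y) z = cinner x z - cinner y z" "cinner x (y - z) = cinner x y - cinner x z"
    "cinner (- x) z = - cinner x z" "cinner x (- z) = - cinner x z"
    "cinner (c *\<^sub>C x) z = c * cinner x z" "cinner x (c *\<^sub>C z) = cnj c * cinner x z"
    "cinner 0 z = 0" "cinner x 0 = 0"
  using cinner.scale_left[of 0 z 0] cinner.scale_right[of x 0 0]
  by (auto simp: cinner.add_left cinner.add_right cinner.diff_left cinner.diff_right
      cinner.minus_left cinner.minus_right cinner.scale_left cinner.scale_right)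

lemma norm_eq_Re_cinner: "(norm x)\<^sup>2 = Re (cinner x x)" for x :: "'h::complex_inner"
  by (simp add: cinner_self)

lemma cinner_norm_le: "cmod (cinner x y) \<le> norm x * norm y" for x y :: "'h::complex_inner"
  using cinner.cauchy_schwarz[of x y]
  by (simp add: cinner_self flip: power_mult_distrib)

lemma norm_scaleC_inner: "norm (c *\<^sub>C x) = cmod c * norm x" for x :: "'h::complex_inner"
proof -
  have "cinner (c *\<^sub>C x) (c *\<^sub>C x) = c * cnj c * cinner x x" by simp
  also have "\<dots> = complex_of_real ((cmod c * norm x)\<^sup>2)"
    by (simp add: cinner_self mult_cnj_self power_mult_distrib)
  finally have "(norm (c *\<^sub>C x))\<^sup>2 = (cmod c * norm x)\<^sup>2"
    by (simp only: norm_eq_Re_cinner Re_complex_of_real)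
  then show ?thesis by (simp add: power2_eq_iff_nonneg)
qed

lemma norm_eq_of_cinner_eq:
  fixes x :: "'h::complex_inner" and y :: "'k::complex_inner"
  assumes "cinner x x = cinner y y"
  shows "norm x = norm y"
proof -
  have "(norm x)\<^sup>2 = (norm y)\<^sup>2" using assms by (simp add: norm_eq_Re_cinner)
  then show ?thesis by (simp add: power2_eq_iff_nonneg)
qed

lemma bounded_bilinear_cinner: "bounded_bilinear (cinner :: 'h::complex_inner \<Rightarrow> 'h \<Rightarrow> complex)"
proof
  show "cinner (r *\<^sub>R a) b = r *\<^sub>R cinner a b" "cinner a (r *\<^sub>R b) = r *\<^sub>R cinner a b" for r and a b :: 'h
    by (simp_all flip: scaleC_of_real add: scaleR_conv_of_real)
  show "\<exists>K. \<forall>a b :: 'h. norm (cinner a b) \<le> norm a * norm b * K"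
    by (rule exI[of _ 1]) (simp add: cinner_norm_le)
qed simp_all

lemmas tendsto_cinner [tendsto_intros] = bounded_bilinear.tendsto[OF bounded_bilinear_cinner]

lemmas continuous_on_cinner [continuous_intros] =
  bounded_bilinear.continuous_on[OF bounded_bilinear_cinner]

lemma cinner_zero_imp_zero:
  assumes "x \<in> H" "\<And>y. y \<in> H \<Longrightarrow> cinner x y = 0"
  shows "(x :: 'h::complex_inner) = 0"
  using assms(2)[OF assms(1)] by (simp add: cinner_self)

lemma cinner_eq_imp_eq:
  assumes "csubspace H" "x \<in> H" "y \<in> H" "\<And>z. z \<in> H \<Longrightarrow> cinner z x = cinner z y"
  shows "(x :: 'h::complex_inner) = y"
proof -
  have "cinner z (x - y) = 0" if "z \<in> H" for z using assms(4)[OF that] by simp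
  then have "x - y = 0"
    using csubspaceD(5)[OF assms(1-3)] by (metis cinner_self norm_eq_zero of_real_eq_0_iff zero_eq_power2)
  then show ?thesis by simp
qed

lemma tendsto_scaleC [tendsto_intros]:
  fixes f :: "'b \<Rightarrow> 'h::complex_inner"
  assumes "(f \<longlongrightarrow> l) F"
  shows "((\<lambda>x. c *\<^sub>C f x) \<longlongrightarrow> c *\<^sub>C l) F"
proof -
  have "bounded_linear (\<lambda>x :: 'h. c *\<^sub>C x)"
    by (rule bounded_linear_intro[of _ "cmod c"])
       (auto simp: scaleC_simps scaleC_scaleR norm_scaleC_inner mult.commute)
  from bounded_linear.tendsto[OF this assms] show ?thesis .
qed


section \<open>Realising forms in \<open>\<ell>\<^sup>2\<close>\<close>

text \<open>Subtracting the rank-one part of a form along \<open>d\<close> leaves a form that has \<open>d\<close> in its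
  kernel; by the Cauchy--Schwarz inequality it is still positive. This is the Schur complement,
  one step of a Cholesky factorisation. Division by zero is harmless here: if \<open>B d d = 0\<close>
  then \<open>d\<close> is already in the kernel.\<close>

definition schur_complement :: "('v \<Rightarrow> 'v \<Rightarrow> complex) \<Rightarrow> 'v \<Rightarrow> 'v \<Rightarrow> 'v \<Rightarrow> complex" where
  "schur_complement B d x y = B x y - B x d * cnj (B y d) / B d d"

context psd_form begin

lemma psd_schur_complement:
  assumes "d \<in> V"
  shows "psd_form V (schur_complement B d)"
proof (rule psd_formI)
  fix x assume x: "x \<in> V"
  have "B x d * cnj (B x d) / B d d = complex_of_real ((cmod (B x d))\<^sup>2 / Re (B d d))"
    by (subst diag_real[OF assms]) (simp only: of_real_divide complex_norm_square)
  moreover have "(cmod (B x d))\<^sup>2 / Re (B d d) \<le> Re (B x x)"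
    using cauchy_schwarz[OF x assms] nonneg[OF assms] nonneg[OF x]
    by (cases "Re (B d d) = 0") (simp_all add: field_simps)
  ultimately show "0 \<le> Re (schur_complement B d x x)" by (simp add: schur_complement_def)
next
  fix x y assume "x \<in> V" "y \<in> V"
  then show "schur_complement B d x y = cnj (schur_complement B d y x)"
    using assms herm[of x y] herm[of d d] by (simp add: schur_complement_def mult.commute)
qed (use assms csub in \<open>auto simp: schur_complement_def add_left scale_left algebra_simps
       add_divide_distrib\<close>)

lemma schur_complement_kernel:
  assumes "d \<in> V" "y \<in> V"
  shows "schur_complement B d d y = 0"
proof (cases "B d d = 0")
  case True
  then show ?thesis using null_left[OF assms] by (simp add: schur_complement_def)
next
  case False
  then show ?thesis using herm[OF assms] by (simp add: schur_complement_def)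
qed

end

primrec schur_residual :: "('v \<Rightarrow> 'v \<Rightarrow> complex) \<Rightarrow> (nat \<Rightarrow> 'v) \<Rightarrow> nat \<Rightarrow> 'v \<Rightarrow> 'v \<Rightarrow> complex" where
  "schur_residual B d 0 = B"
| "schur_residual B d (Suc n) = schur_complement (schur_residual B d n) (d n)"

text \<open>For the forms used below, density with respect to the form is inherited from density in norm.\<close>

lemma (in psd_form) dense_if_norm_dense:
  fixes N :: "'v \<Rightarrow> real"
  assumes "\<And>e. 0 < e \<Longrightarrow> \<exists>d\<in>D. N (x - d) < e" "D \<subseteq> V" "x \<in> V"
    and "\<And>y. y \<in> V \<Longrightarrow> 0 \<le> N y" "\<And>y. y \<in> V \<Longrightarrow> Re (B y y) \<le> (N y)\<^sup>2" "0 < e"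
  shows "\<exists>d\<in>D. Re (B (x - d) (x - d)) < e"
proof -
  obtain d where d: "d \<in> D" "N (x - d) < sqrt e" using assms(1)[of "sqrt e"] \<open>0 < e\<close> by auto
  then have V: "x - d \<in> V" using assms(2,3) csubspaceD(5)[OF csub] by blast
  have "Re (B (x - d) (x - d)) \<le> (N (x - d))\<^sup>2" by (rule assms(5)[OF V])
  also have "\<dots> < (sqrt e)\<^sup>2" using d(2) assms(4)[OF V] by (intro power_strict_mono) auto
  finally show ?thesis using d(1) \<open>0 < e\<close> by auto
qed

text \<open>Iterating the Schur complement along a dense sequence exhausts the form, and the rank-one
  parts that were split off are the coordinates of a map into \<open>\<ell>\<^sup>2\<close>. For a Hilbert space this is
  the expansion in an orthonormal basis, for the form of a positive functional on an algebra it
  is the space of the GNS construction, and for the form of a positive operator it is a square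
  root.\<close>

lemma (in psd_form) ell2_realisation:
  assumes "countable D" "D \<subseteq> V"
    and dense: "\<And>x e. x \<in> V \<Longrightarrow> 0 < e \<Longrightarrow> \<exists>d\<in>D. Re (B (x - d) (x - d)) < e"
  obtains U :: "'v \<Rightarrow> ell2" where
    "\<And>x y. x \<in> V \<Longrightarrow> y \<in> V \<Longrightarrow> U (x + y) = U x + U y"
    "\<And>c x. x \<in> V \<Longrightarrow> U (c *\<^sub>C x) = c *\<^sub>C U x"
    "\<And>x y. x \<in> V \<Longrightarrow> y \<in> V \<Longrightarrow> cinner (U x) (U y) = B x y"
proof -
  have "D \<noteq> {}" using dense[of 0 1] csubspaceD(1)[OF csub] by auto
  define d where "d = from_nat_into D"
  have range_d: "range d = D" unfolding d_def by (rule range_from_nat_into) fact+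
  have dV: "d n \<in> V" for n using range_d assms(2) by auto
  define C where "C = schur_residual B d"
  have C0: "C 0 = B" and CS: "C (Suc n) = schur_complement (C n) (d n)" for n
    by (simp_all add: C_def)
  have psd: "psd_form V (C n)" for n
    by (induction n) (auto simp: C0 CS psd_form_axioms intro!: psd_form.psd_schur_complement dV)
  define u where "u n x = C n x (d n) / complex_of_real (sqrt (Re (C n (d n) (d n))))" for n x
  have u_prod: "u n x * cnj (u n y) = C n x (d n) * cnj (C n y (d n)) / C n (d n) (d n)" for n x y
  proof -
    have "complex_of_real (sqrt (Re (C n (d n) (d n)))) * complex_of_real (sqrt (Re (C n (d n) (d n))))
        = C n (d n) (d n)"
      by (subst (3) psd_form.diag_real[OF psd dV])
         (simp add: psd_form.nonneg[OF psd dV] flip: of_real_mult)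
    then show ?thesis by (simp add: u_def)
  qed
  have split: "B x y = (\<Sum>k<n. u k x * cnj (u k y)) + C n x y" for n x y
    by (induction n) (simp_all add: C0 CS u_prod schur_complement_def)
  have kernel: "\<forall>y\<in>V. C n (d k) y = 0" if "k < n" for n k
    using that
  proof (induction n)
    case (Suc n)
    show ?case
    proof (cases "k = n")
      case True
      then show ?thesis using psd_form.schur_complement_kernel[OF psd dV] by (simp add: CS)
    next
      case False
      then show ?thesis using Suc dV by (simp add: CS schur_complement_def)
    qed
  qed simp
  have decr: "Re (C n x x) \<le> Re (B x x)" if "x \<in> V" for n x
  proof -
    have "Re (u k x * cnj (u k x)) \<ge> 0" for k by (simp add: complex_mult_cnj)
    then show ?thesis using split[of x x n] by (simp add: sum_nonneg)
  qed
  have C_diag: "(\<lambda>n. Re (C n x x)) \<longlonglongrightarrow> 0" if x: "x \<in> V" for x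
  proof (rule LIMSEQ_I)
    fix e :: real assume "e > 0"
    then obtain k where k: "Re (B (x - d k) (x - d k)) < e"
      using dense[OF x] range_d by blast
    have "norm (Re (C n x x) - 0) < e" if "n \<ge> Suc k" for n
    proof -
      have "C n (d k) y = 0" if "y \<in> V" for y using kernel[of k n] that \<open>n \<ge> Suc k\<close> by simp
      then have "Re (C n (x - d k) (x - d k)) = Re (C n x x)"
        using psd_form.Re_diff_diff[OF psd x dV] psd_form.herm[OF psd x dV] x dV by simp
      then show ?thesis
        using decr[of "x - d k" n] k psd_form.nonneg[OF psd x, of n] csubspaceD(5)[OF csub x dV] by simp
    qed
    then show "\<exists>no. \<forall>n\<ge>no. norm (Re (C n x x) - 0) < e" by blast
  qed
  have C_lim: "(\<lambda>n. C n x y) \<longlonglongrightarrow> 0" if x: "x \<in> V" and y: "y \<in> V" for x y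
  proof -
    have "(\<lambda>n. (cmod (C n x y))\<^sup>2) \<longlonglongrightarrow> 0"
    proof (rule tendsto_sandwich[OF _ _ tendsto_const])
      show "(\<lambda>n. Re (C n x x) * Re (C n y y)) \<longlonglongrightarrow> 0"
        using tendsto_mult[OF C_diag[OF x] C_diag[OF y]] by simp
    qed (auto intro!: always_eventually psd_form.cauchy_schwarz[OF psd x y])
    then have "(\<lambda>n. sqrt ((cmod (C n x y))\<^sup>2)) \<longlonglongrightarrow> sqrt 0" by (rule tendsto_real_sqrt)
    then show ?thesis by (simp add: tendsto_norm_zero_iff)
  qed
  have sums: "(\<lambda>k. u k x * cnj (u k y)) sums B x y" if x: "x \<in> V" and y: "y \<in> V" for x y
  proof -
    have "(\<lambda>n. B x y - C n x y) \<longlonglongrightarrow> B x y - 0"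
      by (intro tendsto_intros C_lim x y)
    moreover have "B x y - C n x y = (\<Sum>k<n. u k x * cnj (u k y))" for n
      using split[of x y n] by (metis add_diff_cancel_right')
    ultimately show ?thesis by (simp add: sums_def)
  qed
  have in_ell2: "summable (\<lambda>k. (cmod (u k x))\<^sup>2)" if "x \<in> V" for x
  proof -
    have "summable (\<lambda>k. Re (u k x * cnj (u k x)))"
      using sums[OF that that] by (intro summable_Re) (auto simp: sums_iff)
    then show ?thesis by (simp add: complex_mult_cnj cmod_power2)
  qed
  define U where "U x = Abs_ell2 (\<lambda>k. u k x)" for x
  have nth_U: "ell2_nth (U x) = (\<lambda>k. u k x)" if "x \<in> V" for x
    using in_ell2[OF that] by (simp add: U_def Abs_ell2_inverse)
  show thesis
  proof (rule that[of U])
    fix x y c assume x: "x \<in> V" and y: "y \<in> V"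
    have "ell2_nth (U (x + y)) = ell2_nth (U x + U y)"
      using x y psd_form.add_left[OF psd x y dV] csubspaceD[OF csub]
      by (simp add: nth_U plus_ell2.rep_eq u_def add_divide_distrib)
    then show "U (x + y) = U x + U y" by (simp add: ell2_nth_inject)
    show "cinner (U x) (U y) = B x y"
      using sums[OF x y] x y by (simp add: cinner_ell2_def nth_U sums_iff)
  next
    fix x c assume x: "x \<in> V"
    have "ell2_nth (U (c *\<^sub>C x)) = ell2_nth (c *\<^sub>C U x)"
      using x psd_form.scale_left[OF psd x dV] csubspaceD[OF csub]
      by (simp add: nth_U scaleC_ell2.rep_eq u_def)
    then show "U (c *\<^sub>C x) = c *\<^sub>C U x" by (simp add: ell2_nth_inject)
  qed
qed

text \<open>The space of the GNS construction below is a closure inside \<open>\<ell>\<^sup>2\<close>; it is a Hilbert space because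
  \<open>\<ell>\<^sup>2\<close> is complete.\<close>

instance ell2 :: complete_space
proof
  fix X :: "nat \<Rightarrow> ell2" assume X: "Cauchy X"
  have norm2: "(norm x)\<^sup>2 = (\<Sum>n. (cmod (ell2_nth x n))\<^sup>2)"
    and summ: "summable (\<lambda>n. (cmod (ell2_nth x n))\<^sup>2)" for x :: ell2
  proof -
    show s: "summable (\<lambda>n. (cmod (ell2_nth x n))\<^sup>2)" using ell2_nth[of x] by simp
    have "cinner x x = (\<Sum>n. complex_of_real ((cmod (ell2_nth x n))\<^sup>2))"
      unfolding cinner_ell2_def by (simp only: complex_norm_square)
    then show "(norm x)\<^sup>2 = (\<Sum>n. (cmod (ell2_nth x n))\<^sup>2)"
      using s by (simp add: norm_eq_Re_cinner suminf_of_real[symmetric] del: of_real_power)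
  qed
  have part: "(\<Sum>n<N. (cmod (ell2_nth x n))\<^sup>2) \<le> (norm x)\<^sup>2" for N x
    unfolding norm2 by (rule sum_le_suminf[OF summ]) auto
  have nth_diff: "ell2_nth (x - y) n = ell2_nth x n - ell2_nth y n" for x y n
    by (simp add: minus_ell2.rep_eq)
  have coord: "cmod (ell2_nth x n) \<le> norm x" for x n
  proof -
    have "(cmod (ell2_nth x n))\<^sup>2 \<le> (\<Sum>k<Suc n. (cmod (ell2_nth x k))\<^sup>2)"
      by (simp add: sum_nonneg)
    also note part
    finally show ?thesis by (simp add: abs_le_square_iff[symmetric])
  qed
  have "Cauchy (\<lambda>k. ell2_nth (X k) n)" for n
    unfolding Cauchy_iff
  proof (intro allI impI)
    fix e :: real assume "e > 0"
    then obtain M where M: "\<forall>m\<ge>M. \<forall>k\<ge>M. norm (X m - X k) < e" using X by (auto simp: Cauchy_iff)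
    show "\<exists>M. \<forall>m\<ge>M. \<forall>k\<ge>M. norm (ell2_nth (X m) n - ell2_nth (X k) n) < e"
      using M coord[of "X _ - X _" n] unfolding nth_diff by (meson le_less_trans)
  qed
  then obtain g where g: "\<And>n. (\<lambda>k. ell2_nth (X k) n) \<longlonglongrightarrow> g n"
    unfolding Cauchy_convergent_iff convergent_def by metis
  \<comment> \<open>Fatou's argument: bounds on partial sums of differences survive the coordinatewise limit.\<close>
  have tail: "\<exists>M. \<forall>m\<ge>M. \<forall>N. (\<Sum>n<N. (cmod (ell2_nth (X m) n - g n))\<^sup>2) \<le> e\<^sup>2" if "e > 0" for e
  proof -
    obtain M where M: "\<forall>m\<ge>M. \<forall>k\<ge>M. norm (X m - X k) < e" using X \<open>e > 0\<close> by (auto simp: Cauchy_iff)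
    have "(\<Sum>n<N. (cmod (ell2_nth (X m) n - g n))\<^sup>2) \<le> e\<^sup>2" if "m \<ge> M" for m N
    proof (rule tendsto_upperbound)
      show "(\<lambda>k. \<Sum>n<N. (cmod (ell2_nth (X m) n - ell2_nth (X k) n))\<^sup>2)
          \<longlonglongrightarrow> (\<Sum>n<N. (cmod (ell2_nth (X m) n - g n))\<^sup>2)"
        by (intro tendsto_intros g)
      show "\<forall>\<^sub>F k in sequentially. (\<Sum>n<N. (cmod (ell2_nth (X m) n - ell2_nth (X k) n))\<^sup>2) \<le> e\<^sup>2"
      proof (rule eventually_sequentiallyI)
        fix k assume "k \<ge> M"
        then have "norm (X m - X k) < e" using M that by simp
        then have "(norm (X m - X k))\<^sup>2 \<le> e\<^sup>2" by (intro power_mono) auto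
        then show "(\<Sum>n<N. (cmod (ell2_nth (X m) n - ell2_nth (X k) n))\<^sup>2) \<le> e\<^sup>2"
          using part[of "X m - X k" N] by (simp add: nth_diff)
      qed
    qed simp
    then show ?thesis by blast
  qed
  have diff_in: "summable (\<lambda>n. (cmod (ell2_nth (X m) n - g n))\<^sup>2)"
    if "\<forall>N. (\<Sum>n<N. (cmod (ell2_nth (X m) n - g n))\<^sup>2) \<le> e\<^sup>2" for m e
    using that by (intro summableI_nonneg_bounded[where x = "e\<^sup>2"]) auto
  obtain M1 where "\<forall>m\<ge>M1. \<forall>N. (\<Sum>n<N. (cmod (ell2_nth (X m) n - g n))\<^sup>2) \<le> 1\<^sup>2"
    using tail[of 1] by auto
  then have d1: "summable (\<lambda>n. (cmod (g n - ell2_nth (X M1) n))\<^sup>2)"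
    using diff_in[of M1 1] by (simp add: norm_minus_commute)
  have "summable (\<lambda>n. (cmod (g n))\<^sup>2)"
    using summable_ell2_add[OF d1 summ[of "X M1"]] by simp
  then have L: "ell2_nth (Abs_ell2 g) = g" by (simp add: Abs_ell2_inverse)
  have "X \<longlonglongrightarrow> Abs_ell2 g"
  proof (rule LIMSEQ_I)
    fix e :: real assume "e > 0"
    then obtain M where M: "\<forall>m\<ge>M. \<forall>N. (\<Sum>n<N. (cmod (ell2_nth (X m) n - g n))\<^sup>2) \<le> (e/2)\<^sup>2"
      using tail[of "e/2"] by auto
    have "norm (X m - Abs_ell2 g) < e" if "m \<ge> M" for m
    proof -
      have "(norm (X m - Abs_ell2 g))\<^sup>2 \<le> (e/2)\<^sup>2"
        unfolding norm2 nth_diff L using M that diff_in by (intro suminf_le_const) auto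
      then have "norm (X m - Abs_ell2 g) \<le> e/2"
        using \<open>e > 0\<close> by (simp add: power2_le_iff_abs_le)
      then show ?thesis using \<open>e > 0\<close> by linarith
    qed
    then show "\<exists>no. \<forall>n\<ge>no. norm (X n - Abs_ell2 g) < e" by blast
  qed
  then show "convergent X" by (auto simp: convergent_def)
qed


section \<open>Hilbert spaces and adjoints\<close>

lemma hilbertD:
  assumes "hilbert H"
  shows "csubspace H" "complete H" "closed H"
  using assms by (auto simp: hilbert_def complete_imp_closed)

lemma parallelogram_midpoint:
  fixes a b :: "'h::real_inner"
  shows "(norm (a - b))\<^sup>2 = 2 * (norm a)\<^sup>2 + 2 * (norm b)\<^sup>2 - 4 * (norm ((1/2) *\<^sub>R (a + b)))\<^sup>2"
  unfolding power2_norm_eq_inner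
  by (simp add: inner_diff_left inner_diff_right inner_add_left inner_add_right inner_commute algebra_simps)

text \<open>A sequence in \<open>M\<close> whose distance to \<open>x\<close> tends to the infimum is Cauchy by the parallelogram
  law, and its limit is the foot of the perpendicular.\<close>

lemma orthogonal_projection_exists:
  fixes M :: "'h::complex_inner set"
  assumes M: "csubspace M" "complete M"
  obtains p where "p \<in> M" "\<And>y. y \<in> M \<Longrightarrow> cinner (x - p) y = 0"
proof -
  define \<delta> where "\<delta> = (INF m\<in>M. norm (x - m))"
  have M0: "M \<noteq> {}" using csubspaceD(1)[OF M(1)] by auto
  have bdd: "bdd_below ((\<lambda>m. norm (x - m)) ` M)" by (rule bdd_belowI[of _ 0]) auto
  have \<delta>: "\<delta> \<le> norm (x - m)" if "m \<in> M" for m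
    unfolding \<delta>_def by (rule cINF_lower[OF bdd that])
  have \<delta>0: "0 \<le> \<delta>" unfolding \<delta>_def by (rule cINF_greatest[OF M0]) simp
  have "\<exists>m\<in>M. norm (x - m) < \<delta> + inverse (real (Suc n))" for n
  proof -
    have "\<delta> < \<delta> + inverse (real (Suc n))" by simp
    then show ?thesis unfolding \<delta>_def by (subst (asm) cINF_less_iff[OF M0 bdd]) blast
  qed
  then obtain m where m: "\<And>n. m n \<in> M" "\<And>n. norm (x - m n) < \<delta> + inverse (real (Suc n))" by metis
  have lim: "(\<lambda>n. norm (x - m n)) \<longlonglongrightarrow> \<delta>"
  proof (rule tendsto_sandwich[OF _ _ tendsto_const])
    show "(\<lambda>n. \<delta> + inverse (real (Suc n))) \<longlonglongrightarrow> \<delta>"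
      using tendsto_add[OF tendsto_const LIMSEQ_inverse_real_of_nat, of \<delta>] by simp
  qed (intro always_eventually allI \<delta> m less_imp_le[OF m(2)])+
  have key: "(norm (m i - m j))\<^sup>2 \<le> 2 * (norm (x - m i))\<^sup>2 + 2 * (norm (x - m j))\<^sup>2 - 4 * \<delta>\<^sup>2" for i j
  proof -
    have "(1/2) *\<^sub>R ((x - m i) + (x - m j)) = x - (1/2) *\<^sub>R (m i + m j)"
    proof -
      have "(x - m i) + (x - m j) = 2 *\<^sub>R x - (m i + m j)" by (simp add: scaleR_2)
      then show ?thesis by (simp only: scaleR_right_diff_distrib) simp
    qed
    moreover have "(1/2) *\<^sub>R (m i + m j) \<in> M" by (intro csubspaceD(2,6)[OF M(1)] m(1))
    ultimately have "\<delta> \<le> norm ((1/2) *\<^sub>R ((x - m i) + (x - m j)))" using \<delta> by simp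
    then have "\<delta>\<^sup>2 \<le> (norm ((1/2) *\<^sub>R ((x - m i) + (x - m j))))\<^sup>2" using \<delta>0 by (rule power_mono)
    then show ?thesis
      using parallelogram_midpoint[of "x - m i" "x - m j"] by (simp add: norm_minus_commute)
  qed
  have "Cauchy m"
    unfolding Cauchy_iff
  proof (intro allI impI)
    fix e :: real assume e: "0 < e"
    have "(\<lambda>n. (norm (x - m n))\<^sup>2) \<longlonglongrightarrow> \<delta>\<^sup>2" by (intro tendsto_intros lim)
    moreover have "\<delta>\<^sup>2 < \<delta>\<^sup>2 + e\<^sup>2 / 4" using e by simp
    ultimately have "\<forall>\<^sub>F n in sequentially. (norm (x - m n))\<^sup>2 < \<delta>\<^sup>2 + e\<^sup>2 / 4" by (rule order_tendstoD)
    then obtain N where N: "\<And>n. n \<ge> N \<Longrightarrow> (norm (x - m n))\<^sup>2 < \<delta>\<^sup>2 + e\<^sup>2 / 4"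
      by (auto simp: eventually_sequentially)
    have "norm (m i - m j) < e" if "i \<ge> N" "j \<ge> N" for i j
    proof -
      have "(norm (m i - m j))\<^sup>2 < e\<^sup>2"
        using key[of i j] N[OF that(1)] N[OF that(2)] by linarith
      then show ?thesis using e by (simp add: power2_less_imp_less)
    qed
    then show "\<exists>N. \<forall>i\<ge>N. \<forall>j\<ge>N. norm (m i - m j) < e" by blast
  qed
  then obtain p where p: "p \<in> M" "m \<longlonglongrightarrow> p"
    using M(2) m(1) by (auto simp: complete_def)
  have "(\<lambda>n. norm (x - m n)) \<longlonglongrightarrow> norm (x - p)" by (intro tendsto_intros p)
  then have np: "norm (x - p) = \<delta>" using lim LIMSEQ_unique by blast
  have "cinner (x - p) y = 0" if y: "y \<in> M" for y
  proof (rule ccontr)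
    let ?b = "cinner (x - p) y"
    assume b: "?b \<noteq> 0"
    define s where "s = 1 / ((norm y)\<^sup>2 + 1)"
    have s: "0 < s" "s * (norm y)\<^sup>2 < 1"
      by (simp_all add: s_def add_pos_nonneg field_simps add_nonneg_pos)
    let ?t = "complex_of_real s * ?b"
    have "p + ?t *\<^sub>C y \<in> M" by (intro csubspaceD(2,3)[OF M(1)] p y)
    then have "norm (x - p) \<le> norm (x - (p + ?t *\<^sub>C y))" using \<delta> np by simp
    then have "(norm (x - p))\<^sup>2 \<le> (norm ((x - p) - ?t *\<^sub>C y))\<^sup>2"
      by (intro power_mono) (simp_all add: diff_diff_eq)
    also have "\<dots> = (norm (x - p))\<^sup>2 - 2 * Re (cinner (x - p) (?t *\<^sub>C y)) + (norm (?t *\<^sub>C y))\<^sup>2"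
      unfolding norm_eq_Re_cinner by (rule cinner.Re_diff_diff) simp_all
    also have "cinner (x - p) (?t *\<^sub>C y) = complex_of_real (s * (cmod ?b)\<^sup>2)"
    proof -
      have "cinner (x - p) (?t *\<^sub>C y) = complex_of_real s * (?b * cnj ?b)"
        by (simp only: cinner.scale_right[OF UNIV_I UNIV_I] complex_cnj_mult complex_cnj_complex_of_real
            mult_ac)
      then show ?thesis by (simp only: mult_cnj_self of_real_mult of_real_power)
    qed
    also have "(norm (?t *\<^sub>C y))\<^sup>2 = s * (s * (norm y)\<^sup>2) * (cmod ?b)\<^sup>2"
      by (simp add: norm_scaleC_inner norm_mult power_mult_distrib power2_eq_square del: cinner_simps)
    finally have "2 * (s * (cmod ?b)\<^sup>2) \<le> s * (cmod ?b)\<^sup>2 * (s * (norm y)\<^sup>2)"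
      by (simp add: algebra_simps del: cinner_simps)
    moreover have "s * (cmod ?b)\<^sup>2 * (s * (norm y)\<^sup>2) < s * (cmod ?b)\<^sup>2 * 1"
      using s b by (intro mult_strict_left_mono) simp_all
    moreover have "s * (cmod ?b)\<^sup>2 > 0" using s b by simp
    ultimately show False by linarith
  qed
  with p(1) show thesis by (rule that)
qed

lemma csubspace_orth_compl:
  assumes "csubspace H"
  shows "csubspace (orth_compl H M)"
  using csubspaceD[OF assms] unfolding csubspace_def orth_compl_def by auto

lemma closed_orth_compl:
  assumes "closed (H :: 'h::complex_inner set)"
  shows "closed (orth_compl H M)"
proof -
  have eq: "orth_compl H M = H \<inter> (\<Inter>y\<in>M. {x. cinner x y = 0})" by (auto simp: orth_compl_def)
  have "closed {x :: 'h. cinner x y = 0}" for y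
    by (intro closed_Collect_eq continuous_intros)
  then show ?thesis unfolding eq using assms by auto
qed

lemma orth_compl_closure:
  fixes X :: "'c::complex_inner set"
  shows "orth_compl X (closure N) = orth_compl X N"
proof (intro equalityI subsetI)
  fix x assume x: "x \<in> orth_compl X N"
  have "closed {y. cinner x y = 0}" by (intro closed_Collect_eq continuous_intros)
  then have "closure N \<subseteq> {y. cinner x y = 0}"
    using x by (intro closure_minimal) (auto simp: orth_compl_def)
  then show "x \<in> orth_compl X (closure N)" using x by (auto simp: orth_compl_def)
next
  fix x assume "x \<in> orth_compl X (closure N)"
  then show "x \<in> orth_compl X N" using closure_subset[of N] by (auto simp: orth_compl_def)
qed

lemma orth_sum_orth_compl:
  assumes "hilbert H" "csubspace M" "closed M" "M \<subseteq> (H :: 'h::complex_inner set)"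
  shows "orth_sum H (orth_compl H M) M"
  unfolding orth_sum_def
proof (intro conjI ballI equalityI subsetI)
  fix x assume x: "x \<in> H"
  have "complete M"
    using hilbertD(2)[OF assms(1)] assms(3,4) by (metis complete_Int_closed inf.absorb_iff2)
  then obtain p where p: "p \<in> M" "\<And>y. y \<in> M \<Longrightarrow> cinner (x - p) y = 0"
    using orthogonal_projection_exists assms(2) by metis
  then have "x - p \<in> orth_compl H M"
    using x assms(4) csubspaceD(5)[OF hilbertD(1)[OF assms(1)]] unfolding orth_compl_def by blast
  then show "x \<in> {x + y |x y. x \<in> orth_compl H M \<and> y \<in> M}"
    using p(1) by (intro CollectI exI[of _ "x - p"] exI[of _ p]) simp
next
  fix x assume "x \<in> {x + y |x y. x \<in> orth_compl H M \<and> y \<in> M}"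
  then show "x \<in> H"
    using assms(4) csubspaceD(2)[OF hilbertD(1)[OF assms(1)]] by (auto simp: orth_compl_def)
qed (simp add: orth_compl_def)

lemma orth_compl_double:
  assumes "hilbert H" "csubspace M" "closed M" "M \<subseteq> (H :: 'h::complex_inner set)"
  shows "orth_compl H (orth_compl H M) = M"
proof (intro equalityI subsetI)
  fix x assume x: "x \<in> orth_compl H (orth_compl H M)"
  then obtain u v where uv: "x = u + v" "u \<in> orth_compl H M" "v \<in> M"
  proof -
    have "x \<in> H" using x by (simp add: orth_compl_def)
    also have "H = {x + y |x y. x \<in> orth_compl H M \<and> y \<in> M}"
      using orth_sum_orth_compl[OF assms] unfolding orth_sum_def by blast
    finally show thesis using that by blast
  qed
  have "cinner x u = 0" using x uv by (auto simp: orth_compl_def)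
  moreover have "cinner v u = 0" using uv cinner_commute[of v u] by (auto simp: orth_compl_def)
  ultimately have "u = 0" using uv by (simp add: cinner_self)
  then show "x \<in> M" using uv by simp
next
  fix x assume "x \<in> M"
  then show "x \<in> orth_compl H (orth_compl H M)"
    using assms(4) cinner_commute[of x] by (auto simp: orth_compl_def)
qed

lemma csubspace_closure:
  assumes "csubspace (M :: 'h::complex_inner set)"
  shows "csubspace (closure M)"
  unfolding csubspace_def
proof (intro conjI ballI allI)
  show "0 \<in> closure M" using csubspaceD(1)[OF assms] closure_subset by blast
next
  fix x y assume "x \<in> closure M" "y \<in> closure M"
  then obtain f g where "\<forall>n. f n \<in> M" "f \<longlonglongrightarrow> x" "\<forall>n. g n \<in> M" "g \<longlonglongrightarrow> y"
    unfolding closure_sequential by blast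
  then have "\<forall>n. f n + g n \<in> M" "(\<lambda>n. f n + g n) \<longlonglongrightarrow> x + y"
    using csubspaceD(2)[OF assms] by (auto intro: tendsto_add)
  then show "x + y \<in> closure M" unfolding closure_sequential
    by (intro exI[of _ "\<lambda>n. f n + g n"]) simp
next
  fix c x assume "x \<in> closure M"
  then obtain f where "\<forall>n. f n \<in> M" "f \<longlonglongrightarrow> x" unfolding closure_sequential by blast
  then have "\<forall>n. c *\<^sub>C f n \<in> M" "(\<lambda>n. c *\<^sub>C f n) \<longlonglongrightarrow> c *\<^sub>C x"
    using csubspaceD(3)[OF assms] by (auto intro: tendsto_scaleC)
  then show "c *\<^sub>C x \<in> closure M" unfolding closure_sequential
    by (intro exI[of _ "\<lambda>n. c *\<^sub>C f n"]) simp
qed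

lemma bopD:
  assumes "T \<in> bop H K"
  shows "x \<in> H \<Longrightarrow> T x \<in> K" "x \<in> H \<Longrightarrow> y \<in> H \<Longrightarrow> T (x + y) = T x + T y"
    "x \<in> H \<Longrightarrow> T (c *\<^sub>C x) = c *\<^sub>C T x" "x \<notin> H \<Longrightarrow> T x = undefined"
  using assms by (auto simp: bop_def PiE_def extensional_def)

lemma bop_diff:
  assumes "T \<in> bop H K" "csubspace H" "x \<in> H" "y \<in> H"
  shows "T (x - y) = T x - T y"
  using bopD(2)[OF assms(1,3), of "- y"] bopD(3)[OF assms(1,4), of "-1"] csubspaceD(4)[OF assms(2,4)]
  by (simp add: scaleC_minus_one)

lemma bop_zero:
  assumes "T \<in> bop H K" "csubspace H"
  shows "T 0 = 0"
  using bop_diff[OF assms, of 0 0] csubspaceD(1)[OF assms(2)] by simp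

lemma bop_bound:
  assumes "T \<in> bop H K"
  obtains B where "B \<ge> 0" "\<And>x. x \<in> H \<Longrightarrow> norm (T x) \<le> B * norm x"
proof -
  obtain B where B: "\<And>x. x \<in> H \<Longrightarrow> norm (T x) \<le> B * norm x"
    using assms unfolding bop_def by blast
  have "norm (T x) \<le> \<bar>B\<bar> * norm x" if "x \<in> H" for x
    using B[OF that] by (meson abs_ge_self mult_right_mono norm_ge_zero order_trans)
  then show thesis by (intro that[of "\<bar>B\<bar>"]) auto
qed

lemma bop_restrictI:
  assumes "csubspace H" "\<And>x. x \<in> H \<Longrightarrow> f x \<in> K"
    and "\<And>x y. x \<in> H \<Longrightarrow> y \<in> H \<Longrightarrow> f (x + y) = f x + f y"
    and "\<And>c x. x \<in> H \<Longrightarrow> f (c *\<^sub>C x) = c *\<^sub>C f x"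
    and "\<And>x. x \<in> H \<Longrightarrow> norm (f x) \<le> B * norm x"
  shows "(\<lambda>x\<in>H. f x) \<in> bop H K"
proof -
  have "\<exists>B. \<forall>x\<in>H. norm ((\<lambda>x\<in>H. f x) x) \<le> B * norm x"
    using assms(5) by (intro exI[of _ B]) simp
  then show ?thesis
    using assms(2-4) csubspaceD(2,3)[OF assms(1)] unfolding bop_def by auto
qed

lemma bop_eqI:
  assumes "S \<in> bop H K" "T \<in> bop H K'" "\<And>x. x \<in> H \<Longrightarrow> S x = T x"
  shows "S = T"
  using assms bopD(4) by (metis ext)

lemma csubspace_bop_image:
  assumes "T \<in> bop H K" "csubspace H"
  shows "csubspace (T ` H)"
  unfolding csubspace_def
proof (intro conjI ballI allI)
  show "0 \<in> T ` H" using bop_zero[OF assms] csubspaceD(1)[OF assms(2)] by (metis imageI)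
  show "x + y \<in> T ` H" if "x \<in> T ` H" "y \<in> T ` H" for x y
    using that csubspaceD(2)[OF assms(2)] by (auto simp flip: bopD(2)[OF assms(1)])
  show "c *\<^sub>C x \<in> T ` H" if "x \<in> T ` H" for c x
    using that csubspaceD(3)[OF assms(2)] by (auto simp flip: bopD(3)[OF assms(1)])
qed

lemma bop_restrict_subspace:
  assumes "T \<in> bop X Y" "csubspace X'" "X' \<subseteq> X" "T ` X' \<subseteq> Y'"
  shows "(\<lambda>x\<in>X'. T x) \<in> bop X' Y'"
proof -
  obtain B where B: "B \<ge> 0" "\<And>x. x \<in> X \<Longrightarrow> norm (T x) \<le> B * norm x" by (rule bop_bound[OF assms(1)], rule that)
  show ?thesis
  proof (rule bop_restrictI[OF assms(2), where B = B])
    show "T x \<in> Y'" if "x \<in> X'" for x using assms(4) that by blast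
  qed (simp_all add: bopD(2,3)[OF assms(1)] B(2) subsetD[OF assms(3)])
qed

lemma bop_tendsto:
  assumes T: "T \<in> bop H K" "csubspace H" and f: "\<And>n. f n \<in> H" "x \<in> H" "f \<longlonglongrightarrow> x"
  shows "(\<lambda>n. T (f n)) \<longlonglongrightarrow> T x"
proof -
  obtain B where B: "\<And>x. x \<in> H \<Longrightarrow> norm (T x) \<le> B * norm x"
    by (rule bop_bound[OF T(1)], rule that)
  have le: "norm (T (f n) - T x) \<le> B * norm (f n - x)" for n
    using B[OF csubspaceD(5)[OF T(2) f(1) f(2)], of n] by (simp only: bop_diff[OF T f(1) f(2)])
  have "(\<lambda>n. B * norm (f n - x)) \<longlonglongrightarrow> B * norm (x - x)" by (intro tendsto_intros f(3))
  then have lim: "(\<lambda>n. B * norm (f n - x)) \<longlonglongrightarrow> 0" by simp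
  have "(\<lambda>n. T (f n) - T x) \<longlonglongrightarrow> 0"
    by (rule Lim_null_comparison[OF always_eventually[OF allI[OF le]] lim])
  then show ?thesis by (rule LIM_zero_cancel)
qed

lemma bop_closure_subset:
  assumes T: "T \<in> bop H K" "csubspace H" and M: "M \<subseteq> H" "closed H" "T ` M \<subseteq> closure N"
  shows "T ` closure M \<subseteq> closure N"
proof (intro image_subsetI)
  fix x assume "x \<in> closure M"
  then obtain f where f: "\<And>n. f n \<in> M" "f \<longlonglongrightarrow> x" unfolding closure_sequential by blast
  have "x \<in> H" using \<open>x \<in> closure M\<close> M by (meson closure_minimal in_mono)
  then have "(\<lambda>n. T (f n)) \<longlonglongrightarrow> T x" using f M by (intro bop_tendsto[OF T]) auto
  moreover have "T (f n) \<in> closure N" for n using f(1) M(3) by blast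
  ultimately show "T x \<in> closure N" by (meson closed_closure closed_sequentially)
qed

lemma op_norm_bound:
  assumes "T \<in> bop H K" "csubspace H" "x \<in> H"
  shows "norm (T x) \<le> op_norm H T * norm x"
proof (cases "x = 0")
  case True
  then show ?thesis using bop_zero[OF assms(1,2)] by simp
next
  case False
  obtain B where B: "B \<ge> 0" "\<And>x. x \<in> H \<Longrightarrow> norm (T x) \<le> B * norm x" by (rule bop_bound[OF assms(1)], rule that)
  have bdd: "bdd_above ((\<lambda>x. norm (T x)) ` {x \<in> H. norm x \<le> 1})"
  proof (rule bdd_aboveI2)
    fix y assume "y \<in> {x \<in> H. norm x \<le> 1}"
    then show "norm (T y) \<le> B" using B(2)[of y] mult_left_mono[of "norm y" 1 B] B(1) by simp
  qed
  let ?y = "complex_of_real (1 / norm x) *\<^sub>C x"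
  have y: "?y \<in> H" "norm ?y = 1" using csubspaceD(3)[OF assms(2,3)] False
    by (simp_all add: norm_scaleC_inner norm_divide)
  then have "norm (T ?y) \<le> op_norm H T"
    unfolding op_norm_def by (intro cSUP_upper bdd) auto
  moreover have "norm (T ?y) = norm (T x) / norm x"
    using bopD(3)[OF assms(1,3)] by (simp add: norm_scaleC_inner norm_divide)
  ultimately have "norm (T x) / norm x \<le> op_norm H T" by simp
  then show ?thesis using False by (simp add: pos_divide_le_eq)
qed

lemma op_norm_le:
  assumes "csubspace H" "B \<ge> 0" "\<And>x. x \<in> H \<Longrightarrow> norm (T x) \<le> B * norm x"
  shows "op_norm H T \<le> B"
  unfolding op_norm_def
proof (rule cSUP_least)
  show "{x \<in> H. norm x \<le> 1} \<noteq> {}" using csubspaceD(1)[OF assms(1)] by force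
next
  fix x assume "x \<in> {x \<in> H. norm x \<le> 1}"
  then show "norm (T x) \<le> B" using assms(3)[of x] mult_left_mono[of "norm x" 1 B] assms(2) by simp
qed

text \<open>The Riesz representation theorem: the functional is the inner product with a multiple of a
  vector orthogonal to its kernel.\<close>

lemma riesz_representation:
  assumes H: "hilbert H"
    and f: "\<And>x y. x \<in> H \<Longrightarrow> y \<in> H \<Longrightarrow> f (x + y) = f x + f y"
      "\<And>c x. x \<in> H \<Longrightarrow> f (c *\<^sub>C x) = c * f x"
      "\<And>x. x \<in> H \<Longrightarrow> cmod (f x) \<le> B * norm x"
  obtains z where "z \<in> H" "\<And>x. x \<in> H \<Longrightarrow> f x = cinner x z"
proof (cases "\<forall>x\<in>H. f x = 0")
  case True
  then show thesis using that[of 0] csubspaceD(1)[OF hilbertD(1)[OF H]] by simp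
next
  case False
  note Hs = csubspaceD[OF hilbertD(1)[OF H]]
  obtain x0 where x0: "x0 \<in> H" "f x0 \<noteq> 0" using False by auto
  define N where "N = {x \<in> H. f x = 0}"
  have fd: "f (x - y) = f x - f y" if "x \<in> H" "y \<in> H" for x y
    using f(1)[of x "- y"] f(2)[of y "-1"] that Hs by (simp add: scaleC_minus_one)
  have N: "csubspace N" using f(2)[of 0 0] Hs f by (auto simp: csubspace_def N_def)
  have "closed N"
    unfolding closed_sequential_limits
  proof (intro allI impI)
    fix u l assume u: "(\<forall>n. u n \<in> N) \<and> u \<longlonglongrightarrow> l"
    then have l: "l \<in> H"
      using hilbertD(3)[OF H] unfolding closed_sequential_limits N_def by blast
    have le: "cmod (f l) \<le> B * norm (l - u n)" for n
      using f(3)[of "l - u n"] fd[of l "u n"] u l Hs by (auto simp: N_def)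
    have "(\<lambda>n. B * norm (l - u n)) \<longlonglongrightarrow> B * norm (l - l)" using u by (intro tendsto_intros) auto
    from LIMSEQ_le_const[OF this] have "cmod (f l) \<le> B * norm (l - l)" using le by blast
    then show "l \<in> N" using l by (simp add: N_def)
  qed
  then have "complete N"
    using hilbertD(2)[OF H] by (metis (no_types, lifting) N_def complete_Int_closed inf.absorb_iff2 mem_Collect_eq subsetI)
  then obtain p where p: "p \<in> N" "\<And>y. y \<in> N \<Longrightarrow> cinner (x0 - p) y = 0"
    using orthogonal_projection_exists N by metis
  define w where "w = x0 - p"
  have w: "w \<in> H" "f w \<noteq> 0" using fd[of x0 p] x0 p(1) Hs by (auto simp: w_def N_def)
  then have w0: "w \<noteq> 0" using f(2)[of 0 0] Hs by auto
  let ?z = "(cnj (f w) / complex_of_real ((norm w)\<^sup>2)) *\<^sub>C w"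
  show thesis
  proof (rule that[of ?z])
    show "?z \<in> H" using w Hs by auto
    fix x assume x: "x \<in> H"
    let ?y = "x - (f x / f w) *\<^sub>C w"
    have "?y \<in> N" using x w Hs fd f by (simp add: N_def)
    from p(2)[OF this] have "cinner w ?y = 0" by (simp only: w_def)
    then have "cinner ?y w = 0" using cinner_commute[of ?y w] by simp
    then have "cinner x w = f x / f w * complex_of_real ((norm w)\<^sup>2)" by (simp add: cinner_self)
    then show "f x = cinner x ?z" using w w0 by simp
  qed
qed

lemma adj_eqI:
  assumes "csubspace H" "S \<in> bop K H" "\<And>x y. x \<in> H \<Longrightarrow> y \<in> K \<Longrightarrow> cinner (T x) y = cinner x (S y)"
  shows "adj H K T = S"
  unfolding adj_def
proof (rule the_equality)
  fix S' assume S': "S' \<in> bop K H \<and> (\<forall>x\<in>H. \<forall>y\<in>K. cinner (T x) y = cinner x (S' y))"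
  show "S' = S"
  proof (rule bop_eqI)
    fix y assume y: "y \<in> K"
    show "S' y = S y"
      using S' assms y bopD(1) by (intro cinner_eq_imp_eq[OF assms(1)]) (blast, blast, metis)
  qed (use S' assms in auto)
qed (use assms in auto)

lemma adj_exists:
  assumes H: "hilbert H" and K: "csubspace K" and T: "T \<in> bop H K"
  shows "\<exists>S\<in>bop K H. \<forall>x\<in>H. \<forall>y\<in>K. cinner (T x) y = cinner x (S y)"
proof -
  note Hs = hilbertD(1)[OF H]
  obtain B where B: "B \<ge> 0" "\<And>x. x \<in> H \<Longrightarrow> norm (T x) \<le> B * norm x" by (rule bop_bound[OF T], rule that)
  have "\<exists>z\<in>H. \<forall>x\<in>H. cinner (T x) y = cinner x z" for y
  proof (rule riesz_representation[OF H, where f = "\<lambda>x. cinner (T x) y" and B = "B * norm y"])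
    fix x assume "x \<in> H"
    then show "cmod (cinner (T x) y) \<le> B * norm y * norm x"
      using cinner_norm_le[of "T x" y] mult_right_mono[OF B(2)[of x], of "norm y"]
      by (simp add: algebra_simps)
  qed (auto simp: bopD[OF T])
  then obtain S where S: "\<And>y. S y \<in> H" "\<And>y x. x \<in> H \<Longrightarrow> cinner (T x) y = cinner x (S y)" by metis
  have "(\<lambda>y\<in>K. S y) \<in> bop K H"
  proof (rule bop_restrictI[OF K, where B = B])
    fix y assume "y \<in> K"
    have "(norm (S y))\<^sup>2 = cmod (cinner (T (S y)) y)" using S by (simp add: cinner_self norm_power)
    also have "\<dots> \<le> norm (T (S y)) * norm y" by (rule cinner_norm_le)
    also have "\<dots> \<le> B * norm (S y) * norm y" using B(2)[OF S(1)] by (intro mult_right_mono) auto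
    finally have "norm (S y) * norm (S y) \<le> norm (S y) * (B * norm y)"
      by (simp add: power2_eq_square algebra_simps)
    then show "norm (S y) \<le> B * norm y"
      using B(1) by (cases "S y = 0") auto
  next
    fix x y assume "x \<in> K" "y \<in> K"
    show "S (x + y) = S x + S y"
      by (rule cinner_eq_imp_eq[OF Hs]) (auto intro!: S(1) csubspaceD(2)[OF Hs] simp flip: S(2))
  next
    fix c x assume "x \<in> K"
    show "S (c *\<^sub>C x) = c *\<^sub>C S x"
      by (rule cinner_eq_imp_eq[OF Hs]) (auto intro!: S(1) csubspaceD(3)[OF Hs] simp flip: S(2))
  qed (rule S(1))
  then show ?thesis using S(2) by (intro bexI[of _ "\<lambda>y\<in>K. S y"]) auto
qed

lemma adjD:
  assumes H: "hilbert H" and K: "csubspace K" and T: "T \<in> bop H K"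
  shows "adj H K T \<in> bop K H"
    and "x \<in> H \<Longrightarrow> y \<in> K \<Longrightarrow> cinner (T x) y = cinner x (adj H K T y)"
    and "x \<in> H \<Longrightarrow> y \<in> K \<Longrightarrow> cinner y (T x) = cinner (adj H K T y) x"
proof -
  obtain S where S: "S \<in> bop K H" "\<forall>x\<in>H. \<forall>y\<in>K. cinner (T x) y = cinner x (S y)"
    using adj_exists[OF assms] by blast
  then have "adj H K T = S" using hilbertD(1)[OF H] by (intro adj_eqI) auto
  with S show "adj H K T \<in> bop K H"
    "x \<in> H \<Longrightarrow> y \<in> K \<Longrightarrow> cinner (T x) y = cinner x (adj H K T y)" by auto
  then show "x \<in> H \<Longrightarrow> y \<in> K \<Longrightarrow> cinner y (T x) = cinner (adj H K T y) x"
    using cinner_commute[of y "T x"] cinner_commute[of "adj H K T y" x] by simp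
qed

lemma separable_hilbert_iff:
  "separable_hilbert H \<longleftrightarrow> hilbert H \<and> (\<exists>D. countable D \<and> D \<subseteq> H \<and> H \<subseteq> closure D)"
proof -
  have "top_of_set H closure_of D = H \<longleftrightarrow> H \<subseteq> closure D" if "D \<subseteq> H" for D
    using that by (auto simp: closure_of_subtopology Int_absorb1)
  then show ?thesis by (auto simp: separable_hilbert_def separable_space_def)
qed

lemma contraction_norm_le:
  assumes "contraction H K R" "csubspace H" "h \<in> H"
  shows "norm (R h) \<le> norm h"
proof -
  have "norm (R h) \<le> op_norm H R * norm h"
    using assms by (intro op_norm_bound) (auto simp: contraction_def)
  also have "\<dots> \<le> 1 * norm h" using assms by (intro mult_right_mono) (auto simp: contraction_def)
  finally show ?thesis by simp
qed


section \<open>Representations on Hilbert spaces\<close>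

lemma star_representationD:
  assumes "star_representation H \<pi>"
  shows "\<pi> a \<in> bop H H" "h \<in> H \<Longrightarrow> \<pi> (a + b) h = \<pi> a h + \<pi> b h"
    "h \<in> H \<Longrightarrow> \<pi> (c *\<^sub>C a) h = c *\<^sub>C \<pi> a h" "h \<in> H \<Longrightarrow> \<pi> (a * b) h = \<pi> a (\<pi> b h)"
    "\<pi> (star a) = adj H H (\<pi> a)" "h \<in> H \<Longrightarrow> \<pi> 1 h = h"
  using assms by (auto simp: star_representation_def)

lemma star_representation_cinner:
  assumes "star_representation H \<pi>" "hilbert H" "x \<in> H" "y \<in> H"
  shows "cinner (\<pi> a x) y = cinner x (\<pi> (star a) y)"
  using adjD(2)[OF assms(2) hilbertD(1)[OF assms(2)] star_representationD(1)[OF assms(1)] assms(3,4)]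
  by (simp add: star_representationD(5)[OF assms(1)])

lemma star_representationI:
  assumes "csubspace H" "\<And>a. \<pi> a \<in> bop H H"
    and "\<And>a b h. h \<in> H \<Longrightarrow> \<pi> (a + b) h = \<pi> a h + \<pi> b h"
    and "\<And>c a h. h \<in> H \<Longrightarrow> \<pi> (c *\<^sub>C a) h = c *\<^sub>C \<pi> a h"
    and "\<And>a b h. h \<in> H \<Longrightarrow> \<pi> (a * b) h = \<pi> a (\<pi> b h)"
    and "\<And>a x y. x \<in> H \<Longrightarrow> y \<in> H \<Longrightarrow> cinner (\<pi> a x) y = cinner x (\<pi> (star a) y)"
    and "\<And>h. h \<in> H \<Longrightarrow> \<pi> 1 h = h"
  shows "star_representation H \<pi>"
proof -
  have "adj H H (\<pi> a) = \<pi> (star a)" for a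
    by (intro adj_eqI assms)
  then show ?thesis using assms by (auto simp: star_representation_def)
qed

lemma star_representation_reduces:
  assumes H: "hilbert H" and \<pi>: "star_representation H \<pi>"
    and M: "csubspace M" "closed M" "M \<subseteq> H" and inv: "\<And>a x. x \<in> M \<Longrightarrow> \<pi> a x \<in> M"
  shows "reduces H M \<pi>" "reduces H (orth_compl H M) \<pi>"
proof -
  have "\<pi> a x \<in> orth_compl H M" if "x \<in> orth_compl H M" for a x
  proof -
    have x: "x \<in> H" "\<And>y. y \<in> M \<Longrightarrow> cinner x y = 0" using that by (auto simp: orth_compl_def)
    have "cinner (\<pi> a x) y = 0" if "y \<in> M" for y
      using star_representation_cinner[OF \<pi> H x(1), of y a] x(2)[OF inv[OF that]] that M(3) by auto
    then show ?thesis using bopD(1)[OF star_representationD(1)[OF \<pi>] x(1)] by (simp add: orth_compl_def)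
  qed
  then show "reduces H M \<pi>" "reduces H (orth_compl H M) \<pi>"
    using inv orth_compl_double[OF H M] by (auto simp: reduces_def)
qed


section \<open>Positive elements of a C*-algebra\<close>

lemma star_zero [simp]: "star 0 = (0 :: 'a::cstar_algebra)"
  using star_scaleC[of 0 "0 :: 'a"] by simp

lemma star_minus [simp]: "star (- x) = - star (x :: 'a::cstar_algebra)"
  using star_scaleC[of "-1" x] by (simp add: scaleC_minus_one)

lemma star_diff [simp]: "star (x - y) = star x - star (y :: 'a::cstar_algebra)"
  using star_add[of x "- y"] by simp

lemma star_scaleR [simp]: "star (r *\<^sub>R x) = r *\<^sub>R star (x :: 'a::cstar_algebra)"
  using star_scaleC[of "complex_of_real r" x] by (simp add: scaleC_of_real)

lemma star_one [simp]: "star 1 = (1 :: 'a::cstar_algebra)"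
proof -
  have "star (star 1 * 1) = star 1 * (1 :: 'a)" by (simp only: star_mult star_star)
  then show ?thesis by (simp add: star_star)
qed

lemmas star_simps [simp] = star_star star_add star_mult star_scaleC

lemma star_power: "star (x ^ n) = star (x :: 'a::cstar_algebra) ^ n"
  by (induction n) (simp_all add: power_commutes)

lemma norm_star [simp]: "norm (star x) = norm (x :: 'a::cstar_algebra)"
proof -
  have le: "norm y \<le> norm (star y)" for y :: 'a
  proof (cases "y = 0")
    case False
    have "norm y * norm y \<le> norm (star y) * norm y"
      using cstar_identity[of y] norm_mult_ineq[of "star y" y] by (simp add: power2_eq_square)
    then show ?thesis using False by simp
  qed simp
  show ?thesis using le[of x] le[of "star x"] by simp
qed

lemma bounded_linear_star: "bounded_linear (star :: 'a::cstar_algebra \<Rightarrow> 'a)"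
  by (rule bounded_linear_intro[of _ 1]) simp_all

lemma norm_selfadjoint_square:
  "star x = x \<Longrightarrow> norm (x * x) = (norm (x :: 'a::cstar_algebra))\<^sup>2"
  using cstar_identity[of x] by simp

lemma norm_selfadjoint_power:
  assumes "star x = (x :: 'a::cstar_algebra)"
  shows "norm (x ^ 2 ^ n) = norm x ^ 2 ^ n"
proof (induction n)
  case (Suc n)
  have "norm (x ^ 2 ^ Suc n) = norm (x ^ 2 ^ n * x ^ 2 ^ n)" by (simp add: mult_2 flip: power_add)
  also have "\<dots> = (norm (x ^ 2 ^ n))\<^sup>2"
    by (rule norm_selfadjoint_square) (simp add: star_power assms)
  also have "\<dots> = norm x ^ 2 ^ Suc n" by (simp add: Suc mult.commute flip: power_mult)
  finally show ?case .
qed simp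

text \<open>By the C*-identity \<open>norm (x ^ 2 ^ n) = norm x ^ 2 ^ n\<close>, so the norm of a self-adjoint element is
  the exponential growth rate of its powers. Estimates of powers take the place of spectral
  arguments in this section.\<close>

lemma norm_le_1_if_power_growth:
  assumes "star x = (x :: 'a::cstar_algebra)" "\<And>n. norm (x ^ n) \<le> 1 + real n * C"
  shows "norm x \<le> 1"
proof (rule ccontr)
  assume "\<not> norm x \<le> 1"
  define r where "r = inverse (norm x)"
  have "1 < norm x" using \<open>\<not> norm x \<le> 1\<close> by simp
  moreover from this have "0 < norm x" by linarith
  ultimately have r: "0 < r" "r < 1" "r * norm x = 1"
    unfolding r_def by (simp_all only: inverse_less_1_iff left_inverse positive_imp_inverse_positive
        less_imp_neq[THEN not_sym] simp_thms)
  have "(\<lambda>n. r ^ n + C * (real n * r ^ n)) \<longlonglongrightarrow> 0 + C * 0"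
    using r by (intro tendsto_intros LIMSEQ_power_zero powser_times_n_limit_0) auto
  then have "\<forall>\<^sub>F n in sequentially. r ^ n + C * (real n * r ^ n) < 1"
    by (intro order_tendstoD(2)) auto
  then obtain N where N: "\<And>n. n \<ge> N \<Longrightarrow> r ^ n + C * (real n * r ^ n) < 1"
    by (auto simp: eventually_sequentially)
  let ?n = "2 ^ N :: nat"
  have "1 = r ^ ?n * norm x ^ ?n" using r by (simp flip: power_mult_distrib)
  also have "\<dots> = r ^ ?n * norm (x ^ ?n)" by (simp add: norm_selfadjoint_power[OF assms(1)])
  also have "\<dots> \<le> r ^ ?n * (1 + real ?n * C)" using r by (intro mult_left_mono assms) simp
  also have "\<dots> < 1" using N[of ?n] less_imp_le[OF less_exp[of N]] by (simp add: algebra_simps)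
  finally show False by simp
qed

text \<open>The coefficients of \<open>sqrt (1 - y) = \<Sum>k. sqrt_coeff k * y ^ k\<close>. From the first one on they
  are non-positive, and their partial sums stay non-negative, so the series converges absolutely
  on the closed unit ball.\<close>

definition sqrt_coeff :: "nat \<Rightarrow> real" where
  "sqrt_coeff k = ((1/2) gchoose k) * (- 1) ^ k"

lemma gbinomial_minus_half_sign: "0 \<le> (- 1) ^ n * ((- 1/2 :: real) gchoose n)"
proof -
  have "(- 1) ^ n * (\<Prod>i = 0..<n. (- 1/2 :: real) - of_nat i) = (\<Prod>i = 0..<n. (- 1) * ((- 1/2 :: real) - of_nat i))"
    by (simp only: prod.distrib prod_constant) simp
  also have "\<dots> \<ge> 0" by (intro prod_nonneg) simp
  finally show ?thesis by (simp add: gbinomial_prod_rev)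
qed

lemma sqrt_coeff_sum_nonneg: "0 \<le> (\<Sum>k\<le>n. sqrt_coeff k)"
  using gbinomial_sum_lower_neg[of "1/2 :: real" n] gbinomial_minus_half_sign[of n]
  by (simp add: sqrt_coeff_def)

lemma sqrt_coeff_0 [simp]: "sqrt_coeff 0 = 1"
  by (simp add: sqrt_coeff_def)

lemma sqrt_coeff_Suc_le_0: "sqrt_coeff (Suc n) \<le> 0"
proof -
  have "real (Suc n) * ((1/2) gchoose Suc n) = 1/2 * ((1/2 - 1) gchoose n)"
    by (rule gbinomial_absorption)
  note absorb = this
  have "real (Suc n) * sqrt_coeff (Suc n) = real (Suc n) * ((1/2) gchoose Suc n) * (- 1) ^ Suc n"
    by (simp only: sqrt_coeff_def mult.assoc)
  also have "\<dots> = - (1/2 * ((- 1) ^ n * ((- 1/2) gchoose n)))"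
    unfolding absorb by (simp add: mult.commute)
  finally have "real (Suc n) * sqrt_coeff (Suc n) = - (1/2 * ((- 1) ^ n * ((- 1/2) gchoose n)))" .
  then have "real (Suc n) * sqrt_coeff (Suc n) \<le> 0"
    using gbinomial_minus_half_sign[of n] by linarith
  then show ?thesis by (simp add: mult_le_0_iff)
qed

lemma sqrt_coeff_abs_sum: "(\<Sum>k<n. \<bar>sqrt_coeff (Suc k)\<bar>) \<le> 1"
proof -
  have "(\<Sum>k<n. \<bar>sqrt_coeff (Suc k)\<bar>) = - (\<Sum>k<n. sqrt_coeff (Suc k))"
    using sqrt_coeff_Suc_le_0 by (simp add: sum_negf)
  also have "\<dots> = 1 - (\<Sum>k<Suc n. sqrt_coeff k)"
    by (subst sum.lessThan_Suc_shift) simp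
  also have "\<dots> \<le> 1" using sqrt_coeff_sum_nonneg[of n] by (simp add: lessThan_Suc_atMost)
  finally show ?thesis .
qed

lemma summable_sqrt_coeff: "summable (\<lambda>k. \<bar>sqrt_coeff k\<bar>)"
proof -
  have "summable (\<lambda>k. \<bar>sqrt_coeff (Suc k)\<bar>)"
    by (rule summableI_nonneg_bounded[OF _ sqrt_coeff_abs_sum]) simp
  then show ?thesis by (rule summable_Suc_iff[THEN iffD1])
qed

lemma sqrt_coeff_convolution:
  "(\<Sum>i\<le>k. sqrt_coeff i * sqrt_coeff (k - i)) = (if k = 0 then 1 else if k = 1 then - 1 else 0)"
proof -
  have "(\<Sum>i\<le>k. sqrt_coeff i * sqrt_coeff (k - i))
      = (\<Sum>i\<le>k. ((1/2) gchoose i) * ((1/2) gchoose (k - i)) * (- 1) ^ k)"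
    by (intro sum.cong) (auto simp: sqrt_coeff_def simp flip: power_add)
  also have "\<dots> = ((1/2 + 1/2 :: real) gchoose k) * (- 1) ^ k"
    using gbinomial_Vandermonde[of "1/2 :: real" "1/2" k]
    by (simp only: sum_distrib_right[symmetric] atLeast0AtMost)
  also have "(1/2 + 1/2 :: real) gchoose k = of_nat (1 choose k)"
    using binomial_gbinomial[of 1 k, where 'a = real] by simp
  finally show ?thesis
    by (cases "k = 0"; cases "k = 1") (auto simp: binomial_eq_0)
qed

lemma sqrt_one_minus:
  fixes y :: "'a::cstar_algebra"
  assumes y: "star y = y" "norm y \<le> 1"
  obtains s where "star s = s" "s * s = 1 - y" "norm (1 - s) \<le> 1"
    "\<forall>z. z * y = y * z \<longrightarrow> z * s = s * z"
proof -
  let ?f = "\<lambda>k. sqrt_coeff k *\<^sub>R y ^ k"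
  have le: "norm (?f k) \<le> \<bar>sqrt_coeff k\<bar>" for k
  proof -
    have "norm (y ^ k) \<le> norm y ^ k" by (rule norm_power_ineq)
    also have "\<dots> \<le> 1" using y by (simp add: power_le_one)
    finally have "norm (y ^ k) \<le> 1" .
    from mult_left_mono[OF this, of "\<bar>sqrt_coeff k\<bar>"] show ?thesis by simp
  qed
  have abs: "summable (\<lambda>k. norm (?f k))"
    by (rule summable_comparison_test'[OF summable_sqrt_coeff]) (use le in auto)
  then have summ: "summable ?f" by (rule summable_norm_cancel)
  define s where "s = suminf ?f"
  show thesis
  proof (rule that[of s])
    show "star s = s"
      unfolding s_def using bounded_linear.suminf[OF bounded_linear_star summ]
      by (simp add: star_power y)
    have "(\<lambda>k. \<Sum>i\<le>k. ?f i * ?f (k - i)) sums (s * s)"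
      unfolding s_def by (rule Cauchy_product_sums[OF abs abs])
    moreover have "(\<Sum>i\<le>k. ?f i * ?f (k - i)) = (if k = 0 then 1 else if k = 1 then - y else 0)" for k
    proof -
      have "(\<Sum>i\<le>k. ?f i * ?f (k - i)) = (\<Sum>i\<le>k. sqrt_coeff i * sqrt_coeff (k - i)) *\<^sub>R y ^ k"
        unfolding scaleR_sum_left by (intro sum.cong) (auto simp flip: power_add)
      then show ?thesis by (simp add: sqrt_coeff_convolution)
    qed
    moreover have "(\<lambda>k::nat. if k = 0 then 1 else if k = 1 then - y else 0) sums
        (\<Sum>k\<in>{0, 1 :: nat}. if k = 0 then 1 else if k = 1 then - y else 0)"
      by (rule sums_finite) auto
    ultimately show "s * s = 1 - y" using sums_unique2 by fastforce
    have "s = 1 + (\<Sum>k. ?f (Suc k))"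
      unfolding s_def using suminf_split_head[OF summ] by simp
    moreover have "norm (\<Sum>k. ?f (Suc k)) \<le> 1"
    proof -
      have sh: "summable (\<lambda>k. norm (?f (Suc k)))"
        by (rule summable_Suc_iff[THEN iffD2, OF abs])
      have "norm (\<Sum>k. ?f (Suc k)) \<le> (\<Sum>k. norm (?f (Suc k)))" by (rule summable_norm[OF sh])
      also have "\<dots> \<le> 1"
      proof (rule suminf_le_const[OF sh])
        fix n
        have "(\<Sum>k<n. norm (?f (Suc k))) \<le> (\<Sum>k<n. \<bar>sqrt_coeff (Suc k)\<bar>)"
          by (intro sum_mono le)
        then show "(\<Sum>k<n. norm (?f (Suc k))) \<le> 1" using sqrt_coeff_abs_sum[of n] by linarith
      qed
      finally show ?thesis .
    qed
    ultimately show "norm (1 - s) \<le> 1" by simp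
    show "\<forall>z. z * y = y * z \<longrightarrow> z * s = s * z"
    proof (intro allI impI)
      fix z assume z: "z * y = y * z"
      have "z * y ^ k = y ^ k * z" for k using z by (simp add: power_commuting_commutes)
      then have "(\<lambda>k. z * ?f k) = (\<lambda>k. ?f k * z)" by simp
      then show "z * s = s * z"
        unfolding s_def using suminf_mult[OF summ, of z] suminf_mult2[OF summ, of z] by metis
    qed
  qed
qed

text \<open>The element \<open>v + i y\<close> is a multiple of a unitary, and \<open>y\<close> is its imaginary part.\<close>

lemma norm_le_of_sum_of_squares:
  fixes v y :: "'a::cstar_algebra"
  assumes "star v = v" "star y = y" "v * y = y * v" "v * v + y * y = t *\<^sub>R 1" "0 \<le> t"
  shows "(norm y)\<^sup>2 \<le> t"
proof -
  define u where "u = v + \<i> *\<^sub>C y"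
  have su: "star u = v - \<i> *\<^sub>C y" using assms by (simp add: u_def scaleC_minus_left)
  have "star u * u = v * v + y * y"
  proof -
    have "star u * u = (v - \<i> *\<^sub>C y) * (v + \<i> *\<^sub>C y)" by (simp only: su) (simp only: u_def)
    then show ?thesis using assms(3)
      by (simp add: algebra_simps mult_scaleC_left mult_scaleC_right scaleC_simps scaleC_scaleC
          scaleC_minus_one)
  qed
  then have "norm (star u * u) = t" using assms by simp
  then have nu: "(norm u)\<^sup>2 = t" by (simp only: cstar_identity)
  have "u - star u = (2 * \<i>) *\<^sub>C y"
    unfolding su by (simp add: u_def flip: scaleC_add_left)
  then have "2 * norm y = norm (u - star u)" by (simp add: norm_scaleC norm_mult)
  also have "\<dots> \<le> norm u + norm (star u)" by (rule norm_triangle_ineq4)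
  finally have "norm y \<le> norm u" by simp
  then show ?thesis using nu by (metis norm_ge_zero power_mono)
qed

text \<open>For \<open>s = sqrt (1 - b\<^sup>2)\<close> the element \<open>b + i s\<close> is unitary, so its imaginary part \<open>s\<close> has norm
  at most 1.\<close>

lemma norm_one_minus_square:
  fixes b :: "'a::cstar_algebra"
  assumes b: "star b = b" "norm b \<le> 1"
  shows "norm (1 - b * b) \<le> 1"
proof -
  have nb: "norm (b * b) \<le> 1" using b by (simp add: norm_selfadjoint_square power_le_one)
  obtain s where s: "star s = s" "s * s = 1 - b * b" "\<forall>z. z * (b * b) = b * b * z \<longrightarrow> z * s = s * z"
  proof (rule sqrt_one_minus[of "b * b"])
    show "star (b * b) = b * b" by (simp add: b)
  qed (rule nb, rule that)
  have "b * s = s * b" by (rule s(3)[rule_format]) (simp add: mult.assoc)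
  then have "(norm s)\<^sup>2 \<le> 1"
    by (rule norm_le_of_sum_of_squares[OF b(1) s(1)]) (simp_all add: s(2))
  then show ?thesis using norm_selfadjoint_square[OF s(1)] s(2) by simp
qed

text \<open>For a self-adjoint element of norm at most \<open>t\<close>, having its spectrum in the positive half-line
  means being within distance \<open>t\<close> of \<open>t\<close>. In this form sums and scalar multiples are immediate.\<close>

definition positive :: "'a::cstar_algebra \<Rightarrow> bool" where
  "positive a \<longleftrightarrow> star a = a \<and> (\<exists>t\<ge>0. norm (t *\<^sub>R 1 - a) \<le> t)"

lemma positive_0: "positive 0"
  unfolding positive_def by (auto intro: exI[of _ 0])

lemma positive_add:
  assumes "positive a" "positive b"
  shows "positive (a + b)"
proof -
  obtain s t where "s \<ge> 0" "t \<ge> 0" and st: "norm (s *\<^sub>R 1 - a) \<le> s" "norm (t *\<^sub>R 1 - b) \<le> t"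
    using assms by (auto simp: positive_def)
  moreover have "norm ((s + t) *\<^sub>R 1 - (a + b)) \<le> norm (s *\<^sub>R 1 - a) + norm (t *\<^sub>R 1 - b)"
    using norm_triangle_ineq[of "s *\<^sub>R 1 - a" "t *\<^sub>R 1 - b"] by (simp add: algebra_simps)
  ultimately show ?thesis
    using assms unfolding positive_def by (intro conjI exI[of _ "s + t"]) auto
qed

lemma positive_scaleR:
  assumes "positive a" "0 \<le> r"
  shows "positive (r *\<^sub>R a)"
proof -
  obtain t where t: "t \<ge> 0" "norm (t *\<^sub>R 1 - a) \<le> t" using assms by (auto simp: positive_def)
  have "norm ((r * t) *\<^sub>R 1 - r *\<^sub>R a) = r * norm (t *\<^sub>R 1 - a)"
    using assms(2) norm_scaleR[of r "t *\<^sub>R 1 - a"] by (simp add: scaleR_diff_right)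
  then show ?thesis
    using assms t unfolding positive_def by (intro conjI exI[of _ "r * t"]) (auto simp: mult_left_mono)
qed

lemma positive_norm_diff: "star a = a \<Longrightarrow> norm a \<le> t \<Longrightarrow> positive (t *\<^sub>R 1 - a)"
  unfolding positive_def by (auto intro!: exI[of _ t] order_trans[OF norm_ge_zero])

lemma norm_scaled_one_minus_square:
  assumes "star y = (y :: 'a::cstar_algebra)" "(norm y)\<^sup>2 \<le> t"
  shows "norm (t *\<^sub>R 1 - y * y) \<le> t"
proof (cases "t = 0")
  case True
  then show ?thesis using assms by simp
next
  case False
  then have t: "t > 0" using assms(2) by (metis le_less order_trans zero_le_power2)
  let ?b = "(1 / sqrt t) *\<^sub>R y"
  have "norm y \<le> sqrt t" using assms(2) by (simp add: real_le_rsqrt)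
  then have "norm ?b \<le> 1" using t by (simp add: field_simps)
  then have "norm (1 - ?b * ?b) \<le> 1" using assms by (intro norm_one_minus_square) simp_all
  then have "t * norm (1 - ?b * ?b) \<le> t" using t by simp
  also have "t * norm (1 - ?b * ?b) = norm (t *\<^sub>R (1 - ?b * ?b))" using t by simp
  also have "t *\<^sub>R (1 - ?b * ?b) = t *\<^sub>R 1 - y * y" using t by (simp add: scaleR_diff_right)
  finally show ?thesis .
qed

lemma positive_square: "star y = y \<Longrightarrow> positive (y * y)"
  unfolding positive_def using norm_scaled_one_minus_square[of y "(norm y)\<^sup>2"]
  by (intro conjI exI[of _ "(norm y)\<^sup>2"]) auto

lemma positive_sqrt:
  fixes a :: "'a::cstar_algebra"
  assumes "positive a"
  obtains y where "star y = y" "y * y = a" "\<forall>z. z * a = a * z \<longrightarrow> z * y = y * z"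
proof -
  obtain t where t: "t \<ge> 0" "norm (t *\<^sub>R 1 - a) \<le> t" and a: "star a = a"
    using assms by (auto simp: positive_def)
  show thesis
  proof (cases "t = 0")
    case True
    then show thesis using t that[of 0] by auto
  next
    case False
    with t have t0: "t > 0" by simp
    let ?x = "1 - (1 / t) *\<^sub>R a"
    have "norm ?x = norm ((1 / t) *\<^sub>R (t *\<^sub>R 1 - a))" using t0 by (simp add: scaleR_diff_right)
    also have "\<dots> = (1 / t) * norm (t *\<^sub>R 1 - a)" using t0 by (simp only: norm_scaleR) simp
    also have "\<dots> \<le> 1" using t t0 by (simp add: pos_divide_le_eq)
    finally have nx: "norm ?x \<le> 1" .
    obtain s where s: "star s = s" "s * s = 1 - ?x" "\<forall>z. z * ?x = ?x * z \<longrightarrow> z * s = s * z"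
    proof (rule sqrt_one_minus[of ?x])
      show "star ?x = ?x" by (simp add: a)
    qed (rule nx, rule that)
    show thesis
    proof (rule that[of "sqrt t *\<^sub>R s"])
      show "star (sqrt t *\<^sub>R s) = sqrt t *\<^sub>R s" by (simp add: s(1))
      have "sqrt t *\<^sub>R s * sqrt t *\<^sub>R s = t *\<^sub>R (s * s)" using t0 by simp
      also have "\<dots> = a" using t0 by (simp add: s(2))
      finally show "sqrt t *\<^sub>R s * sqrt t *\<^sub>R s = a" .
      show "\<forall>z. z * a = a * z \<longrightarrow> z * sqrt t *\<^sub>R s = sqrt t *\<^sub>R s * z"
      proof (intro allI impI)
        fix z assume "z * a = a * z"
        then have "z * s = s * z" by (intro s(3)[rule_format]) (simp add: algebra_simps)
        then show "z * sqrt t *\<^sub>R s = sqrt t *\<^sub>R s * z" by simp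
      qed
    qed
  qed
qed

lemma positive_norm_bound:
  assumes "positive a" "norm a \<le> t"
  shows "norm (t *\<^sub>R 1 - a) \<le> t"
proof -
  obtain y where y: "star y = y" "y * y = a" using positive_sqrt[OF assms(1)] by metis
  then show ?thesis
    using norm_scaled_one_minus_square[of y t] norm_selfadjoint_square[OF y(1)] assms(2) by simp
qed

text \<open>With \<open>n = norm a\<close>, both \<open>n + a\<close> and \<open>n - a\<close> have norm at most \<open>n\<close>, and
  \<open>4 n a = (n + a)\<^sup>2 - (n - a)\<^sup>2\<close>; hence \<open>4 n\<^sup>2 \<le> 2 n\<^sup>2\<close>.\<close>

lemma positive_antisym:
  fixes a :: "'a::cstar_algebra"
  assumes "positive a" "positive (- a)"
  shows "a = 0"
proof -
  let ?n = "norm a" and ?x = "norm a *\<^sub>R 1 + a" and ?y = "norm a *\<^sub>R 1 - a"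
  have x: "norm ?x \<le> ?n" using positive_norm_bound[OF assms(2), of ?n] by simp
  have y: "norm ?y \<le> ?n" using positive_norm_bound[OF assms(1), of ?n] by simp
  have "(4 * ?n) *\<^sub>R a = ?n *\<^sub>R a + ?n *\<^sub>R a + ?n *\<^sub>R a + ?n *\<^sub>R a"
    by (simp flip: scaleR_add_left)
  also have "\<dots> = ?x * ?x - ?y * ?y" by (simp add: algebra_simps)
  finally have "norm (?x * ?x - ?y * ?y) = norm ((4 * ?n) *\<^sub>R a)" by (rule arg_cong[symmetric])
  then have "4 * ?n * ?n = norm (?x * ?x - ?y * ?y)" by simp
  also have "\<dots> \<le> norm (?x * ?x) + norm (?y * ?y)" by (rule norm_triangle_ineq4)
  also have "\<dots> \<le> ?n * ?n + ?n * ?n"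
    by (intro add_mono order_trans[OF norm_mult_ineq] mult_mono x y) auto
  finally have "?n * ?n \<le> 0" by simp
  then show ?thesis by (simp add: mult_le_0_iff)
qed

text \<open>The spectra of \<open>c*c\<close> and \<open>cc*\<close> agree up to zero. In terms of norms: powers of \<open>1 + cc*\<close> are
  \<open>1 + c q c*\<close> with \<open>q\<close> a polynomial in \<open>c*c\<close> whose norm grows linearly.\<close>

lemma positive_minus_star_swap:
  fixes c :: "'a::cstar_algebra"
  assumes "positive (- (star c * c))"
  shows "positive (- (c * star c))"
proof (cases "c = 0")
  case True
  then show ?thesis by (simp add: positive_0)
next
  case False
  have normalised: "positive (- (e * star e))"
    if e: "norm e \<le> 1" "positive (- (star e * e))" for e :: 'a
  proof -
    have e2: "norm (star e * e) \<le> 1" using e(1) by (simp only: cstar_identity) (simp add: power_le_one)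
    then have x: "norm (1 + star e * e) \<le> 1"
      using positive_norm_bound[OF e(2), of 1] by (simp add: norm_minus_cancel)
    have "\<exists>q. norm q \<le> real n \<and> (1 + e * star e) ^ n = 1 + e * q * star e" for n
    proof (induction n)
      case 0
      then show ?case by (intro exI[of _ 0]) simp
    next
      case (Suc n)
      then obtain q where q: "norm q \<le> real n" "(1 + e * star e) ^ n = 1 + e * q * star e" by blast
      let ?q = "1 + (1 + star e * e) * q"
      have "norm ?q \<le> 1 + norm ((1 + star e * e) * q)" using norm_triangle_ineq[of 1 "(1 + star e * e) * q"] by simp
      also have "norm ((1 + star e * e) * q) \<le> 1 * real n"
        by (intro order_trans[OF norm_mult_ineq] mult_mono x q) auto
      finally have "norm ?q \<le> real (Suc n)" by simp
      moreover have "(1 + e * star e) ^ Suc n = 1 + e * ?q * star e"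
        by (simp add: q algebra_simps)
      ultimately show ?case by blast
    qed
    then have growth: "norm ((1 + e * star e) ^ n) \<le> 1 + real n * 1" for n
    proof -
      obtain q where q: "norm q \<le> real n" "(1 + e * star e) ^ n = 1 + e * q * star e"
        using \<open>\<exists>q. norm q \<le> real n \<and> (1 + e * star e) ^ n = 1 + e * q * star e\<close> by blast
      have "norm (e * q * star e) \<le> (1 * real n) * 1"
        by (intro order_trans[OF norm_mult_ineq] mult_mono) (use e q in auto)
      then show ?thesis unfolding q(2) using norm_triangle_ineq[of 1 "e * q * star e"] by simp
    qed
    have "norm (1 + e * star e) \<le> 1"
      by (rule norm_le_1_if_power_growth[OF _ growth]) simp
    then show ?thesis unfolding positive_def by (intro conjI exI[of _ 1]) simp_all
  qed
  let ?r = "inverse (norm c)"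
  have "positive ((?r * ?r) *\<^sub>R - (star c * c))" by (rule positive_scaleR[OF assms]) simp
  then have "positive (- ((?r *\<^sub>R c) * star (?r *\<^sub>R c)))"
    using False by (intro normalised) simp_all
  then have "positive ((norm c * norm c) *\<^sub>R - ((?r *\<^sub>R c) * star (?r *\<^sub>R c)))"
    by (rule positive_scaleR) simp
  moreover have "norm c * norm c * (?r * ?r) = 1" using False by (simp add: field_simps)
  ultimately show ?thesis by simp
qed

text \<open>The theorem of Fukamiya, Kelley--Vaught and Kaplansky. Let \<open>m\<close> be the negative part of
  \<open>b = a*a\<close>. Then \<open>c = a m\<close> satisfies \<open>c*c = - m\<^sup>3\<close>, so \<open>- c*c\<close> and \<open>- cc*\<close> are positive; but
  \<open>c*c + cc*\<close> is twice the sum of the squares of the real and imaginary part of \<open>c\<close>.\<close>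

theorem positive_star_mult: "positive (star a * (a :: 'a::cstar_algebra))"
proof -
  have normalised: "positive (star a * a)" if na: "norm a \<le> 1" for a :: 'a
  proof -
    define b where "b = star a * a"
    have b: "star b = b" by (simp add: b_def)
    have nb: "norm b \<le> 1" unfolding b_def cstar_identity using na by (simp add: power_le_one)
    \<comment> \<open>\<open>s\<close> is the absolute value of \<open>b\<close>.\<close>
    obtain s where s: "star s = s" "s * s = b * b" "norm (1 - s) \<le> 1"
      "\<forall>z. z * (1 - b * b) = (1 - b * b) * z \<longrightarrow> z * s = s * z"
    proof (rule sqrt_one_minus[of "1 - b * b"])
      show "star (1 - b * b) = 1 - b * b" by (simp add: b)
      show "norm (1 - b * b) \<le> 1" by (rule norm_one_minus_square[OF b nb])
    next
      fix s assume "star s = s" "s * s = 1 - (1 - b * b)" "norm (1 - s) \<le> 1"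
        "\<forall>z. z * (1 - b * b) = (1 - b * b) * z \<longrightarrow> z * s = s * z"
      moreover from this(2) have "s * s = b * b" by simp
      ultimately show thesis by (rule_tac that)
    qed
    have bs: "b * s = s * b" by (rule s(4)[rule_format]) (simp add: algebra_simps)
    define m where "m = (1/2) *\<^sub>R (s - b)"
    have m: "star m = m" by (simp add: m_def s b)
    have ms: "m * s = m * m" and bm: "b * m = - (m * m)" and mb: "m * b = - (m * m)"
    proof -
      have db: "(s - b) * b = - ((s - b) * s)" and bd: "b * (s - b) = - ((s - b) * s)"
        by (simp_all add: left_diff_distrib right_diff_distrib bs s(2))
      have "(s - b) * (s - b) = (s - b) * s + (s - b) * s"
        by (simp only: right_diff_distrib[of "s - b"] db) simp
      then have dd: "(s - b) * (s - b) = 2 *\<^sub>R ((s - b) * s)" by (simp only: scaleR_2)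
      show "m * s = m * m" "b * m = - (m * m)" "m * b = - (m * m)"
        by (simp_all only: m_def mult_scaleR_left mult_scaleR_right dd db bd scaleR_scaleR) simp_all
    qed
    \<comment> \<open>As \<open>s\<close> and \<open>m\<close> act alike on the range of \<open>m\<close>, the norm of \<open>m (1 - m)\<^sup>n\<close> stays bounded. So the
      powers of \<open>1 - m\<close> grow linearly, and \<open>m\<close> is positive.\<close>
    have pow: "m * (1 - s) ^ n = m * (1 - m) ^ n" for n
    proof (induction n)
      case (Suc n)
      have "m * (1 - s) ^ Suc n = m * (1 - m) ^ n * (1 - s)"
        by (simp only: power_Suc2 mult.assoc[symmetric] Suc)
      also have "m * (1 - m) ^ n = (1 - m) ^ n * m"
        by (rule power_commuting_commutes[symmetric]) (simp add: algebra_simps)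
      also have "(1 - m) ^ n * m * (1 - s) = (1 - m) ^ n * m * (1 - m)"
        by (simp add: mult.assoc right_diff_distrib ms)
      also have "(1 - m) ^ n * m = m * (1 - m) ^ n"
        by (rule power_commuting_commutes) (simp add: algebra_simps)
      finally show ?case by (simp only: power_Suc2 mult.assoc)
    qed simp
    have "norm (m * (1 - m) ^ n) \<le> norm m" for n
    proof -
      have "norm ((1 - s) ^ n) \<le> 1"
        using norm_power_ineq[of "1 - s" n] power_le_one[of "norm (1 - s)" n] s(3) by simp
      then have "norm m * norm ((1 - s) ^ n) \<le> norm m" by (intro mult_left_le) auto
      then show ?thesis using norm_mult_ineq[of m "(1 - s) ^ n"] by (simp add: pow)
    qed
    then have "norm ((1 - m) ^ n) \<le> 1 + real n * norm m" for n
    proof (induction n)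
      case (Suc n)
      have "(1 - m) ^ Suc n = (1 - m) ^ n - m * (1 - m) ^ n" by (simp add: algebra_simps)
      then have "norm ((1 - m) ^ Suc n) \<le> norm ((1 - m) ^ n) + norm (m * (1 - m) ^ n)"
        by (metis norm_triangle_ineq4)
      also have "\<dots> \<le> 1 + real n * norm m + norm m" using Suc by (intro add_mono) auto
      finally show ?case by (simp add: algebra_simps)
    qed simp
    then have "norm (1 - m) \<le> 1"
      by (rule norm_le_1_if_power_growth[rotated]) (simp add: m)
    then have "positive m" unfolding positive_def using m by (intro conjI exI[of _ 1]) auto
    then obtain w where w: "star w = w" "w * w = m" using positive_sqrt by metis
    define c where "c = a * m"
    have cc: "star c * c = - (m * m * m)"
    proof -
      have "star c * c = m * b * m" by (simp add: c_def m b_def mult.assoc)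
      then show ?thesis by (simp add: mb)
    qed
    have "m * m * m = (w * w * w) * (w * w * w)" by (simp add: w(2)[symmetric] mult.assoc)
    then have neg: "positive (- (star c * c))"
      unfolding cc using positive_square[of "w * w * w"] w(1) by (simp add: mult.assoc)
    define h k where "h = c + star c" and "k = \<i> *\<^sub>C (star c - c)"
    have hk: "star h = h" "star k = k"
      by (simp_all add: h_def k_def scaleC_minus_left flip: scaleC_minus_right)
    have hk_sum: "h * h + k * k = 2 *\<^sub>R (star c * c + c * star c)"
      by (simp add: h_def k_def mult_scaleC_left mult_scaleC_right scaleC_scaleC scaleC_minus_one
          scaleC_simps algebra_simps scaleR_2)
    have "star c * c = (1/2) *\<^sub>R (h * h + k * k) + - (c * star c)"
      unfolding hk_sum by simp
    also have "positive \<dots>"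
      by (intro positive_add positive_scaleR positive_square hk positive_minus_star_swap neg) simp
    finally have "star c * c = 0" using neg by (rule positive_antisym)
    then have "m * m * m = 0" using cc by simp
    then have "(m * m) * (m * m) = 0" by (simp flip: mult.assoc)
    then have "norm m = 0"
      using norm_selfadjoint_square[of "m * m"] norm_selfadjoint_square[of m] m by simp
    then have "b = s" by (simp add: m_def)
    then show ?thesis
      using s(1,3) b unfolding positive_def b_def[symmetric] by (intro conjI exI[of _ 1]) auto
  qed
  show ?thesis
  proof (cases "a = 0")
    case True
    then show ?thesis by (simp add: positive_0)
  next
    case False
    let ?r = "inverse (norm a)"
    have "positive ((norm a * norm a) *\<^sub>R (star (?r *\<^sub>R a) * (?r *\<^sub>R a)))"
      using False by (intro positive_scaleR normalised) simp_all
    moreover have "norm a * norm a * (?r * ?r) = 1" using False by (simp add: field_simps)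
    ultimately show ?thesis by simp
  qed
qed

lemma positive_conjugate:
  assumes "positive x"
  shows "positive (star b * x * (b :: 'a::cstar_algebra))"
proof -
  obtain y where y: "star y = y" "y * y = x" using positive_sqrt[OF assms] by metis
  then show ?thesis using positive_star_mult[of "y * b"] by (simp add: mult.assoc flip: y(2))
qed

text \<open>For \<open>t = norm (x + w)\<close> the element \<open>t - x = (t - (x + w)) + w\<close> is positive. Its square root \<open>v\<close>
  commutes with the square root \<open>y\<close> of \<open>x\<close>, and \<open>v\<^sup>2 + y\<^sup>2 = t\<close>.\<close>

lemma norm_mono_positive:
  fixes x w :: "'a::cstar_algebra"
  assumes "positive x" "positive w"
  shows "norm x \<le> norm (x + w)"
proof -
  let ?t = "norm (x + w)"
  have "star (x + w) = x + w" using assms by (simp add: positive_def)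
  then have "positive ((?t *\<^sub>R 1 - (x + w)) + w)"
    using assms by (intro positive_add positive_norm_diff) auto
  then have "positive (?t *\<^sub>R 1 - x)" by (simp add: algebra_simps)
  then obtain v where v: "star v = v" "v * v = ?t *\<^sub>R 1 - x"
    "\<forall>z. z * (?t *\<^sub>R 1 - x) = (?t *\<^sub>R 1 - x) * z \<longrightarrow> z * v = v * z"
    by (rule positive_sqrt)
  obtain y where y: "star y = y" "y * y = x" using positive_sqrt[OF assms(1)] by metis
  have "y * v = v * y" proof (rule v(3)[rule_format])
    have "y * x = x * y" by (simp only: y(2)[symmetric] mult.assoc)
    then show "y * (?t *\<^sub>R 1 - x) = (?t *\<^sub>R 1 - x) * y" by (simp add: algebra_simps)
  qed
  then have "(norm y)\<^sup>2 \<le> ?t"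
    by (intro norm_le_of_sum_of_squares[OF v(1) y(1) sym _ norm_ge_zero]) (simp_all add: v(2) y(2))
  then show ?thesis using norm_selfadjoint_square[OF y(1)] y(2) by simp
qed


section \<open>Positive functionals\<close>

definition sublinear :: "('v::real_vector \<Rightarrow> real) \<Rightarrow> bool" where
  "sublinear p \<longleftrightarrow> (\<forall>x y. p (x + y) \<le> p x + p y) \<and> (\<forall>r\<ge>0. \<forall>x. p (r *\<^sub>R x) = r * p x)"

lemma sublinearD:
  assumes "sublinear p"
  shows "p (x + y) \<le> p x + p y" "0 \<le> r \<Longrightarrow> p (r *\<^sub>R x) = r * p x" "p 0 = 0" "- p (- x) \<le> p x"
proof -
  show *: "p (x + y) \<le> p x + p y" "0 \<le> r \<Longrightarrow> p (r *\<^sub>R x) = r * p x" for x y r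
    using assms by (auto simp: sublinear_def)
  show **: "p 0 = 0" using *(2)[of 0 0] by simp
  show "- p (- x) \<le> p x" using *(1)[of x "- x"] ** by simp
qed

lemma sublinearI:
  assumes "\<And>x y. p (x + y) \<le> p x + p y" "p 0 = 0" "\<And>r x. 0 < r \<Longrightarrow> p (r *\<^sub>R x) \<le> r * p x"
  shows "sublinear p"
proof -
  have "p (r *\<^sub>R x) = r * p x" if "0 \<le> r" for r x
  proof (cases "r = 0")
    case True
    then show ?thesis using assms(2) by simp
  next
    case False
    then have r: "0 < r" using that by simp
    have "p x = p ((1 / r) *\<^sub>R (r *\<^sub>R x))" using r by simp
    also have "\<dots> \<le> (1 / r) * p (r *\<^sub>R x)" using r by (intro assms(3)) simp
    finally have "r * p x \<le> p (r *\<^sub>R x)" using r by (simp add: field_simps)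
    then show ?thesis using assms(3)[OF r, of x] by simp
  qed
  then show ?thesis using assms(1) by (simp add: sublinear_def)
qed

lemma sublinear_INF:
  fixes F :: "'i \<Rightarrow> 'v::real_vector \<Rightarrow> real"
  assumes ne: "I \<noteq> {}" and bdd: "\<And>x. bdd_below ((\<lambda>i. F i x) ` I)"
    and add: "\<And>i j x y. i \<in> I \<Longrightarrow> j \<in> I \<Longrightarrow> \<exists>k\<in>I. F k (x + y) \<le> F i x + F j y"
    and scale: "\<And>i r x. i \<in> I \<Longrightarrow> 0 < r \<Longrightarrow> \<exists>k\<in>I. F k (r *\<^sub>R x) \<le> r * F i x"
    and zero: "\<And>i. i \<in> I \<Longrightarrow> 0 \<le> F i 0" "\<exists>i\<in>I. F i 0 \<le> 0"
  shows "sublinear (\<lambda>x. INF i\<in>I. F i x)" (is "sublinear ?p")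
proof (rule sublinearI)
  have lower: "?p x \<le> F i x" if "i \<in> I" for i x by (rule cINF_lower[OF bdd that])
  have greatest: "c \<le> ?p x" if "\<And>i. i \<in> I \<Longrightarrow> c \<le> F i x" for c x by (rule cINF_greatest[OF ne that])
  show "?p (x + y) \<le> ?p x + ?p y" for x y
  proof -
    have split: "?p (x + y) \<le> F i x + F j y" if "i \<in> I" "j \<in> I" for i j
      using add[OF that, of x y] lower order_trans by blast
    have half: "?p (x + y) - F i x \<le> ?p y" if "i \<in> I" for i
    proof (rule greatest)
      fix j assume "j \<in> I"
      from split[OF that this] show "?p (x + y) - F i x \<le> F j y" by linarith
    qed
    have "?p (x + y) - ?p y \<le> ?p x"
    proof (rule greatest)
      fix i assume "i \<in> I"
      from half[OF this] show "?p (x + y) - ?p y \<le> F i x" by linarith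
    qed
    then show ?thesis by simp
  qed
  show "?p 0 = 0"
  proof (rule antisym)
    show "?p 0 \<le> 0" using zero(2) lower order_trans by blast
  qed (rule greatest[OF zero(1)])
  fix r :: real and x assume r: "0 < r"
  have "?p (r *\<^sub>R x) / r \<le> ?p x"
  proof (rule greatest)
    fix i assume i: "i \<in> I"
    have "?p (r *\<^sub>R x) \<le> r * F i x" using scale[OF i r, of x] lower order_trans by blast
    then show "?p (r *\<^sub>R x) / r \<le> F i x" using r by (simp add: pos_divide_le_eq mult.commute)
  qed
  then show "?p (r *\<^sub>R x) \<le> r * ?p x" using r by (simp add: pos_divide_le_eq mult.commute)
qed

text \<open>The largest sublinear functional \<open>r \<le> q\<close> with \<open>r (- y) = - q y\<close>.\<close>

definition tilt :: "('v::real_vector \<Rightarrow> real) \<Rightarrow> 'v \<Rightarrow> 'v \<Rightarrow> real" where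
  "tilt q y x = (INF t\<in>{0..}. q (x + t *\<^sub>R y) - t * q y)"

lemma
  assumes q: "sublinear q"
  shows sublinear_tilt: "sublinear (tilt q y)"
    and tilt_le: "tilt q y x \<le> q x"
    and tilt_minus_le: "tilt q y (- y) \<le> - q y"
proof -
  have bdd: "bdd_below ((\<lambda>t. q (x + t *\<^sub>R y) - t * q y) ` {0..})" for x
  proof (rule bdd_belowI2)
    fix t :: real assume "t \<in> {0..}"
    then have "t * q y = q ((x + t *\<^sub>R y) + - x)" using sublinearD(2)[OF q, of t y] by simp
    also have "\<dots> \<le> q (x + t *\<^sub>R y) + q (- x)" by (rule sublinearD(1)[OF q])
    finally show "- q (- x) \<le> q (x + t *\<^sub>R y) - t * q y" by simp
  qed
  have lower: "tilt q y x \<le> q (x + t *\<^sub>R y) - t * q y" if "0 \<le> t" for t x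
    unfolding tilt_def using that by (intro cINF_lower[OF bdd]) simp
  show "tilt q y x \<le> q x" for x using lower[of 0 x] by simp
  show "tilt q y (- y) \<le> - q y" using lower[of 1 "- y"] sublinearD(3)[OF q] by simp
  show "sublinear (tilt q y)"
    unfolding tilt_def[abs_def]
  proof (rule sublinear_INF[OF _ bdd])
    fix s t :: real and x z assume st: "s \<in> {0..}" "t \<in> {0..}"
    have "q ((x + z) + (s + t) *\<^sub>R y) = q ((x + s *\<^sub>R y) + (z + t *\<^sub>R y))"
      by (simp add: scaleR_add_left ac_simps)
    also have "\<dots> \<le> q (x + s *\<^sub>R y) + q (z + t *\<^sub>R y)" by (rule sublinearD(1)[OF q])
    finally show "\<exists>k\<in>{0..}. q ((x + z) + k *\<^sub>R y) - k * q y
        \<le> (q (x + s *\<^sub>R y) - s * q y) + (q (z + t *\<^sub>R y) - t * q y)"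
      using st by (intro bexI[of _ "s + t"]) (simp_all add: algebra_simps)
  next
    fix t r :: real and x assume t: "t \<in> {0..}" and r: "0 < r"
    have "q (r *\<^sub>R x + (r * t) *\<^sub>R y) = q (r *\<^sub>R (x + t *\<^sub>R y))" by (simp add: scaleR_add_right)
    also have "\<dots> = r * q (x + t *\<^sub>R y)" using r by (intro sublinearD(2)[OF q]) simp
    finally show "\<exists>k\<in>{0..}. q (r *\<^sub>R x + k *\<^sub>R y) - k * q y \<le> r * (q (x + t *\<^sub>R y) - t * q y)"
      using r t by (intro bexI[of _ "r * t"]) (simp_all add: algebra_simps)
  qed (auto simp: sublinearD(2)[OF q] intro!: bexI[of _ 0])
qed

text \<open>The Hahn--Banach theorem: a minimal sublinear functional is unchanged by tilting, hence odd in
  every direction, hence linear.\<close>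

lemma hahn_banach_sublinear:
  fixes p :: "'v::real_vector \<Rightarrow> real"
  assumes p: "sublinear p"
  obtains f where "linear f" "\<And>x. f x \<le> p x" "f x0 = p x0"
proof -
  \<comment> \<open>Linear functionals below \<open>p1\<close> agree with \<open>p\<close> at \<open>x0\<close>.\<close>
  define p1 where "p1 = tilt p x0"
  have p1: "sublinear p1" unfolding p1_def by (rule sublinear_tilt[OF p])
  define A where "A = {q. sublinear q \<and> q \<le> p1}"
  have po: "partial_order_on A (relation_of (\<lambda>q r. r \<le> q) A)"
    by (auto simp: partial_order_on_def preorder_on_def refl_on_def trans_on_def antisym_on_def
        relation_of_def)
  have "\<exists>u\<in>A. \<forall>a\<in>C. u \<le> a" if C: "C \<in> Chains (relation_of (\<lambda>q r. r \<le> q) A)" for C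
  proof (cases "C = {}")
    case True
    then show ?thesis using p1 by (auto simp: A_def)
  next
    case False
    have CA: "C \<subseteq> A" and chain: "\<And>q r. q \<in> C \<Longrightarrow> r \<in> C \<Longrightarrow> r \<le> q \<or> q \<le> r"
      using C by (auto simp: Chains_def relation_of_def)
    have sub: "sublinear q" and le1: "q x \<le> p1 x" if "q \<in> C" for q x
      using that CA by (auto simp: A_def le_fun_def)
    define u where "u x = (INF q\<in>C. q x)" for x
    have bdd: "bdd_below ((\<lambda>q. q x) ` C)" for x
    proof (rule bdd_belowI2)
      fix q assume "q \<in> C"
      then show "- p1 (- x) \<le> q x" using sublinearD(4)[OF sub, of q x] le1[of q "- x"] by simp
    qed
    have lower: "u x \<le> q x" if "q \<in> C" for q x
      unfolding u_def by (rule cINF_lower[OF bdd that])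
    have "sublinear u"
      unfolding u_def[abs_def]
    proof (rule sublinear_INF[OF False bdd])
      fix q r x y assume q: "q \<in> C" and r: "r \<in> C"
      obtain s where s: "s \<in> C" "s \<le> q" "s \<le> r" using chain[OF q r] q r by blast
      have "s (x + y) \<le> s x + s y" by (rule sublinearD(1)[OF sub[OF s(1)]])
      also have "\<dots> \<le> q x + r y" using s(2,3) by (intro add_mono) (auto simp: le_fun_def)
      finally show "\<exists>s\<in>C. s (x + y) \<le> q x + r y" using s(1) by blast
    next
      fix q x and r :: real assume "q \<in> C" "0 < r"
      then show "\<exists>s\<in>C. s (r *\<^sub>R x) \<le> r * q x" by (intro bexI[of _ q]) (simp_all add: sublinearD(2)[OF sub])
    qed (use False in \<open>auto simp: sublinearD(3)[OF sub]\<close>)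
    moreover have "u \<le> p1"
    proof (rule le_funI)
      fix x
      obtain q where "q \<in> C" using False by blast
      then show "u x \<le> p1 x" using lower[of q x] le1[of q x] by linarith
    qed
    ultimately show ?thesis using lower by (intro bexI[of _ u]) (auto simp: A_def le_fun_def)
  qed
  then obtain f where f: "f \<in> A" "\<And>q. q \<in> A \<Longrightarrow> q \<le> f \<Longrightarrow> q = f"
    using predicate_Zorn[OF po] by blast
  have fs: "sublinear f" and fp1: "f \<le> p1" using f(1) by (auto simp: A_def)
  have "tilt f y = f" for y
  proof (rule f(2))
    show "tilt f y \<le> f" using tilt_le[OF fs] by (simp add: le_fun_def)
    then show "tilt f y \<in> A" using sublinear_tilt[OF fs] fp1 by (auto simp: A_def)
  qed
  then have odd: "f (- y) = - f y" for y
    using tilt_minus_le[OF fs, of y] sublinearD(4)[OF fs, of "- y"] by simp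
  have "linear f"
  proof
    fix x y
    have "f x \<le> f (x + y) + f (- y)" using sublinearD(1)[OF fs, of "x + y" "- y"] by simp
    then show "f (x + y) = f x + f y" using sublinearD(1)[OF fs, of x y] odd[of y] by simp
  next
    fix r x
    show "f (r *\<^sub>R x) = r *\<^sub>R f x"
      using sublinearD(2)[OF fs, of r x] sublinearD(2)[OF fs, of "- r" x] odd[of "r *\<^sub>R x"]
      by (cases "0 \<le> r") auto
  qed
  moreover have fp: "f x \<le> p x" for x
    using fp1 tilt_le[OF p, of x0 x] by (auto simp: p1_def le_fun_def intro: order_trans)
  moreover have "p x0 \<le> f x0"
  proof -
    have "f (- x0) \<le> p1 (- x0)" using fp1 by (simp add: le_fun_def)
    also have "\<dots> \<le> - p x0" unfolding p1_def by (rule tilt_minus_le[OF p])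
    finally show ?thesis using odd by simp
  qed
  ultimately show thesis using that by (meson order_antisym)
qed

text \<open>Real parts of contractive positive functionals. The complex functional is recovered as
  \<open>x \<mapsto> g x - \<i> g (\<i> x)\<close>.\<close>

definition positive_functional :: "('a::cstar_algebra \<Rightarrow> real) \<Rightarrow> bool" where
  "positive_functional g \<longleftrightarrow> linear g \<and> (\<forall>x. g (star x) = g x) \<and> (\<forall>x. \<bar>g x\<bar> \<le> norm x) \<and>
     (\<forall>x. positive x \<longrightarrow> 0 \<le> g x)"

text \<open>Hahn--Banach is applied to the distance to the cone of negative elements. A linear functional
  below it is non-negative on positive elements, and on these elements the distance equals the
  norm.\<close>

lemma norming_positive_functional:
  fixes a :: "'a::cstar_algebra"
  obtains g where "positive_functional g" "g (star a * a) = (norm a)\<^sup>2"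
proof -
  define p where "p x = (INF w\<in>Collect positive. norm (x + w))" for x :: 'a
  have ne: "Collect positive \<noteq> {}" using positive_0 by blast
  have bdd: "bdd_below ((\<lambda>w. norm (x + w)) ` Collect positive)" for x :: 'a
    by (rule bdd_belowI2[of _ 0]) simp
  have lower: "p x \<le> norm (x + w)" if "positive w" for x w
    unfolding p_def using that by (intro cINF_lower[OF bdd]) simp
  have greatest: "c \<le> p x" if "\<And>w. positive w \<Longrightarrow> c \<le> norm (x + w)" for c x
    unfolding p_def using that by (intro cINF_greatest[OF ne]) simp
  have "sublinear p"
    unfolding p_def[abs_def]
  proof (rule sublinear_INF[OF ne bdd])
    fix x y v w :: 'a assume vw: "v \<in> Collect positive" "w \<in> Collect positive"
    have "norm ((x + y) + (v + w)) \<le> norm (x + v) + norm (y + w)"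
      using norm_triangle_ineq[of "x + v" "y + w"] by (simp add: algebra_simps)
    then show "\<exists>k\<in>Collect positive. norm ((x + y) + k) \<le> norm (x + v) + norm (y + w)"
      using vw by (intro bexI[of _ "v + w"]) (simp_all add: positive_add)
  next
    fix r :: real and x w :: 'a assume "w \<in> Collect positive" "0 < r"
    then show "\<exists>k\<in>Collect positive. norm (r *\<^sub>R x + k) \<le> r * norm (x + w)"
      by (intro bexI[of _ "r *\<^sub>R w"]) (simp_all add: positive_scaleR flip: scaleR_add_right)
  qed (auto simp: positive_0 intro!: bexI[of _ 0])
  then obtain f where f: "linear f" "\<And>x. f x \<le> p x" "f (star a * a) = p (star a * a)"
    using hahn_banach_sublinear[of p "star a * a"] by metis
  have f_le: "f x \<le> norm x" for x using f(2)[of x] lower[OF positive_0, of x] by simp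
  have f_pos: "0 \<le> f x" if "positive x" for x
    using f(2)[of "- x"] lower[OF that, of "- x"] by (simp add: linear_neg[OF f(1)])
  have fa: "f (star a * a) = (norm a)\<^sup>2"
  proof -
    have "norm (star a * a) \<le> p (star a * a)"
      by (intro greatest norm_mono_positive positive_star_mult)
    then show ?thesis using f_le[of "star a * a"] f(3) by (simp add: cstar_identity)
  qed
  \<comment> \<open>Averaging with the adjoint makes the functional blind to skew-adjoint elements.\<close>
  define g where "g x = (f x + f (star x)) / 2" for x
  have "linear g"
    by (rule linearI) (simp_all add: g_def linear_add[OF f(1)] linear_scale[OF f(1)] field_simps)
  moreover have "\<bar>g x\<bar> \<le> norm x" for x
    using f_le[of x] f_le[of "- x"] f_le[of "star x"] f_le[of "- star x"]
    by (simp add: g_def linear_neg[OF f(1)] abs_le_iff)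
  moreover have "0 \<le> g x" if "positive x" for x
    using f_pos[OF that] that by (simp add: g_def positive_def)
  moreover have "g (star x) = g x" for x by (simp add: g_def)
  moreover have "g (star a * a) = (norm a)\<^sup>2" using fa by (simp add: g_def)
  ultimately show thesis using that[of g] by (simp add: positive_functional_def)
qed

lemma positive_functionalD:
  assumes "positive_functional g"
  shows "linear g" "g (star x) = g x" "\<bar>g x\<bar> \<le> norm x" "positive x \<Longrightarrow> 0 \<le> g x"
    "g (x + y) = g x + g y" "g (x - y) = g x - g y" "g (r *\<^sub>R x) = r * g x" "g (- x) = - g x"
    "g 0 = 0"
proof -
  show "linear g" "g (star x) = g x" "\<bar>g x\<bar> \<le> norm x" "positive x \<Longrightarrow> 0 \<le> g x"
    using assms by (auto simp: positive_functional_def)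
  then show "g (x + y) = g x + g y" "g (x - y) = g x - g y" "g (r *\<^sub>R x) = r * g x" "g (- x) = - g x"
    "g 0 = 0"
    by (simp_all add: linear_add linear_diff linear_scale linear_neg linear_0)
qed

text \<open>A geometrically weighted sum of functionals norming a dense sequence. If it vanishes at
  \<open>a*a\<close>, then all of them do, so \<open>a\<close> cannot be far from zero.\<close>

lemma faithful_positive_functional:
  fixes D :: "'a::cstar_algebra set"
  assumes "countable D" "closure D = UNIV"
  obtains g :: "'a \<Rightarrow> real" where "positive_functional g" "\<And>a. g (star a * a) = 0 \<Longrightarrow> a = 0"
proof -
  have "D \<noteq> {}" using assms(2) by auto
  define d where "d = from_nat_into D"
  have range_d: "range d = D" unfolding d_def by (rule range_from_nat_into) fact+
  have "\<forall>n. \<exists>g. positive_functional g \<and> g (star (d n) * d n) = (norm (d n))\<^sup>2"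
    using norming_positive_functional by metis
  then obtain G where G: "\<And>n. positive_functional (G n)" "\<And>n. G n (star (d n) * d n) = (norm (d n))\<^sup>2"
    by metis
  let ?w = "\<lambda>n. (1/2 :: real) ^ Suc n"
  define g where "g x = (\<Sum>n. ?w n * G n x)" for x
  have w: "?w sums 1" by (rule power_half_series)
  have le: "\<bar>?w n * G n x\<bar> \<le> ?w n * norm x" for n x
    using positive_functionalD(3)[OF G(1), of n x] by (simp add: abs_mult)
  have sw: "summable (\<lambda>n. ?w n * norm x)" for x using w by (intro summable_mult2) (auto simp: sums_iff)
  have summ: "summable (\<lambda>n. ?w n * G n x)" for x
    by (rule summable_comparison_test'[OF sw[of x]]) (use le in auto)
  have pos: "0 \<le> ?w n * G n x" if "positive x" for n x
    using positive_functionalD(4)[OF G(1) that, of n] by simp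
  have "positive_functional g"
    unfolding positive_functional_def
  proof (intro conjI allI impI)
    show "linear g"
    proof (rule linearI)
      fix x y r
      show "g (x + y) = g x + g y"
        using suminf_add[OF summ[of x] summ[of y]]
        by (simp add: g_def positive_functionalD(5)[OF G(1)] distrib_left)
      show "g (r *\<^sub>R x) = r *\<^sub>R g x"
        using suminf_mult[OF summ[of x], of r]
        by (simp add: g_def positive_functionalD(7)[OF G(1)] mult.left_commute)
    qed
  next
    fix x :: 'a
    show "g (star x) = g x" by (simp add: g_def positive_functionalD(2)[OF G(1)])
    have "norm (g x) \<le> (\<Sum>n. ?w n * norm x)"
      unfolding g_def by (rule norm_suminf_le[OF _ sw]) (use le in auto)
    also have "\<dots> = norm x" using w suminf_mult2[of ?w "norm x"] by (simp add: sums_iff)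
    finally show "\<bar>g x\<bar> \<le> norm x" by simp
    show "0 \<le> g x" if "positive x" unfolding g_def by (intro suminf_nonneg summ pos that)
  qed
  moreover have "a = 0" if a: "g (star a * a) = 0" for a
  proof -
    have "\<forall>n. ?w n * G n (star a * a) = 0"
      using a suminf_eq_zero_iff[OF summ, of "star a * a"] pos[OF positive_star_mult] by (simp add: g_def)
    then have G0: "G n (star a * a) = 0" for n by simp
    have near: "norm (d n) \<le> 2 * norm (d n - a)" for n
    proof -
      \<comment> \<open>The parallelogram identity for \<open>d n = a + (d n - a)\<close> in the seminorm of \<open>G n\<close>.\<close>
      let ?u = "d n - a" and ?v = "a - (d n - a)"
      have "star ?u * ?u + star ?u * ?u + (star a * a + star a * a) = star (d n) * d n + star ?v * ?v"
        by (simp add: algebra_simps)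
      then have "G n (star ?u * ?u + star ?u * ?u + (star a * a + star a * a))
          = G n (star (d n) * d n + star ?v * ?v)" by (rule arg_cong)
      then have "2 * G n (star ?u * ?u) + 2 * G n (star a * a) = G n (star (d n) * d n) + G n (star ?v * ?v)"
        by (simp only: positive_functionalD(5)[OF G(1)] mult_2)
      then have "(norm (d n))\<^sup>2 \<le> 2 * G n (star ?u * ?u)"
        using positive_functionalD(4)[OF G(1) positive_star_mult, of n ?v] G0[of n] G(2)[of n]
        by linarith
      also have "\<dots> \<le> 2 * (norm ?u)\<^sup>2"
        using positive_functionalD(3)[OF G(1), of n "star ?u * ?u"] cstar_identity[of ?u] by linarith
      also have "\<dots> \<le> (2 * norm ?u)\<^sup>2" by (simp add: power_mult_distrib)
      finally show ?thesis by (rule power2_le_imp_le) simp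
    qed
    have "norm a < e" if "0 < e" for e
    proof -
      have "a \<in> closure D" using assms(2) by simp
      then obtain y where "y \<in> D" "dist y a < e / 3" using \<open>0 < e\<close> by (meson closure_approachable divide_pos_pos zero_less_numeral)
      then obtain n where n: "norm (d n - a) < e / 3" using range_d by (auto simp: dist_norm)
      have "norm a \<le> norm (d n) + norm (d n - a)"
        using norm_triangle_ineq4[of "d n" "d n - a"] by simp
      then show ?thesis using near[of n] n by linarith
    qed
    then show "a = 0" by (metis less_irrefl norm_eq_zero zero_less_norm_iff)
  qed
  ultimately show thesis by (rule that)
qed


section \<open>Separability of countably generated C*-algebras\<close>

lemma bounded_bilinear_scaleC_cstar:
  "bounded_bilinear (scaleC :: complex \<Rightarrow> 'a::cstar_algebra \<Rightarrow> 'a)"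
proof
  show "\<exists>K. \<forall>c (x :: 'a). norm (c *\<^sub>C x) \<le> norm c * norm x * K"
    by (rule exI[of _ 1]) (simp add: norm_scaleC)
  show "(r *\<^sub>R c) *\<^sub>C x = r *\<^sub>R (c *\<^sub>C x)" for r c and x :: 'a
    by (simp add: scaleR_conv_of_real[of r c] flip: scaleC_scaleC scaleC_of_real)
  show "c *\<^sub>C (r *\<^sub>R x) = r *\<^sub>R (c *\<^sub>C x)" for r c and x :: 'a
    by (rule scaleC_scaleR)
qed (simp_all add: scaleC_simps)

text \<open>With \<open>Q\<close> countable and dense in the complex numbers, the union over all \<open>n\<close> is a countable set
  whose closure is the C*-subalgebra generated by \<open>G\<close> and the unit.\<close>

primrec star_hull :: "complex set \<Rightarrow> 'a::cstar_algebra set \<Rightarrow> nat \<Rightarrow> 'a set" where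
  "star_hull Q G 0 = insert 0 (insert 1 G)"
| "star_hull Q G (Suc n) = star_hull Q G n \<union> (\<lambda>(x, y). x + y) ` (star_hull Q G n \<times> star_hull Q G n)
     \<union> (\<lambda>(x, y). x * y) ` (star_hull Q G n \<times> star_hull Q G n) \<union> star ` star_hull Q G n
     \<union> (\<lambda>(c, x). c *\<^sub>C x) ` (Q \<times> star_hull Q G n)"

lemma countable_dense_if_generates:
  fixes G :: "'a::cstar_algebra set"
  assumes "countable G" "generates G"
  obtains D :: "'a set" where "countable D" "closure D = UNIV"
proof -
  obtain Q :: "complex set" where Q: "countable Q" "\<And>X. open X \<Longrightarrow> X \<noteq> {} \<Longrightarrow> \<exists>d\<in>Q. d \<in> X"
    using countable_dense_exists by blast
  have Qd: "c \<in> closure Q" for c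
    unfolding closure_approachable using Q(2)[of "ball c _"] by (auto simp: dist_commute)
  let ?S = "star_hull Q G"
  define S where "S = (\<Union>n. ?S n)"
  have mono: "?S m \<subseteq> ?S n" if "m \<le> n" for m n
    by (rule lift_Suc_mono_le[OF _ that]) auto
  have countable: "countable (?S n)" for n
    using assms(1) Q(1) by (induction n) auto
  have pair: "\<exists>n. x \<in> ?S n \<and> y \<in> ?S n" if "x \<in> S" "y \<in> S" for x y
  proof -
    obtain m n where "x \<in> ?S m" "y \<in> ?S n" using \<open>x \<in> S\<close> \<open>y \<in> S\<close> by (auto simp: S_def)
    then show ?thesis
      using mono[OF max.cobounded1, of m n] mono[OF max.cobounded2, of n m] by blast
  qed
  have S_add: "x + y \<in> S" and S_mult: "x * y \<in> S" if "x \<in> S" "y \<in> S" for x y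
  proof -
    obtain n where "x \<in> ?S n" "y \<in> ?S n" using pair[OF \<open>x \<in> S\<close> \<open>y \<in> S\<close>] by blast
    then have "x + y \<in> ?S (Suc n)" "x * y \<in> ?S (Suc n)" by (auto simp: image_iff)
    then show "x + y \<in> S" "x * y \<in> S" unfolding S_def by blast+
  qed
  have S_star: "star x \<in> S" if "x \<in> S" for x
  proof -
    obtain n where "x \<in> ?S n" using \<open>x \<in> S\<close> by (auto simp: S_def)
    then have "star x \<in> ?S (Suc n)" by auto
    then show ?thesis unfolding S_def by blast
  qed
  have S_scale: "c *\<^sub>C x \<in> S" if "c \<in> Q" "x \<in> S" for c x
  proof -
    obtain n where "x \<in> ?S n" using \<open>x \<in> S\<close> by (auto simp: S_def)
    then have "c *\<^sub>C x \<in> ?S (Suc n)" using that(1) by (auto simp: image_iff)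
    then show ?thesis unfolding S_def by blast
  qed
  have base: "insert 0 (insert 1 G) \<subseteq> closure S"
  proof -
    have "?S 0 \<subseteq> S" unfolding S_def by blast
    then show ?thesis using closure_subset[of S] by auto
  qed
  have seq: "\<exists>f. (\<forall>n. f n \<in> S) \<and> f \<longlonglongrightarrow> x" if "x \<in> closure S" for x
    using that unfolding closure_sequential .
  have in_closure: "x \<in> closure S" if "\<And>n. f n \<in> S" "f \<longlonglongrightarrow> x" for f x
    using that unfolding closure_sequential by blast
  have "cstar_subalgebra (closure S)"
    unfolding cstar_subalgebra_def csubspace_def
  proof (intro conjI ballI allI)
    show "0 \<in> closure S" using base by simp
  next
    fix x y assume "x \<in> closure S" "y \<in> closure S"
    then obtain f h where f: "\<forall>n. f n \<in> S" "f \<longlonglongrightarrow> x" and h: "\<forall>n. h n \<in> S" "h \<longlonglongrightarrow> y"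
      using seq by metis
    show "x + y \<in> closure S"
      by (rule in_closure[OF S_add tendsto_add[OF f(2) h(2)]]) (simp_all add: f h)
    show "x * y \<in> closure S"
      by (rule in_closure[OF S_mult tendsto_mult[OF f(2) h(2)]]) (simp_all add: f h)
  next
    fix x assume "x \<in> closure S"
    then obtain f where f: "\<forall>n. f n \<in> S" "f \<longlonglongrightarrow> x" using seq by blast
    show "star x \<in> closure S"
      by (rule in_closure[OF S_star bounded_linear.tendsto[OF bounded_linear_star f(2)]]) (simp add: f)
    fix c
    obtain k where k: "\<forall>n. k n \<in> Q" "k \<longlonglongrightarrow> c" using Qd[of c] unfolding closure_sequential by blast
    have "(\<lambda>n. k n *\<^sub>C f n) \<longlonglongrightarrow> c *\<^sub>C x"
      by (rule bounded_bilinear.tendsto[OF bounded_bilinear_scaleC_cstar k(2) f(2)])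
    then show "c *\<^sub>C x \<in> closure S" by (rule in_closure[rotated]) (simp add: k f S_scale)
  qed simp
  then have "(\<Inter>{B. cstar_subalgebra B \<and> G \<subseteq> B \<and> 1 \<in> B}) \<subseteq> closure S" using base by blast
  then have "closure S = UNIV" using assms(2) unfolding generates_def by blast
  moreover have "countable S" unfolding S_def using countable by blast
  ultimately show thesis using that by blast
qed


section \<open>Separable C*-algebras have faithful separable representations\<close>

text \<open>Carries the identities that define a representation from a dense subspace to its closure.\<close>

lemma limit_identity:
  fixes f g :: "'h::complex_inner \<Rightarrow> 'k::t2_space"
  assumes "x \<in> closure M" "\<And>y. y \<in> M \<Longrightarrow> f y = g y"
    and "\<And>u. (\<And>n. u n \<in> M) \<Longrightarrow> u \<longlonglongrightarrow> x \<Longrightarrow> (\<lambda>n. f (u n)) \<longlonglongrightarrow> f x"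
    and "\<And>u. (\<And>n. u n \<in> M) \<Longrightarrow> u \<longlonglongrightarrow> x \<Longrightarrow> (\<lambda>n. g (u n)) \<longlonglongrightarrow> g x"
  shows "f x = g x"
proof -
  obtain u where u: "\<And>n. u n \<in> M" "u \<longlonglongrightarrow> x"
    using assms(1) unfolding closure_sequential by blast
  have "(\<lambda>n. f (u n)) \<longlonglongrightarrow> f x" by (rule assms(3)[OF u])
  moreover have "(\<lambda>n. f (u n)) \<longlonglongrightarrow> g x" using assms(4)[OF u] assms(2)[OF u(1)] by simp
  ultimately show ?thesis by (rule LIMSEQ_unique)
qed

lemma bop_extension_to_closure:
  fixes T :: "'h::complex_inner \<Rightarrow> 'k::{complex_inner,complete_space}"
  assumes M: "csubspace M"
    and T: "\<And>x. x \<in> M \<Longrightarrow> T x \<in> N"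
      "\<And>x y. x \<in> M \<Longrightarrow> y \<in> M \<Longrightarrow> T (x + y) = T x + T y"
      "\<And>c x. x \<in> M \<Longrightarrow> T (c *\<^sub>C x) = c *\<^sub>C T x"
      "\<And>x. x \<in> M \<Longrightarrow> norm (T x) \<le> B * norm x"
  obtains T' where "T' \<in> bop (closure M) (closure N)" "\<And>x. x \<in> M \<Longrightarrow> T' x = T x"
proof -
  note Ms = csubspaceD[OF M]
  have Td: "T (x - y) = T x - T y" if "x \<in> M" "y \<in> M" for x y
    using T(2)[OF that(1) Ms(4)[OF that(2)]] T(3)[OF that(2), of "-1"] by (simp add: scaleC_minus_one)
  have "(\<bar>B\<bar>)-lipschitz_on M T"
  proof (rule lipschitz_onI)
    fix x y assume xy: "x \<in> M" "y \<in> M"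
    have "norm (T (x - y)) \<le> B * norm (x - y)" by (intro T Ms xy)
    also have "\<dots> \<le> \<bar>B\<bar> * norm (x - y)" by (intro mult_right_mono) auto
    finally show "dist (T x) (T y) \<le> \<bar>B\<bar> * dist x y" by (simp add: dist_norm Td[OF xy])
  qed simp
  then have uc: "uniformly_continuous_on M T" by (rule lipschitz_on_uniformly_continuous)
  obtain T1 where T1: "uniformly_continuous_on (closure M) T1" "\<And>x. x \<in> M \<Longrightarrow> T x = T1 x"
    by (rule uniformly_continuous_on_extension_on_closure[OF uc], rule that)
  have cont: "(\<lambda>n. T1 (u n)) \<longlonglongrightarrow> T1 x" if "\<And>n. u n \<in> closure M" "u \<longlonglongrightarrow> x" "x \<in> closure M" for u x
    using uniformly_continuous_imp_continuous[OF T1(1)] that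
    unfolding continuous_on_sequentially comp_def by blast
  have seq: "\<exists>u. (\<forall>n. u n \<in> M) \<and> u \<longlonglongrightarrow> x" if "x \<in> closure M" for x
    using that unfolding closure_sequential .
  have sub: "y \<in> M \<Longrightarrow> y \<in> closure M" for y using closure_subset by blast
  note Mc = csubspaceD[OF csubspace_closure[OF M]]
  have "(\<lambda>x\<in>closure M. T1 x) \<in> bop (closure M) (closure N)"
  proof (rule bop_restrictI[OF csubspace_closure[OF M], where B = B])
    fix x assume x: "x \<in> closure M"
    then obtain u where u: "\<forall>n. u n \<in> M" "u \<longlonglongrightarrow> x" using seq by blast
    have lim: "(\<lambda>n. T1 (u n)) \<longlonglongrightarrow> T1 x" by (rule cont[OF _ u(2) x]) (simp add: u sub)
    have "T1 (u n) \<in> N" for n using u(1) T1(2) T(1) by metis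
    then show "T1 x \<in> closure N" using lim unfolding closure_sequential
      by (intro exI[of _ "\<lambda>n. T1 (u n)"]) simp
    have "norm (T1 (u n)) \<le> B * norm (u n)" for n using u(1) T1(2) T(4) by metis
    moreover have "(\<lambda>n. B * norm (u n)) \<longlonglongrightarrow> B * norm x" by (intro tendsto_intros u)
    ultimately show "norm (T1 x) \<le> B * norm x"
      using tendsto_norm[OF lim] by (meson LIMSEQ_le)
    show "T1 (c *\<^sub>C x) = c *\<^sub>C T1 x" for c
    proof (rule LIMSEQ_unique)
      show "(\<lambda>n. T1 (c *\<^sub>C u n)) \<longlonglongrightarrow> T1 (c *\<^sub>C x)"
        by (rule cont[OF _ tendsto_scaleC[OF u(2)] Mc(3)[OF x]]) (simp add: u sub Ms)
      have "T1 (c *\<^sub>C u n) = c *\<^sub>C T1 (u n)" for n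
        using T(3)[of "u n" c] T1(2)[of "u n"] T1(2)[of "c *\<^sub>C u n"] u(1) Ms(3) by simp
      then show "(\<lambda>n. T1 (c *\<^sub>C u n)) \<longlonglongrightarrow> c *\<^sub>C T1 x" using tendsto_scaleC[OF lim] by simp
    qed
    fix y assume y: "y \<in> closure M"
    then obtain v where v: "\<forall>n. v n \<in> M" "v \<longlonglongrightarrow> y" using seq by blast
    have lim_v: "(\<lambda>n. T1 (v n)) \<longlonglongrightarrow> T1 y" by (rule cont[OF _ v(2) y]) (simp add: v sub)
    show "T1 (x + y) = T1 x + T1 y"
    proof (rule LIMSEQ_unique)
      show "(\<lambda>n. T1 (u n + v n)) \<longlonglongrightarrow> T1 (x + y)"
        by (rule cont[OF _ tendsto_add[OF u(2) v(2)] Mc(2)[OF x y]]) (simp add: u v sub Ms)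
      have "T1 (u n + v n) = T1 (u n) + T1 (v n)" for n
        using T(2)[of "u n" "v n"] T1(2)[of "u n"] T1(2)[of "v n"] T1(2)[of "u n + v n"] u(1) v(1) Ms(2)
        by simp
      then show "(\<lambda>n. T1 (u n + v n)) \<longlonglongrightarrow> T1 x + T1 y" using tendsto_add[OF lim lim_v] by simp
    qed
  qed
  then show thesis using T1(2) sub by (intro that[of "\<lambda>x\<in>closure M. T1 x"]) auto
qed

text \<open>The GNS construction for a faithful positive functional: the form \<open>\<langle>a, b\<rangle> = F (b* a)\<close> is
  realised in \<open>\<ell>\<^sup>2\<close>, and left multiplication extends to the closure. That left multiplication is
  bounded means \<open>b* a* a b \<le> \<parallel>a\<parallel>\<^sup>2 b* b\<close>.\<close>

theorem faithful_separable_representation: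
  fixes D :: "'a::cstar_algebra set"
  assumes D: "countable D" "closure D = UNIV"
  obtains H :: "ell2 set" and \<pi> :: "'a \<Rightarrow> ell2 \<Rightarrow> ell2"
    where "separable_hilbert H" "faithful_representation H \<pi>"
proof -
  obtain g :: "'a \<Rightarrow> real" where g: "positive_functional g" and faithful: "\<And>a. g (star a * a) = 0 \<Longrightarrow> a = 0"
    by (rule faithful_positive_functional[OF D], rule that)
  note gD = positive_functionalD[OF g]
  define F where "F x = Complex (g x) (- g (\<i> *\<^sub>C x))" for x
  have F_add: "F (x + y) = F x + F y" for x y
    by (simp add: F_def complex_eq_iff gD scaleC_add_right)
  have F_scale: "F (c *\<^sub>C x) = c * F x" for c x
  proof -
    have c: "c *\<^sub>C x = Re c *\<^sub>R x + Im c *\<^sub>R (\<i> *\<^sub>C x)"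
      by (subst complex_eq[of c])
         (simp add: scaleC_add_left scaleC_of_real mult.commute[of \<i>] flip: scaleC_scaleC)
    have ic: "\<i> *\<^sub>C (c *\<^sub>C x) = Re c *\<^sub>R (\<i> *\<^sub>C x) - Im c *\<^sub>R x"
      unfolding c by (simp add: scaleC_add_right scaleC_scaleR scaleC_scaleC scaleC_minus_one)
    have "g (c *\<^sub>C x) = Re c * g x + Im c * g (\<i> *\<^sub>C x)" unfolding c by (simp add: gD)
    moreover have "g (\<i> *\<^sub>C (c *\<^sub>C x)) = Re c * g (\<i> *\<^sub>C x) - Im c * g x"
      unfolding ic by (simp add: gD)
    ultimately show ?thesis by (simp add: F_def complex_eq_iff)
  qed
  have F_star: "F (star x) = cnj (F x)" for x
  proof -
    have "g (\<i> *\<^sub>C star x) = g (star (- (\<i> *\<^sub>C x)))" by (simp add: scaleC_minus_left)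
    also have "\<dots> = - g (\<i> *\<^sub>C x)" by (simp only: gD)
    finally show ?thesis by (simp add: F_def complex_eq_iff gD)
  qed
  define B where "B a b = F (star b * a)" for a b
  have Re_B: "Re (B a a) = g (star a * a)" for a by (simp add: B_def F_def)
  interpret psd_form UNIV B
  proof (rule psd_formI)
    fix x y z :: 'a and c
    show "B (x + y) z = B x z + B y z" by (simp add: B_def distrib_left F_add)
    show "B (c *\<^sub>C x) z = c * B x z" by (simp add: B_def mult_scaleC_right F_scale)
    show "B x y = cnj (B y x)" using F_star[of "star x * y"] by (simp add: B_def)
    show "0 \<le> Re (B x x)" unfolding Re_B by (intro gD positive_star_mult)
  qed simp
  have Re_B_le: "Re (B a a) \<le> (norm a)\<^sup>2" for a
    using gD(3)[of "star a * a"] by (simp add: Re_B cstar_identity)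
  have D_dense: "\<exists>d\<in>D. norm (x - d) < e" if "0 < e" for x e
    using D(2) that closure_approachable[of x D] by (auto simp: dist_norm norm_minus_commute)
  have dense: "\<exists>d\<in>D. Re (B (x - d) (x - d)) < e" if "0 < e" for x e
    by (rule dense_if_norm_dense[where N = norm]) (simp_all add: D_dense Re_B_le that)
  obtain U :: "'a \<Rightarrow> ell2" where U: "\<And>x y. U (x + y) = U x + U y" "\<And>c x. U (c *\<^sub>C x) = c *\<^sub>C U x"
    "\<And>x y. cinner (U x) (U y) = B x y"
  proof (rule ell2_realisation[of D])
    fix U :: "'a \<Rightarrow> ell2"
    assume "\<And>x y. x \<in> UNIV \<Longrightarrow> y \<in> UNIV \<Longrightarrow> U (x + y) = U x + U y"
      "\<And>c x. x \<in> UNIV \<Longrightarrow> U (c *\<^sub>C x) = c *\<^sub>C U x"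
      "\<And>x y. x \<in> UNIV \<Longrightarrow> y \<in> UNIV \<Longrightarrow> cinner (U x) (U y) = B x y"
    then show thesis by (intro that[of U]) simp_all
  qed (simp_all add: D(1) dense)
  have norm_U: "(norm (U a))\<^sup>2 = g (star a * a)" for a by (simp add: norm_eq_Re_cinner U Re_B)
  have U_diff: "U (x - y) = U x - U y" for x y
    using U(1)[of x "- y"] U(2)[of "-1" y] by (simp add: scaleC_minus_one)
  have norm_U_le: "norm (U a) \<le> norm a" for a
    using Re_B_le[of a] norm_U[of a] by (simp add: Re_B power2_le_imp_le)
  have inj_U: "inj U"
  proof (rule injI)
    fix x y assume "U x = U y"
    then have "norm (U (x - y)) = 0" by (simp add: U_diff)
    then have "g (star (x - y) * (x - y)) = 0" using norm_U[of "x - y"] by simp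
    then show "x = y" using faithful[of "x - y"] by simp
  qed
  have mult_bound: "norm (U (a * b)) \<le> norm a * norm (U b)" for a b
  proof -
    have "positive ((norm a)\<^sup>2 *\<^sub>R 1 - star a * a)"
      by (rule positive_norm_diff) (simp_all add: cstar_identity)
    then have "positive (star b * ((norm a)\<^sup>2 *\<^sub>R 1 - star a * a) * b)" by (rule positive_conjugate)
    then have "0 \<le> g (star b * ((norm a)\<^sup>2 *\<^sub>R 1 - star a * a) * b)" by (rule gD)
    also have "star b * ((norm a)\<^sup>2 *\<^sub>R 1 - star a * a) * b
        = (norm a)\<^sup>2 *\<^sub>R (star b * b) - star (a * b) * (a * b)"
      by (simp add: algebra_simps)
    finally have "g (star (a * b) * (a * b)) \<le> (norm a)\<^sup>2 * g (star b * b)"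
      by (simp only: gD)
    then have "(norm (U (a * b)))\<^sup>2 \<le> (norm a * norm (U b))\<^sup>2"
      by (simp only: norm_U power_mult_distrib)
    then show ?thesis by (rule power2_le_imp_le) simp
  qed
  define M where "M = range U"
  have M: "csubspace M"
    unfolding csubspace_def
  proof (intro conjI ballI allI)
    show "0 \<in> M" using U(2)[of 0 0] by (auto simp: M_def image_iff intro!: exI[of _ 0])
    show "x + y \<in> M" if "x \<in> M" "y \<in> M" for x y using that U(1) by (auto simp: M_def simp flip: U(1))
    show "c *\<^sub>C x \<in> M" if "x \<in> M" for c x using that by (auto simp: M_def simp flip: U(2))
  qed
  define H where "H = closure M"
  have H: "hilbert H" unfolding hilbert_def H_def by (simp add: csubspace_closure M complete_eq_closed)
  note Hs = hilbertD(1)[OF H]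
  have MH: "x \<in> M \<Longrightarrow> x \<in> H" for x unfolding H_def using closure_subset by blast
  have "separable_hilbert H"
    unfolding separable_hilbert_iff
  proof (intro conjI H exI[of _ "U ` D"])
    show "countable (U ` D)" using D(1) by simp
    show "U ` D \<subseteq> H" using MH by (auto simp: M_def)
    have "M \<subseteq> closure (U ` D)"
      unfolding M_def
    proof (intro image_subsetI)
      fix a
      have "a \<in> closure D" using D by simp
      show "U a \<in> closure (U ` D)"
        unfolding closure_approachable
      proof (intro allI impI)
        fix e :: real assume "0 < e"
        then obtain d where d: "d \<in> D" "dist d a < e"
          using \<open>a \<in> closure D\<close> by (meson closure_approachable)
        have "dist (U d) (U a) < e"
          using norm_U_le[of "d - a"] d(2) by (simp add: dist_norm U_diff)
        then show "\<exists>y\<in>U ` D. dist y (U a) < e" using d(1) by blast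
      qed
    qed
    then show "H \<subseteq> closure (U ` D)" unfolding H_def by (simp add: closure_minimal)
  qed
  have "\<exists>T. T \<in> bop H H \<and> (\<forall>b. T (U b) = U (a * b))" for a
  proof -
    define T where "T h = U (a * inv U h)" for h
    have TU: "T (U b) = U (a * b)" for b by (simp add: T_def inv_f_f[OF inj_U])
    obtain T' where T': "T' \<in> bop (closure M) (closure M)" "\<And>x. x \<in> M \<Longrightarrow> T' x = T x"
    proof (rule bop_extension_to_closure[OF M, of T M "norm a"])
      fix x y c assume "x \<in> M"
      then obtain b where b: "x = U b" by (auto simp: M_def)
      show "T x \<in> M" by (simp add: b TU M_def)
      show "T (c *\<^sub>C x) = c *\<^sub>C T x" by (simp add: b TU mult_scaleC_right flip: U(2))
      show "norm (T x) \<le> norm a * norm x" by (simp add: b TU mult_bound)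
      assume "y \<in> M"
      then obtain b' where b': "y = U b'" by (auto simp: M_def)
      show "T (x + y) = T x + T y" by (simp add: b b' TU distrib_left flip: U(1))
    qed (rule that)
    then have "T' (U b) = U (a * b)" for b using TU by (simp add: M_def)
    then show ?thesis using T'(1) unfolding H_def by blast
  qed
  then obtain \<pi> where \<pi>: "\<And>a. \<pi> a \<in> bop H H" "\<And>a b. \<pi> a (U b) = U (a * b)" by metis
  have lim: "(\<lambda>n. \<pi> a (u n)) \<longlonglongrightarrow> \<pi> a x" if "\<And>n. u n \<in> H" "u \<longlonglongrightarrow> x" for a u x
  proof -
    have "x \<in> H" using that hilbertD(3)[OF H] by (meson closed_sequentially)
    then show ?thesis by (intro bop_tendsto[OF \<pi>(1) Hs] that)
  qed
  have "star_representation H \<pi>"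
  proof (rule star_representationI[OF Hs \<pi>(1)])
    fix a b :: 'a and h assume h: "h \<in> H"
    show "\<pi> (a + b) h = \<pi> a h + \<pi> b h"
      by (rule limit_identity[OF h[unfolded H_def]])
         (auto simp: M_def \<pi> distrib_right U MH intro!: lim tendsto_add)
    show "\<pi> (c *\<^sub>C a) h = c *\<^sub>C \<pi> a h" for c
      by (rule limit_identity[OF h[unfolded H_def]])
         (auto simp: M_def \<pi> mult_scaleC_left U MH intro!: lim tendsto_scaleC)
    show "\<pi> (a * b) h = \<pi> a (\<pi> b h)"
      by (rule limit_identity[OF h[unfolded H_def]])
         (auto simp: M_def \<pi> mult.assoc MH intro!: lim bopD(1)[OF \<pi>(1)])
    show "\<pi> 1 h = h"
      by (rule limit_identity[OF h[unfolded H_def]]) (auto simp: M_def \<pi> MH intro!: lim)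
  next
    fix a :: 'a and x y assume x: "x \<in> H" and y: "y \<in> H"
    have M_case: "cinner (\<pi> a x) (U c) = cinner x (\<pi> (star a) (U c))" for c
      by (rule limit_identity[OF x[unfolded H_def]])
         (auto simp: M_def \<pi> U B_def mult.assoc MH intro!: lim tendsto_cinner)
    show "cinner (\<pi> a x) y = cinner x (\<pi> (star a) y)"
      by (rule limit_identity[OF y[unfolded H_def], where f = "\<lambda>y. cinner (\<pi> a x) y"])
         (auto simp: M_def M_case MH intro!: lim tendsto_cinner[OF tendsto_const])
  qed
  moreover have "inj \<pi>"
  proof (rule injI)
    fix a b assume "\<pi> a = \<pi> b"
    then have "U (a * 1) = U (b * 1)" using \<pi>(2) by metis
    then show "a = b" using inj_U by (simp add: inj_eq)
  qed
  ultimately show thesis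
    using \<open>separable_hilbert H\<close> that unfolding faithful_representation_def by blast
qed


section \<open>Orthogonal sums\<close>

instantiation complex :: complex_inner
begin

definition scaleC_complex :: "complex \<Rightarrow> complex \<Rightarrow> complex" where
  "scaleC_complex c z = c * z"
definition cinner_complex :: "complex \<Rightarrow> complex \<Rightarrow> complex" where
  "cinner_complex x y = x * cnj y"

instance
  by standard
     (auto simp: scaleC_complex_def cinner_complex_def algebra_simps inner_complex_def scaleR_conv_of_real)

end

instantiation prod :: (complex_vector, complex_vector) complex_vector
begin

definition scaleC_prod :: "complex \<Rightarrow> 'a \<times> 'b \<Rightarrow> 'a \<times> 'b" where
  "scaleC_prod c p = (c *\<^sub>C fst p, c *\<^sub>C snd p)"

instance
  by standard
     (auto simp: scaleC_prod_def scaleC_simps scaleC_scaleC scaleC_of_real scaleR_prod_def)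

end

instantiation prod :: (complex_inner, complex_inner) complex_inner
begin

definition cinner_prod :: "'a \<times> 'b \<Rightarrow> 'a \<times> 'b \<Rightarrow> complex" where
  "cinner_prod p q = cinner (fst p) (fst q) + cinner (snd p) (snd q)"

instance
proof
  fix x y :: "'a \<times> 'b"
  show "cinner x y = cnj (cinner y x)"
    using cinner_commute[of "fst x" "fst y"] cinner_commute[of "snd x" "snd y"]
    by (simp only: cinner_prod_def complex_cnj_add)
qed (simp_all add: cinner_prod_def scaleC_prod_def algebra_simps inner_prod_def inner_eq_Re_cinner)

end

lemma scaleC_Pair [simp]: "c *\<^sub>C (x, y) = (c *\<^sub>C x, c *\<^sub>C y)"
  by (simp add: scaleC_prod_def)

lemma fst_scaleC [simp]: "fst (c *\<^sub>C p) = c *\<^sub>C fst p" and snd_scaleC [simp]: "snd (c *\<^sub>C p) = c *\<^sub>C snd p"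
  by (simp_all add: scaleC_prod_def)

lemma cinner_Pair [simp]: "cinner (x, y) (x', y') = cinner x x' + cinner y y'"
  by (simp add: cinner_prod_def)

lemma norm_fst_snd_le: "norm (fst p) \<le> norm p" "norm (snd p) \<le> norm p"
  for p :: "'a::real_normed_vector \<times> 'b::real_normed_vector"
  using norm_fst_le[of "fst p" "snd p"] norm_snd_le[of "snd p" "fst p"] by simp_all

lemma csubspace_Times: "csubspace H \<Longrightarrow> csubspace K \<Longrightarrow> csubspace (H \<times> K)"
  unfolding csubspace_def by (auto simp: zero_prod_def)

lemma separable_hilbert_Times:
  assumes H: "separable_hilbert H" and K: "separable_hilbert K"
  shows "separable_hilbert (H \<times> K)"
proof -
  have HK: "hilbert H" "hilbert K" using H K by (auto simp: separable_hilbert_def)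
  have "complete (H \<times> K)"
    unfolding complete_def
  proof (intro allI impI, elim conjE)
    fix s :: "nat \<Rightarrow> 'a \<times> 'b" assume s: "\<forall>n. s n \<in> H \<times> K" "Cauchy s"
    have "Cauchy (\<lambda>n. fst (s n))" "Cauchy (\<lambda>n. snd (s n))" using s(2) by (auto intro: Cauchy_fst Cauchy_snd)
    moreover have "\<forall>n. fst (s n) \<in> H" "\<forall>n. snd (s n) \<in> K" using s(1) by (auto simp: mem_Times_iff)
    ultimately obtain x y where "x \<in> H" "(\<lambda>n. fst (s n)) \<longlonglongrightarrow> x" "y \<in> K" "(\<lambda>n. snd (s n)) \<longlonglongrightarrow> y"
      using HK[THEN hilbertD(2)] unfolding complete_def by meson
    then show "\<exists>l\<in>H \<times> K. s \<longlonglongrightarrow> l"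
      using tendsto_Pair[of "\<lambda>n. fst (s n)" x sequentially "\<lambda>n. snd (s n)" y]
      by (intro bexI[of _ "(x, y)"]) auto
  qed
  then have "hilbert (H \<times> K)" using HK by (simp add: hilbert_def csubspace_Times)
  moreover obtain D E where "countable D" "D \<subseteq> H" "H \<subseteq> closure D" "countable E" "E \<subseteq> K" "K \<subseteq> closure E"
    using H K unfolding separable_hilbert_iff by blast
  ultimately show ?thesis
    unfolding separable_hilbert_iff
    by (intro conjI exI[of _ "D \<times> E"]) (auto simp: closure_Times)
qed

definition direct_sum ::
  "'h::complex_inner set \<Rightarrow> 'k::complex_inner set \<Rightarrow> ('h \<Rightarrow> 'h) \<Rightarrow> ('k \<Rightarrow> 'k) \<Rightarrow> 'h \<times> 'k \<Rightarrow> 'h \<times> 'k" where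
  "direct_sum H K S T = (\<lambda>p\<in>H \<times> K. (S (fst p), T (snd p)))"

lemma bop_direct_sum:
  assumes "csubspace H" "csubspace K" "S \<in> bop H H" "T \<in> bop K K"
  shows "direct_sum H K S T \<in> bop (H \<times> K) (H \<times> K)"
proof -
  obtain B where B: "B \<ge> 0" "\<And>x. x \<in> H \<Longrightarrow> norm (S x) \<le> B * norm x" by (rule bop_bound[OF assms(3)], rule that)
  obtain C where C: "C \<ge> 0" "\<And>x. x \<in> K \<Longrightarrow> norm (T x) \<le> C * norm x" by (rule bop_bound[OF assms(4)], rule that)
  have "norm (S (fst p), T (snd p)) \<le> (B + C) * norm p" if "p \<in> H \<times> K" for p
  proof -
    have "norm (S (fst p), T (snd p)) \<le> norm (S (fst p)) + norm (T (snd p))" by (rule norm_Pair_le)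
    also have "\<dots> \<le> B * norm (fst p) + C * norm (snd p)" using that by (intro add_mono B C) auto
    also have "\<dots> \<le> B * norm p + C * norm p"
      using B C by (intro add_mono mult_left_mono) (simp_all add: norm_fst_snd_le)
    finally show ?thesis by (simp add: distrib_right)
  qed
  then show ?thesis
    unfolding direct_sum_def using bopD[OF assms(3)] bopD[OF assms(4)]
    by (intro bop_restrictI[OF csubspace_Times[OF assms(1,2)], where B = "B + C"]) auto
qed

lemma star_representation_direct_sum:
  assumes H: "hilbert H" and K: "hilbert K"
    and \<pi>: "star_representation H \<pi>" and \<rho>: "star_representation K \<rho>"
  shows "star_representation (H \<times> K) (\<lambda>a. direct_sum H K (\<pi> a) (\<rho> a))"
proof (rule star_representationI)
  note Hs = hilbertD(1)[OF H] and Ks = hilbertD(1)[OF K]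
  show "csubspace (H \<times> K)" by (rule csubspace_Times[OF Hs Ks])
  show "direct_sum H K (\<pi> a) (\<rho> a) \<in> bop (H \<times> K) (H \<times> K)" for a
    by (intro bop_direct_sum Hs Ks star_representationD(1)[OF \<pi>] star_representationD(1)[OF \<rho>])
qed (auto simp: direct_sum_def star_representationD(2,3,4,6)[OF \<pi>] star_representationD(2,3,4,6)[OF \<rho>]
      star_representation_cinner[OF \<pi> H] star_representation_cinner[OF \<rho> K]
      bopD(1)[OF star_representationD(1)[OF \<pi>]] bopD(1)[OF star_representationD(1)[OF \<rho>]])

lemma faithful_representation_direct_sum:
  assumes H: "hilbert H" and K: "hilbert K"
    and \<pi>: "star_representation H \<pi>" and \<rho>: "faithful_representation K \<rho>"
  shows "faithful_representation (H \<times> K) (\<lambda>a. direct_sum H K (\<pi> a) (\<rho> a))"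
  unfolding faithful_representation_def
proof (intro conjI injI)
  show "star_representation (H \<times> K) (\<lambda>a. direct_sum H K (\<pi> a) (\<rho> a))"
    using \<rho> by (intro star_representation_direct_sum H K \<pi>) (simp add: faithful_representation_def)
  fix a b assume eq: "direct_sum H K (\<pi> a) (\<rho> a) = direct_sum H K (\<pi> b) (\<rho> b)"
  have rep: "star_representation K \<rho>" and inj: "inj \<rho>" using \<rho> by (auto simp: faithful_representation_def)
  have "\<rho> a = \<rho> b"
  proof (rule bop_eqI)
    fix k assume "k \<in> K"
    then show "\<rho> a k = \<rho> b k"
      using fun_cong[OF eq, of "(0, k)"] csubspaceD(1)[OF hilbertD(1)[OF H]] by (simp add: direct_sum_def)
  qed (rule star_representationD(1)[OF rep])+
  then show "a = b" using inj by (simp add: inj_eq)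
qed

lemma star_representation_character:
  assumes "character chi"
  shows "star_representation (UNIV :: complex set) (\<lambda>a. \<lambda>z\<in>UNIV. chi a * z)"
proof (rule star_representationI)
  show "(\<lambda>z\<in>UNIV. chi a * z) \<in> bop UNIV (UNIV :: complex set)" for a
    by (rule bop_restrictI[where B = "cmod (chi a)"])
       (simp_all add: distrib_left scaleC_complex_def norm_mult)
qed (use assms in \<open>auto simp: character_def distrib_right scaleC_complex_def cinner_complex_def\<close>)

lemma separable_hilbert_complex: "separable_hilbert (UNIV :: complex set)"
proof -
  obtain Q :: "complex set" where Q: "countable Q" "\<And>X. open X \<Longrightarrow> X \<noteq> {} \<Longrightarrow> \<exists>d\<in>Q. d \<in> X"
    using countable_dense_exists by blast
  have "c \<in> closure Q" for c
    unfolding closure_approachable using Q(2)[of "ball c _"] by (auto simp: dist_commute)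
  then show ?thesis
    unfolding separable_hilbert_iff hilbert_def using Q(1) by (auto simp: complete_UNIV)
qed


section \<open>Hyperrigidity on arbitrary separable Hilbert spaces\<close>

text \<open>Like \<^const>\<open>ucp\<close>, but for maps between the operators of two different Hilbert spaces, as
  compressions are.\<close>

definition ucp_map ::
  "'m::complex_inner set \<Rightarrow> 'h::complex_inner set \<Rightarrow> (('m \<Rightarrow> 'm) \<Rightarrow> 'h \<Rightarrow> 'h) \<Rightarrow> bool" where
  "ucp_map M H \<Psi> \<longleftrightarrow>
     (\<forall>T\<in>bop M M. \<Psi> T \<in> bop H H) \<and>
     (\<forall>S\<in>bop M M. \<forall>T\<in>bop M M. \<Psi> (\<lambda>x\<in>M. S x + T x) = (\<lambda>x\<in>H. \<Psi> S x + \<Psi> T x)) \<and>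
     (\<forall>c. \<forall>T\<in>bop M M. \<Psi> (\<lambda>x\<in>M. c *\<^sub>C T x) = (\<lambda>x\<in>H. c *\<^sub>C \<Psi> T x)) \<and>
     \<Psi> (\<lambda>x\<in>M. x) = (\<lambda>x\<in>H. x) \<and>
     (\<forall>n T. (\<forall>i<n. \<forall>j<n. T i j \<in> bop M M) \<longrightarrow> positive_matrix M n T \<longrightarrow>
        positive_matrix H n (\<lambda>i j. \<Psi> (T i j)))"

lemma ucp_iff_ucp_map: "ucp H \<Phi> \<longleftrightarrow> ucp_map H H \<Phi>"
  by (simp add: ucp_def ucp_map_def)

lemma ucp_mapD:
  assumes "ucp_map M H \<Psi>"
  shows "T \<in> bop M M \<Longrightarrow> \<Psi> T \<in> bop H H"
    and "S \<in> bop M M \<Longrightarrow> T \<in> bop M M \<Longrightarrow> \<Psi> (\<lambda>x\<in>M. S x + T x) = (\<lambda>x\<in>H. \<Psi> S x + \<Psi> T x)"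
    and "T \<in> bop M M \<Longrightarrow> \<Psi> (\<lambda>x\<in>M. c *\<^sub>C T x) = (\<lambda>x\<in>H. c *\<^sub>C \<Psi> T x)"
    and "\<Psi> (\<lambda>x\<in>M. x) = (\<lambda>x\<in>H. x)"
    and "(\<And>i j. i < n \<Longrightarrow> j < n \<Longrightarrow> X i j \<in> bop M M) \<Longrightarrow> positive_matrix M n X \<Longrightarrow>
        positive_matrix H n (\<lambda>i j. \<Psi> (X i j))"
  using assms unfolding ucp_map_def by (blast, blast, blast, blast, simp)

lemma ucp_mapI:
  assumes "\<And>T. T \<in> bop M M \<Longrightarrow> \<Psi> T \<in> bop H H"
    and "\<And>S T h. S \<in> bop M M \<Longrightarrow> T \<in> bop M M \<Longrightarrow> h \<in> H \<Longrightarrow> \<Psi> (\<lambda>x\<in>M. S x + T x) h = \<Psi> S h + \<Psi> T h"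
    and "\<And>c T h. T \<in> bop M M \<Longrightarrow> h \<in> H \<Longrightarrow> \<Psi> (\<lambda>x\<in>M. c *\<^sub>C T x) h = c *\<^sub>C \<Psi> T h"
    and "\<And>h. h \<in> H \<Longrightarrow> \<Psi> (\<lambda>x\<in>M. x) h = h"
    and "\<And>T h. h \<notin> H \<Longrightarrow> \<Psi> T h = undefined"
    and "\<And>n T. (\<And>i j. i < n \<Longrightarrow> j < n \<Longrightarrow> T i j \<in> bop M M) \<Longrightarrow> positive_matrix M n T \<Longrightarrow>
        positive_matrix H n (\<lambda>i j. \<Psi> (T i j))"
  shows "ucp_map M H \<Psi>"
  unfolding ucp_map_def
proof (intro conjI ballI allI impI)
  fix S T assume "S \<in> bop M M" "T \<in> bop M M"
  then show "\<Psi> (\<lambda>x\<in>M. S x + T x) = (\<lambda>x\<in>H. \<Psi> S x + \<Psi> T x)"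
    using assms(2,5) by (intro ext) (simp add: restrict_def)
next
  fix c T assume "T \<in> bop M M"
  then show "\<Psi> (\<lambda>x\<in>M. c *\<^sub>C T x) = (\<lambda>x\<in>H. c *\<^sub>C \<Psi> T x)"
    using assms(3,5) by (intro ext) (simp add: restrict_def)
next
  show "\<Psi> (\<lambda>x\<in>M. x) = (\<lambda>x\<in>H. x)"
    using assms(4,5) by (intro ext) (simp add: restrict_def)
qed (use assms in auto)

lemma positive_matrix_sum:
  assumes "positive_matrix M n S" "positive_matrix N n T"
    and "\<And>x. x \<in> H \<Longrightarrow> f x \<in> M" "\<And>x. x \<in> H \<Longrightarrow> g x \<in> N"
    and eq: "\<And>i j x y. i < n \<Longrightarrow> j < n \<Longrightarrow> x \<in> H \<Longrightarrow> y \<in> H \<Longrightarrow>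
      cinner (Q i j x) y = cinner (S i j (f x)) (f y) + cinner (T i j (g x)) (g y)"
  shows "positive_matrix H n Q"
  unfolding positive_matrix_def Let_def
proof (intro allI impI)
  fix h assume h: "\<forall>i<n. h i \<in> H"
  have "(\<Sum>i<n. \<Sum>j<n. cinner (Q i j (h j)) (h i)) = (\<Sum>i<n. \<Sum>j<n. cinner (S i j (f (h j))) (f (h i)))
      + (\<Sum>i<n. \<Sum>j<n. cinner (T i j (g (h j))) (g (h i)))"
    unfolding sum.distrib[symmetric] using h by (intro sum.cong refl) (simp add: eq)
  then show "(\<Sum>i<n. \<Sum>j<n. cinner (Q i j (h j)) (h i)) \<in> \<real> \<and>
      0 \<le> Re (\<Sum>i<n. \<Sum>j<n. cinner (Q i j (h j)) (h i))"
    using assms(1)[unfolded positive_matrix_def Let_def, rule_format, of "\<lambda>i. f (h i)"]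
      assms(2)[unfolded positive_matrix_def Let_def, rule_format, of "\<lambda>i. g (h i)"] assms(3,4) h by simp
qed

lemma positive_matrix_compression:
  assumes "positive_matrix M n S" "\<And>x. x \<in> H \<Longrightarrow> f x \<in> M"
    and "\<And>i j x y. i < n \<Longrightarrow> j < n \<Longrightarrow> x \<in> H \<Longrightarrow> y \<in> H \<Longrightarrow> cinner (Q i j x) y = cinner (S i j (f x)) (f y)"
  shows "positive_matrix H n Q"
proof -
  have "positive_matrix H n (\<lambda>i j x. 0)" by (simp add: positive_matrix_def)
  then show ?thesis by (rule positive_matrix_sum[OF assms(1), where g = "\<lambda>x. x"]) (simp_all add: assms(2,3))
qed

lemma bop_add_op:
  assumes "csubspace H" "S \<in> bop H K" "T \<in> bop H K" "csubspace K"
  shows "(\<lambda>x\<in>H. S x + T x) \<in> bop H K"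
proof -
  obtain B where B: "B \<ge> 0" "\<And>x. x \<in> H \<Longrightarrow> norm (S x) \<le> B * norm x" by (rule bop_bound[OF assms(2)], rule that)
  obtain C where C: "C \<ge> 0" "\<And>x. x \<in> H \<Longrightarrow> norm (T x) \<le> C * norm x" by (rule bop_bound[OF assms(3)], rule that)
  show ?thesis
  proof (rule bop_restrictI[OF assms(1), where B = "B + C"])
    fix x assume x: "x \<in> H"
    show "norm (S x + T x) \<le> (B + C) * norm x"
      using norm_triangle_ineq[of "S x" "T x"] B(2)[OF x] C(2)[OF x] by (simp add: distrib_right)
  qed (simp_all add: bopD(1-3)[OF assms(2)] bopD(1-3)[OF assms(3)] csubspaceD(2)[OF assms(4)]
      scaleC_add_right)
qed

lemma bop_scaleC_op:
  assumes "csubspace H" "T \<in> bop H K" "csubspace K"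
  shows "(\<lambda>x\<in>H. c *\<^sub>C T x) \<in> bop H K"
proof -
  obtain B where B: "B \<ge> 0" "\<And>x. x \<in> H \<Longrightarrow> norm (T x) \<le> B * norm x" by (rule bop_bound[OF assms(2)], rule that)
  show ?thesis
  proof (rule bop_restrictI[OF assms(1), where B = "cmod c * B"])
    fix x assume x: "x \<in> H"
    show "norm (c *\<^sub>C T x) \<le> cmod c * B * norm x"
      using mult_left_mono[OF B(2)[OF x], of "cmod c"] by (simp add: norm_scaleC_inner mult.assoc)
  qed (simp_all add: bopD(1-3)[OF assms(2)] csubspaceD(3)[OF assms(3)] scaleC_add_right scaleC_scaleC
      mult.commute)
qed

lemma bop_diff_op:
  assumes "csubspace H" "S \<in> bop H K" "T \<in> bop H K" "csubspace K"
  shows "(\<lambda>x\<in>H. S x - T x) \<in> bop H K"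
proof -
  have "(\<lambda>x\<in>H. S x + (\<lambda>x\<in>H. (-1) *\<^sub>C T x) x) \<in> bop H K"
    by (intro bop_add_op bop_scaleC_op assms)
  also have "(\<lambda>x\<in>H. S x + (\<lambda>x\<in>H. (-1) *\<^sub>C T x) x) = (\<lambda>x\<in>H. S x - T x)"
    by (intro ext) (simp add: scaleC_minus_one)
  finally show ?thesis .
qed

lemma bop_identity: "csubspace H \<Longrightarrow> (\<lambda>x\<in>H. x) \<in> bop H H"
  by (rule bop_restrictI[where B = 1]) simp_all

lemma bop_comp:
  assumes "csubspace H" "S \<in> bop H K" "T \<in> bop K L"
  shows "(\<lambda>x\<in>H. T (S x)) \<in> bop H L"
proof -
  obtain B where B: "B \<ge> 0" "\<And>x. x \<in> H \<Longrightarrow> norm (S x) \<le> B * norm x" by (rule bop_bound[OF assms(2)], rule that)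
  obtain C where C: "C \<ge> 0" "\<And>x. x \<in> K \<Longrightarrow> norm (T x) \<le> C * norm x" by (rule bop_bound[OF assms(3)], rule that)
  show ?thesis
  proof (rule bop_restrictI[OF assms(1), where B = "C * B"])
    fix x assume x: "x \<in> H"
    have "norm (T (S x)) \<le> C * norm (S x)" by (rule C(2)[OF bopD(1)[OF assms(2) x]])
    also have "\<dots> \<le> C * (B * norm x)" by (rule mult_left_mono[OF B(2)[OF x] C(1)])
    finally show "norm (T (S x)) \<le> C * B * norm x" by (simp add: mult.assoc)
  qed (simp_all add: bopD(1-3)[OF assms(2)] bopD(1-3)[OF assms(3)])
qed

lemma op_norm_zero:
  assumes "csubspace H" "\<And>x. x \<in> H \<Longrightarrow> T x = 0"
  shows "op_norm H T = 0"
proof -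
  have "(\<lambda>x. norm (T x)) ` {x \<in> H. norm x \<le> 1} = {0}"
    using assms csubspaceD(1)[OF assms(1)] by (auto simp: image_iff intro!: exI[of _ 0])
  then show ?thesis by (simp add: op_norm_def)
qed

text \<open>The definition of hyperrigidity is applied to a constant sequence of UCP maps.\<close>

lemma hyperrigid_ell2:
  fixes H :: "ell2 set"
  assumes "hyperrigid G" and H: "separable_hilbert H" and \<pi>: "faithful_representation H \<pi>"
    and \<Phi>: "ucp H \<Phi>" and fixes_G: "\<And>g. g \<in> G \<Longrightarrow> \<Phi> (\<pi> g) = \<pi> g"
  shows "\<Phi> (\<pi> a) = \<pi> a"
proof -
  have Hs: "csubspace H" using H by (simp add: separable_hilbert_def hilbert_def)
  have \<pi>b: "\<pi> a \<in> bop H H" for a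
    using \<pi> star_representationD(1) by (auto simp: faithful_representation_def)
  have \<Phi>b: "\<Phi> (\<pi> a) \<in> bop H H" using \<Phi> \<pi>b by (simp add: ucp_def)
  have G0: "op_norm H (\<lambda>x\<in>H. \<Phi> (\<pi> g) x - \<pi> g x) = 0" if "g \<in> G" for g
    by (rule op_norm_zero[OF Hs]) (simp add: fixes_G[OF that])
  have "\<forall>a. (\<lambda>k::nat. op_norm H (\<lambda>x\<in>H. \<Phi> (\<pi> a) x - \<pi> a x)) \<longlonglongrightarrow> 0"
    using assms(1) unfolding hyperrigid_def
    by (elim conjE allE[of _ H] allE[of _ \<pi>] allE[of _ "\<lambda>k. \<Phi>"] impE)
       (simp_all add: H \<pi> \<Phi> G0)
  then have "op_norm H (\<lambda>x\<in>H. \<Phi> (\<pi> a) x - \<pi> a x) = 0" by (simp add: LIMSEQ_const_iff)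
  then have "norm (\<Phi> (\<pi> a) x - \<pi> a x) \<le> 0" if "x \<in> H" for x
    using op_norm_bound[OF bop_diff_op[OF Hs \<Phi>b \<pi>b[of a] Hs] Hs that] that by simp
  then show ?thesis by (intro bop_eqI[OF \<Phi>b \<pi>b]) simp
qed

locale unitary_pair =
  fixes H :: "'h::complex_inner set" and H' :: "'k::complex_inner set"
    and U :: "'h \<Rightarrow> 'k" and V :: "'k \<Rightarrow> 'h"
  assumes Hs: "csubspace H" and Hs': "csubspace H'"
    and U_in: "x \<in> H \<Longrightarrow> U x \<in> H'" and V_in: "y \<in> H' \<Longrightarrow> V y \<in> H"
    and VU: "x \<in> H \<Longrightarrow> V (U x) = x" and UV: "y \<in> H' \<Longrightarrow> U (V y) = y"
    and U_add: "x \<in> H \<Longrightarrow> x' \<in> H \<Longrightarrow> U (x + x') = U x + U x'"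
    and U_scale: "x \<in> H \<Longrightarrow> U (c *\<^sub>C x) = c *\<^sub>C U x"
    and U_cinner: "x \<in> H \<Longrightarrow> x' \<in> H \<Longrightarrow> cinner (U x) (U x') = cinner x x'"
begin

lemma norm_U: "x \<in> H \<Longrightarrow> norm (U x) = norm x"
  by (rule norm_eq_of_cinner_eq[OF U_cinner])

lemma dist_U:
  assumes "x \<in> H" "y \<in> H"
  shows "dist (U x) (U y) = dist x y"
proof -
  have "U (x + (-1) *\<^sub>C y) = U x + (-1) *\<^sub>C U y"
    using assms by (simp only: U_add U_scale csubspaceD(3)[OF Hs])
  then show ?thesis
    using norm_U[OF csubspaceD(5)[OF Hs assms]] by (simp add: dist_norm scaleC_minus_one)
qed

lemma inverse: "unitary_pair H' H V U"
proof
  fix x y c assume x: "x \<in> H'"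
  show "V (c *\<^sub>C x) = c *\<^sub>C V x"
    using VU[of "c *\<^sub>C V x"] V_in[OF x] by (simp add: U_scale UV x csubspaceD(3)[OF Hs])
  assume y: "y \<in> H'"
  show "V (x + y) = V x + V y"
    using VU[of "V x + V y"] V_in[OF x] V_in[OF y] by (simp add: U_add UV x y csubspaceD(2)[OF Hs])
  show "cinner (V x) (V y) = cinner x y"
    using U_cinner[OF V_in[OF x] V_in[OF y]] by (simp add: UV x y)
qed (rule Hs Hs' U_in V_in UV VU, assumption?)+

lemma separable_hilbert_image:
  assumes "separable_hilbert H"
  shows "separable_hilbert H'"
proof -
  obtain D where D: "countable D" "D \<subseteq> H" "H \<subseteq> closure D" and "complete H"
    using assms unfolding separable_hilbert_iff hilbert_def by blast
  have "complete H'"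
    unfolding complete_def
  proof (intro allI impI, elim conjE)
    fix s assume s: "\<forall>n. s n \<in> H'" "Cauchy s"
    have "dist (V (s m)) (V (s n)) = dist (s m) (s n)" for m n
      using dist_U[of "V (s m)" "V (s n)"] s(1) by (simp add: V_in UV)
    then have "Cauchy (\<lambda>n. V (s n))" using s(2) by (simp add: Cauchy_def)
    moreover have "\<forall>n. V (s n) \<in> H" using V_in s(1) by simp
    ultimately have "\<exists>l\<in>H. (\<lambda>n. V (s n)) \<longlonglongrightarrow> l"
      by (intro \<open>complete H\<close>[unfolded complete_def, rule_format] conjI)
    then obtain l where l: "l \<in> H" "(\<lambda>n. V (s n)) \<longlonglongrightarrow> l" by blast
    have "dist (s n) (U l) = dist (V (s n)) l" for n
      using dist_U[of "V (s n)" l] s(1) l(1) by (simp add: V_in UV)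
    then have "s \<longlonglongrightarrow> U l" using l(2) unfolding tendsto_dist_iff[of s] tendsto_dist_iff[of "\<lambda>n. V (s n)"] by simp
    then show "\<exists>l\<in>H'. s \<longlonglongrightarrow> l" using U_in[OF l(1)] by blast
  qed
  then have "hilbert H'" using Hs' by (simp add: hilbert_def)
  moreover have "H' \<subseteq> closure (U ` D)"
  proof
    fix y assume y: "y \<in> H'"
    show "y \<in> closure (U ` D)"
      unfolding closure_approachable
    proof (intro allI impI)
      fix e :: real assume "0 < e"
      moreover have "V y \<in> closure D" using V_in[OF y] D(3) by blast
      ultimately obtain d where d: "d \<in> D" "dist d (V y) < e" unfolding closure_approachable by blast
      then have "dist (U d) y < e" using dist_U[of d "V y"] V_in[OF y] UV[OF y] D(2) by auto
      then show "\<exists>x\<in>U ` D. dist x y < e" using d(1) by blast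
    qed
  qed
  moreover have "U ` D \<subseteq> H'" using D(2) U_in by blast
  ultimately show ?thesis unfolding separable_hilbert_iff using D(1) by blast
qed

end

definition conjugate_op :: "'k set \<Rightarrow> ('h \<Rightarrow> 'k) \<Rightarrow> ('k \<Rightarrow> 'h) \<Rightarrow> ('h \<Rightarrow> 'h) \<Rightarrow> 'k \<Rightarrow> 'k" where
  "conjugate_op H' U V X = (\<lambda>y\<in>H'. U (X (V y)))"

context unitary_pair begin

abbreviation "up \<equiv> conjugate_op H' U V"
abbreviation "down \<equiv> conjugate_op H V U"

lemma V_add: "x \<in> H' \<Longrightarrow> y \<in> H' \<Longrightarrow> V (x + y) = V x + V y"
  and V_scale: "x \<in> H' \<Longrightarrow> V (c *\<^sub>C x) = c *\<^sub>C V x"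
  using unitary_pair.U_add[OF inverse] unitary_pair.U_scale[OF inverse] by blast+

lemma up_bop:
  assumes X: "X \<in> bop H H"
  shows "up X \<in> bop H' H'"
proof -
  obtain B where B: "B \<ge> 0" "\<And>x. x \<in> H \<Longrightarrow> norm (X x) \<le> B * norm x" by (rule bop_bound[OF X], rule that)
  have "norm (U (X (V y))) \<le> B * norm y" if y: "y \<in> H'" for y
    using B(2)[OF V_in[OF y]] norm_U[OF bopD(1)[OF X V_in[OF y]]] norm_U[OF V_in[OF y]] UV[OF y] by simp
  then show ?thesis
    unfolding conjugate_op_def
    by (intro bop_restrictI[OF Hs', where B = B])
       (simp_all add: U_in bopD(1-3)[OF X] V_in V_add V_scale U_add U_scale)
qed

lemma down_up: "X \<in> bop H H \<Longrightarrow> down (up X) = X"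
  by (rule bop_eqI[OF unitary_pair.up_bop[OF inverse up_bop]])
     (simp_all add: conjugate_op_def U_in VU bopD(1))

lemma up_add: "S \<in> bop H H \<Longrightarrow> T \<in> bop H H \<Longrightarrow> up (\<lambda>x\<in>H. S x + T x) = (\<lambda>y\<in>H'. up S y + up T y)"
  by (rule ext) (simp add: conjugate_op_def V_in U_add bopD(1))

lemma up_scale: "T \<in> bop H H \<Longrightarrow> up (\<lambda>x\<in>H. c *\<^sub>C T x) = (\<lambda>y\<in>H'. c *\<^sub>C up T y)"
  by (rule ext) (simp add: conjugate_op_def V_in U_scale bopD(1))

lemma up_identity: "up (\<lambda>x\<in>H. x) = (\<lambda>y\<in>H'. y)"
  by (rule ext) (simp add: conjugate_op_def V_in UV)

lemma up_positive:
  assumes X: "\<And>i j. i < n \<Longrightarrow> j < n \<Longrightarrow> X i j \<in> bop H H" and pos: "positive_matrix H n X"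
  shows "positive_matrix H' n (\<lambda>i j. up (X i j))"
proof (rule positive_matrix_compression[OF pos V_in])
  fix i j x y assume ij: "i < n" "j < n" and xy: "x \<in> H'" "y \<in> H'"
  have "X i j (V x) \<in> H" by (rule bopD(1)[OF X[OF ij] V_in[OF xy(1)]])
  then show "cinner (up (X i j) x) y = cinner (X i j (V x)) (V y)"
    using U_cinner[of "X i j (V x)" "V y"] xy by (simp add: conjugate_op_def V_in UV)
qed

lemma faithful_representation_up:
  assumes H: "hilbert H" and \<pi>: "faithful_representation H \<pi>"
  shows "faithful_representation H' (\<lambda>a. up (\<pi> a))"
proof -
  have rep: "star_representation H \<pi>" and inj: "inj \<pi>" using \<pi> by (auto simp: faithful_representation_def)
  note \<pi>b = star_representationD(1)[OF rep]
  have "star_representation H' (\<lambda>a. up (\<pi> a))"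
  proof (rule star_representationI[OF Hs' up_bop[OF \<pi>b]])
    fix a x y assume x: "x \<in> H'" and y: "y \<in> H'"
    have "cinner (\<pi> a (V x)) (V y) = cinner (V x) (\<pi> (star a) (V y))"
      by (intro star_representation_cinner[OF rep H] V_in x y)
    then show "cinner (up (\<pi> a) x) y = cinner x (up (\<pi> (star a)) y)"
      using U_cinner[of "\<pi> a (V x)" "V y"] U_cinner[of "V x" "\<pi> (star a) (V y)"] x y bopD(1)[OF \<pi>b]
      by (simp add: conjugate_op_def V_in UV)
  qed (simp_all add: conjugate_op_def star_representationD(2,3,4,6)[OF rep] U_in V_in UV VU U_add U_scale
        bopD(1)[OF \<pi>b])
  moreover have "inj (\<lambda>a. up (\<pi> a))"
    by (rule injI) (metis down_up[OF \<pi>b] inj injD)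
  ultimately show ?thesis by (simp add: faithful_representation_def)
qed

lemma ucp_up:
  assumes "ucp H \<Phi>"
  shows "ucp H' (\<lambda>Y. up (\<Phi> (down Y)))"
  unfolding ucp_iff_ucp_map
proof (rule ucp_mapI)
  note \<Phi>D = ucp_mapD[OF assms[unfolded ucp_iff_ucp_map]]
  note down = unitary_pair.up_bop[OF inverse]
  show "up (\<Phi> (down T)) \<in> bop H' H'" if "T \<in> bop H' H'" for T
    by (intro up_bop \<Phi>D(1) down that)
  show "up (\<Phi> (down (\<lambda>x\<in>H'. S x + T x))) h = up (\<Phi> (down S)) h + up (\<Phi> (down T)) h"
    if "S \<in> bop H' H'" "T \<in> bop H' H'" "h \<in> H'" for S T h
    using that by (simp add: unitary_pair.up_add[OF inverse] \<Phi>D(1,2) down up_add)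
  show "up (\<Phi> (down (\<lambda>x\<in>H'. c *\<^sub>C T x))) h = c *\<^sub>C up (\<Phi> (down T)) h"
    if "T \<in> bop H' H'" "h \<in> H'" for c T h
    using that by (simp add: unitary_pair.up_scale[OF inverse] \<Phi>D(1,3) down up_scale)
  show "up (\<Phi> (down (\<lambda>x\<in>H'. x))) h = h" if "h \<in> H'" for h
    using that by (simp add: unitary_pair.up_identity[OF inverse] \<Phi>D(4) up_identity)
  show "positive_matrix H' n (\<lambda>i j. up (\<Phi> (down (T i j))))"
    if T: "\<And>i j. i < n \<Longrightarrow> j < n \<Longrightarrow> T i j \<in> bop H' H'" and pos: "positive_matrix H' n T" for n T
    by (intro up_positive \<Phi>D(1,5) unitary_pair.up_positive[OF inverse] down pos T)
qed (simp add: conjugate_op_def)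

end

text \<open>A unitary from \<open>H\<close> onto a subspace of \<open>\<ell>\<^sup>2\<close>, found by realising the inner product there, carries
  the representation and the UCP map along.\<close>

lemma hyperrigid_fixes:
  fixes H :: "'h::complex_inner set" and G :: "'a::cstar_algebra set"
  assumes G: "hyperrigid G" and H: "separable_hilbert H" and \<pi>: "faithful_representation H \<pi>"
    and \<Phi>: "ucp H \<Phi>" and fixes_G: "\<And>g. g \<in> G \<Longrightarrow> \<Phi> (\<pi> g) = \<pi> g"
  shows "\<Phi> (\<pi> a) = \<pi> a"
proof -
  have hH: "hilbert H" using H by (simp add: separable_hilbert_def)
  note Hs = hilbertD(1)[OF hH]
  obtain D where D: "countable D" "D \<subseteq> H" "H \<subseteq> closure D" using H unfolding separable_hilbert_iff by blast
  have dense: "\<exists>d\<in>D. Re (cinner (x - d) (x - d)) < e" if "x \<in> H" "0 < e" for x e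
    by (rule psd_form.dense_if_norm_dense[OF psd_form_cinner[OF Hs], where N = norm])
       (use that D closure_approachable[of x D]
         in \<open>auto simp: norm_eq_Re_cinner dist_norm norm_minus_commute\<close>)
  obtain U :: "'h \<Rightarrow> ell2" where U: "\<And>x y. x \<in> H \<Longrightarrow> y \<in> H \<Longrightarrow> U (x + y) = U x + U y"
    "\<And>c x. x \<in> H \<Longrightarrow> U (c *\<^sub>C x) = c *\<^sub>C U x"
    "\<And>x y. x \<in> H \<Longrightarrow> y \<in> H \<Longrightarrow> cinner (U x) (U y) = cinner x y"
    by (rule psd_form.ell2_realisation[OF psd_form_cinner[OF Hs] D(1,2) dense], assumption+, rule that)
  have inj_U: "inj_on U H"
  proof (rule inj_onI)
    fix x y assume xy: "x \<in> H" "y \<in> H" "U x = U y"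
    then have "cinner z x = cinner z y" if "z \<in> H" for z
      using U(3)[OF that xy(1)] U(3)[OF that xy(2)] by simp
    then show "x = y" by (rule cinner_eq_imp_eq[OF Hs xy(1,2)])
  qed
  have "csubspace (U ` H)"
    unfolding csubspace_def
  proof (intro conjI ballI allI)
    have "U 0 = 0" using U(2)[of 0 0] csubspaceD(1)[OF Hs] by simp
    then show "0 \<in> U ` H" using csubspaceD(1)[OF Hs] by (metis imageI)
  qed (auto intro: csubspaceD(2,3)[OF Hs] simp flip: U)
  then interpret unitary_pair H "U ` H" U "inv_into H U"
    by unfold_locales (auto simp: Hs U inv_into_f_f[OF inj_U])
  have \<pi>b: "\<pi> a \<in> bop H H" for a
    using \<pi> star_representationD(1) by (auto simp: faithful_representation_def)
  have "up (\<Phi> (down (up (\<pi> a)))) = up (\<pi> a)"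
    by (rule hyperrigid_ell2[OF G separable_hilbert_image[OF H] faithful_representation_up[OF hH \<pi>]
          ucp_up[OF \<Phi>]])
       (simp add: down_up \<pi>b fixes_G)
  then have "up (\<Phi> (\<pi> a)) = up (\<pi> a)" by (simp add: down_up \<pi>b)
  moreover have "\<Phi> (\<pi> a) \<in> bop H H" using \<Phi> \<pi>b unfolding ucp_def by blast
  ultimately show ?thesis using down_up \<pi>b by metis
qed

text \<open>Hyperrigidity speaks about UCP maps on the space of one faithful representation, whereas \<open>\<pi>\<close> need
  not be faithful and \<open>\<Psi>\<close> starts from another space. The representation \<open>\<pi> \<oplus> \<sigma>\<close> is faithful, and
  \<open>X \<mapsto> \<Psi> Y \<oplus> Y\<close>, where \<open>Y\<close> is the lower right corner of \<open>X\<close>, is a UCP map that sends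
  \<open>\<pi> a \<oplus> \<sigma> a\<close> to \<open>\<Psi> (\<sigma> a) \<oplus> \<sigma> a\<close>.\<close>

lemma unique_extension_property:
  fixes H :: "'h::complex_inner set" and M :: "'m::complex_inner set" and G :: "'a::cstar_algebra set"
  assumes G: "hyperrigid G" and H: "separable_hilbert H" and M: "separable_hilbert M"
    and \<pi>: "star_representation H \<pi>" and \<sigma>: "faithful_representation M \<sigma>"
    and \<Psi>: "ucp_map M H \<Psi>" and on_G: "\<And>g. g \<in> G \<Longrightarrow> \<Psi> (\<sigma> g) = \<pi> g"
  shows "\<Psi> (\<sigma> a) = \<pi> a"
proof -
  have hH: "hilbert H" and hM: "hilbert M" using H M by (auto simp: separable_hilbert_def)
  note Hs = hilbertD(1)[OF hH] and Ms = hilbertD(1)[OF hM]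
  note H0 = csubspaceD(1)[OF Hs] and M0 = csubspaceD(1)[OF Ms]
  have \<sigma>r: "star_representation M \<sigma>" using \<sigma> by (simp add: faithful_representation_def)
  note \<sigma>b = star_representationD(1)[OF \<sigma>r] and \<pi>b = star_representationD(1)[OF \<pi>]
  let ?E = "H \<times> M"
  define corner where "corner X = (\<lambda>m\<in>M. snd (X (0 :: 'h, m)))" for X :: "'h \<times> 'm \<Rightarrow> 'h \<times> 'm"
  have corner: "corner X \<in> bop M M" if X: "X \<in> bop ?E ?E" for X
  proof -
    obtain B where B: "B \<ge> 0" "\<And>x. x \<in> ?E \<Longrightarrow> norm (X x) \<le> B * norm x" by (rule bop_bound[OF X], rule that)
    show ?thesis
      unfolding corner_def
    proof (rule bop_restrictI[OF Ms, where B = B])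
      fix x assume x: "x \<in> M"
      show "snd (X (0, x)) \<in> M" using bopD(1)[OF X, of "(0, x)"] x H0 by (simp add: mem_Times_iff)
      show "norm (snd (X (0, x))) \<le> B * norm x"
        using B(2)[of "(0, x)"] norm_fst_snd_le(2)[of "X (0, x)"] x H0 by (simp add: norm_Pair)
      show "snd (X (0, c *\<^sub>C x)) = c *\<^sub>C snd (X (0, x))" for c
        using bopD(3)[OF X, of "(0, x)" c] x H0 by simp
      fix y assume "y \<in> M"
      then show "snd (X (0, x + y)) = snd (X (0, x)) + snd (X (0, y))"
        using bopD(2)[OF X, of "(0, x)" "(0, y)"] x H0 by simp
    qed
  qed
  define \<Phi> where "\<Phi> X = direct_sum H M (\<Psi> (corner X)) (corner X)" for X
  note \<Psi>D = ucp_mapD[OF \<Psi>]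
  have \<Psi>b: "\<Psi> (corner X) \<in> bop H H" if "X \<in> bop ?E ?E" for X by (intro \<Psi>D(1) corner that)
  have corner_rep: "corner (direct_sum H M (\<pi> a) (\<sigma> a)) = \<sigma> a" for a
    by (rule bop_eqI[OF corner[OF bop_direct_sum[OF Hs Ms \<pi>b \<sigma>b]] \<sigma>b])
       (simp add: corner_def direct_sum_def H0)
  have "ucp ?E \<Phi>"
    unfolding ucp_iff_ucp_map
  proof (rule ucp_mapI)
    show "\<Phi> T \<in> bop ?E ?E" if "T \<in> bop ?E ?E" for T
      unfolding \<Phi>_def by (intro bop_direct_sum Hs Ms \<Psi>b corner that)
    show "\<Phi> (\<lambda>x\<in>?E. S x + T x) h = \<Phi> S h + \<Phi> T h"
      if S: "S \<in> bop ?E ?E" and T: "T \<in> bop ?E ?E" and h: "h \<in> ?E" for S T h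
    proof -
      have "corner (\<lambda>x\<in>?E. S x + T x) = (\<lambda>x\<in>M. corner S x + corner T x)"
        unfolding corner_def by (intro ext) (simp add: H0)
      moreover have "\<Psi> (\<lambda>x\<in>M. corner S x + corner T x) = (\<lambda>x\<in>H. \<Psi> (corner S) x + \<Psi> (corner T) x)"
        by (intro \<Psi>D(2) corner S T)
      ultimately show ?thesis using h by (auto simp: \<Phi>_def direct_sum_def)
    qed
    show "\<Phi> (\<lambda>x\<in>?E. c *\<^sub>C T x) h = c *\<^sub>C \<Phi> T h" if T: "T \<in> bop ?E ?E" and h: "h \<in> ?E" for c T h
    proof -
      have "corner (\<lambda>x\<in>?E. c *\<^sub>C T x) = (\<lambda>x\<in>M. c *\<^sub>C corner T x)"
        unfolding corner_def by (intro ext) (simp add: H0)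
      moreover have "\<Psi> (\<lambda>x\<in>M. c *\<^sub>C corner T x) = (\<lambda>x\<in>H. c *\<^sub>C \<Psi> (corner T) x)"
        by (intro \<Psi>D(3) corner T)
      ultimately show ?thesis using h by (auto simp: \<Phi>_def direct_sum_def)
    qed
    show "\<Phi> (\<lambda>x\<in>?E. x) h = h" if "h \<in> ?E" for h
    proof -
      have "corner (\<lambda>x\<in>?E. x) = (\<lambda>x\<in>M. x)" unfolding corner_def by (intro ext) (simp add: H0)
      moreover have "\<Psi> (\<lambda>x\<in>M. x) = (\<lambda>x\<in>H. x)" by (rule \<Psi>D(4))
      ultimately show ?thesis using that by (auto simp: \<Phi>_def direct_sum_def)
    qed
    show "\<Phi> T h = undefined" if "h \<notin> ?E" for T h using that by (simp add: \<Phi>_def direct_sum_def)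
    show "positive_matrix ?E n (\<lambda>i j. \<Phi> (T i j))"
      if T: "\<And>i j. i < n \<Longrightarrow> j < n \<Longrightarrow> T i j \<in> bop ?E ?E" and pos: "positive_matrix ?E n T" for n T
    proof -
      have c_pos: "positive_matrix M n (\<lambda>i j. corner (T i j))"
        by (rule positive_matrix_compression[OF pos, where f = "\<lambda>m. (0, m)"])
           (simp_all add: corner_def cinner_prod_def H0)
      have \<Psi>_pos: "positive_matrix H n (\<lambda>i j. \<Psi> (corner (T i j)))"
        by (intro \<Psi>D(5) c_pos corner T)
      show ?thesis
        by (rule positive_matrix_sum[OF \<Psi>_pos c_pos, where f = fst and g = snd])
           (auto simp: \<Phi>_def direct_sum_def)
    qed
  qed
  then have "\<Phi> (direct_sum H M (\<pi> a) (\<sigma> a)) = direct_sum H M (\<pi> a) (\<sigma> a)"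
    by (rule hyperrigid_fixes[OF G separable_hilbert_Times[OF H M]
          faithful_representation_direct_sum[OF hH hM \<pi> \<sigma>]])
       (simp add: \<Phi>_def corner_rep on_G)
  then have eq: "direct_sum H M (\<Psi> (\<sigma> a)) (\<sigma> a) = direct_sum H M (\<pi> a) (\<sigma> a)"
    by (simp add: \<Phi>_def corner_rep)
  have "\<Psi> (\<sigma> a) \<in> bop H H" by (intro \<Psi>D(1) \<sigma>b)
  then show ?thesis
  proof (rule bop_eqI[OF _ \<pi>b])
    fix h assume "h \<in> H"
    then show "\<Psi> (\<sigma> a) h = \<pi> a h"
      using fun_cong[OF eq, of "(h, 0)"] M0 by (simp add: direct_sum_def)
  qed
qed


section \<open>The defect of a contraction\<close>

locale contraction_between =
  fixes H :: "'h::complex_inner set" and K :: "'k::complex_inner set" and R :: "'h \<Rightarrow> 'k"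
  assumes hH: "hilbert H" and hK: "hilbert K" and contr: "contraction H K R"
begin

abbreviation "\<Delta> \<equiv> defect H K R"
abbreviation "Rs \<equiv> adj H K R"

lemmas Hs = hilbertD(1)[OF hH] and Ks = hilbertD(1)[OF hK]

lemma R_bop: "R \<in> bop H K"
  using contr by (simp add: contraction_def)

lemmas RD = bopD[OF R_bop] and R_diff = bop_diff[OF R_bop Hs]
lemmas Rs_bop = adjD(1)[OF hH Ks R_bop]
lemmas RsD = bopD[OF Rs_bop]
lemmas Rs_cinner = adjD(3)[OF hH Ks R_bop, symmetric]

lemma R_norm_le: "h \<in> H \<Longrightarrow> norm (R h) \<le> norm h"
  by (rule contraction_norm_le[OF contr Hs])

lemma defect_bop: "\<Delta> \<in> bop H H"
proof -
  have "(\<lambda>h\<in>H. (\<lambda>h\<in>H. h) h - (\<lambda>h\<in>H. Rs (R h)) h) \<in> bop H H"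
    by (intro bop_diff_op bop_identity bop_comp[OF _ R_bop Rs_bop] Hs)
  also have "(\<lambda>h\<in>H. (\<lambda>h\<in>H. h) h - (\<lambda>h\<in>H. Rs (R h)) h) = \<Delta>"
    unfolding defect_def by (intro ext) simp
  finally show ?thesis .
qed

lemmas defectD = bopD[OF defect_bop]

lemma defect_cinner:
  assumes "h \<in> H" "k \<in> H"
  shows "cinner (\<Delta> h) k = cinner h k - cinner (R h) (R k)"
  using Rs_cinner[OF assms(2) RD(1)[OF assms(1)]] assms by (simp add: defect_def)

lemma psd_defect: "psd_form H (\<lambda>h k. cinner (\<Delta> h) k)"
proof (rule psd_formI[OF Hs])
  fix x y assume xy: "x \<in> H" "y \<in> H"
  show "cinner (\<Delta> x) y = cnj (cinner (\<Delta> y) x)"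
    using cinner_commute[of x y] cinner_commute[of "R x" "R y"] by (simp add: defect_cinner xy)
next
  fix x assume x: "x \<in> H"
  have "(norm (R x))\<^sup>2 \<le> (norm x)\<^sup>2" by (intro power_mono R_norm_le x) simp
  then show "0 \<le> Re (cinner (\<Delta> x) x)" by (simp add: defect_cinner x norm_eq_Re_cinner)
qed (simp_all add: defectD)

sublocale defect: psd_form H "\<lambda>h k. cinner (\<Delta> h) k"
  by (rule psd_defect)

lemma defect_adjoint: "h \<in> H \<Longrightarrow> k \<in> H \<Longrightarrow> cinner (\<Delta> h) k = cinner h (\<Delta> k)"
  using defect.herm[of h k] cinner_commute[of h "\<Delta> k"] by simp

lemma defect_eq_0:
  assumes "h \<in> H" "Re (cinner (\<Delta> h) h) = 0"
  shows "\<Delta> h = 0"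
  by (rule cinner_zero_imp_zero[OF defectD(1)]) (use assms defect.null_left in auto)

lemma codefect_R: "h \<in> H \<Longrightarrow> codefect H K R (R h) = R (\<Delta> h)"
  by (simp add: codefect_def defect_def RD RsD R_diff)

text \<open>Complete positivity of \<open>X \<mapsto> \<langle>X e, e\<rangle> \<Delta>\<close>, with \<open>e\<close> the unit vector of the one-dimensional summand:
  write \<open>\<Delta> = W* W\<close> with \<open>W\<close> into \<open>\<ell>\<^sup>2\<close>; the coordinates \<open>w\<^sub>m\<close> of \<open>W h\<close> split the form into the sum over
  \<open>m\<close> of the forms of \<open>X\<close> at the vectors \<open>w\<^sub>m e\<close>. The summand \<open>L\<close> will carry a faithful
  representation, so that the whole representation is faithful.\<close>

lemma ucp_map_compression:
  assumes sep: "separable_hilbert H" and L: "csubspace (L :: ell2 set)"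
  shows "ucp_map (K \<times> (UNIV :: complex set) \<times> L) H
    (\<lambda>X. \<lambda>h\<in>H. Rs (fst (X (R h, 0, 0))) + fst (snd (X (0, 1, 0))) *\<^sub>C \<Delta> h)"
proof -
  let ?M = "K \<times> (UNIV :: complex set) \<times> L"
  have Ms: "csubspace ?M" by (intro csubspace_Times Ks L csubspace_UNIV)
  note K0 = csubspaceD(1)[OF Ks] and L0 = csubspaceD(1)[OF L]
  have in_M: "(k, c, 0) \<in> ?M" if "k \<in> K" for k c using that L0 by simp
  define e where "e X = fst (snd (X (0 :: 'k, 1 :: complex, 0 :: ell2)))"
    for X :: "'k \<times> complex \<times> ell2 \<Rightarrow> 'k \<times> complex \<times> ell2"
  define \<Psi> where "\<Psi> X = (\<lambda>h\<in>H. Rs (fst (X (R h, 0, 0))) + e X *\<^sub>C \<Delta> h)"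
    for X :: "'k \<times> complex \<times> ell2 \<Rightarrow> 'k \<times> complex \<times> ell2"
  have XK: "fst (X (k, c, 0)) \<in> K" if "X \<in> bop ?M ?M" "k \<in> K" for X k c
    using bopD(1)[OF that(1) in_M[OF that(2)], of c] by (simp add: mem_Times_iff)
  obtain W :: "'h \<Rightarrow> ell2" where W: "\<And>h k. h \<in> H \<Longrightarrow> k \<in> H \<Longrightarrow> cinner (W h) (W k) = cinner (\<Delta> h) k"
  proof -
    obtain D where D: "countable D" "D \<subseteq> H" "H \<subseteq> closure D"
      using sep unfolding separable_hilbert_iff by blast
    have le: "Re (cinner (\<Delta> y) y) \<le> (norm y)\<^sup>2" if "y \<in> H" for y
      by (simp add: defect_cinner[OF that that] cinner_self)
    have "\<exists>d\<in>D. Re (cinner (\<Delta> (x - d)) (x - d)) < r" if "x \<in> H" "0 < r" for x r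
      by (rule defect.dense_if_norm_dense[where N = norm])
         (use that D closure_approachable[of x D] le in \<open>auto simp: dist_norm norm_minus_commute\<close>)
    then show thesis
      by (rule defect.ell2_realisation[OF D(1,2)]) (assumption | rule that)+
  qed
  have "ucp_map ?M H \<Psi>"
  proof (rule ucp_mapI)
    fix X assume X: "X \<in> bop ?M ?M"
    have 1: "(\<lambda>h\<in>H. (R h, 0, 0)) \<in> bop H ?M"
      by (rule bop_restrictI[OF Hs, where B = 1])
         (simp_all add: RD L0 R_norm_le norm_Pair)
    have 2: "(\<lambda>m\<in>?M. fst m) \<in> bop ?M K"
      by (rule bop_restrictI[OF Ms, where B = 1]) (auto simp: norm_fst_snd_le)
    have "(\<lambda>h\<in>H. (\<lambda>h\<in>H. Rs ((\<lambda>h\<in>H. (\<lambda>m\<in>?M. fst m) ((\<lambda>h\<in>H. X ((\<lambda>h\<in>H. (R h, 0, 0)) h)) h)) h)) h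
        + (\<lambda>h\<in>H. e X *\<^sub>C \<Delta> h) h) \<in> bop H H"
      by (intro bop_add_op bop_scaleC_op defect_bop Hs bop_comp[OF Hs _ Rs_bop] bop_comp[OF Hs _ 2]
          bop_comp[OF Hs 1 X])
    also have "(\<lambda>h\<in>H. (\<lambda>h\<in>H. Rs ((\<lambda>h\<in>H. (\<lambda>m\<in>?M. fst m) ((\<lambda>h\<in>H. X ((\<lambda>h\<in>H. (R h, 0, 0)) h)) h)) h)) h
        + (\<lambda>h\<in>H. e X *\<^sub>C \<Delta> h) h) = \<Psi> X"
      unfolding \<Psi>_def using bopD(1)[OF X in_M[OF RD(1)]] by (intro ext) simp
    finally show "\<Psi> X \<in> bop H H" .
  next
    fix S T h assume S: "S \<in> bop ?M ?M" and T: "T \<in> bop ?M ?M" and h: "h \<in> H"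
    show "\<Psi> (\<lambda>x\<in>?M. S x + T x) h = \<Psi> S h + \<Psi> T h"
      using h XK[OF S] XK[OF T]
      by (simp add: \<Psi>_def e_def K0 L0 RD RsD scaleC_add_left)
  next
    fix c T h assume T: "T \<in> bop ?M ?M" and h: "h \<in> H"
    show "\<Psi> (\<lambda>x\<in>?M. c *\<^sub>C T x) h = c *\<^sub>C \<Psi> T h"
      using h XK[OF T]
      by (simp add: \<Psi>_def e_def K0 L0 RD RsD scaleC_add_right scaleC_scaleC scaleC_complex_def)
  next
    fix h assume "h \<in> H"
    then show "\<Psi> (\<lambda>x\<in>?M. x) h = h"
      by (simp add: \<Psi>_def e_def K0 L0 RD defect_def)
  next
    fix X h assume "h \<notin> H"
    then show "\<Psi> X h = undefined" by (simp add: \<Psi>_def)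
  next
    fix n :: nat and T assume T: "\<And>i j. i < n \<Longrightarrow> j < n \<Longrightarrow> T i j \<in> bop ?M ?M"
      and pos: "positive_matrix ?M n T"
    note posD = pos[unfolded positive_matrix_def Let_def, rule_format]
    have "positive_matrix H n (\<lambda>i j x. e (T i j) *\<^sub>C \<Delta> x)"
      unfolding positive_matrix_def Let_def
    proof (intro allI impI)
      fix h assume h: "\<forall>i<n. h i \<in> H"
      let ?B = "\<Sum>i<n. \<Sum>j<n. cinner (e (T i j) *\<^sub>C \<Delta> (h j)) (h i)"
      define w where "w i m = ell2_nth (W (h i)) m" for i m
      define s where "s m = (\<Sum>i<n. \<Sum>j<n. e (T i j) * (w j m * cnj (w i m)))" for m
      have s: "s m \<in> \<real> \<and> 0 \<le> Re (s m)" for m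
      proof -
        have "s m = (\<Sum>i<n. \<Sum>j<n. cinner (T i j (0, w j m, 0)) (0, w i m, 0))"
          unfolding s_def
        proof (intro sum.cong refl)
          fix i j assume "i \<in> {..<n}" "j \<in> {..<n}"
          then have "T i j (w j m *\<^sub>C (0, 1, 0)) = w j m *\<^sub>C T i j (0, 1, 0)"
            by (intro bopD(3)[OF T] in_M K0) auto
          then show "e (T i j) * (w j m * cnj (w i m)) = cinner (T i j (0, w j m, 0)) (0, w i m, 0)"
            by (simp add: scaleC_complex_def cinner_complex_def cinner_prod_def e_def)
        qed
        then show ?thesis
          using pos[unfolded positive_matrix_def Let_def, rule_format, of "\<lambda>i. (0, w i m, 0)"] in_M[OF K0]
          by simp
      qed
      have "?B = (\<Sum>i<n. \<Sum>j<n. e (T i j) * cinner (W (h j)) (W (h i)))"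
        using h by (intro sum.cong refl) (simp add: W)
      moreover have "s sums (\<Sum>i<n. \<Sum>j<n. e (T i j) * cinner (W (h j)) (W (h i)))"
        unfolding s_def
      proof (intro sums_sum sums_mult)
        fix i j
        have "summable (\<lambda>m. w j m * cnj (w i m))"
          unfolding w_def using ell2_nth by (intro summable_ell2_mult) auto
        then show "(\<lambda>m. w j m * cnj (w i m)) sums cinner (W (h j)) (W (h i))"
          by (simp add: cinner_ell2_def w_def summable_sums)
      qed
      ultimately have "(\<lambda>m. Re (s m)) sums Re ?B" "(\<lambda>m. Im (s m)) sums Im ?B"
        by (simp_all only: sums_Re sums_Im)
      moreover have "Im (s m) = 0" for m using s by (simp add: complex_is_Real_iff)
      ultimately show "?B \<in> \<real> \<and> 0 \<le> Re ?B"
        using s sums_le[of "\<lambda>_. 0" "\<lambda>m. Re (s m)" 0 "Re ?B"] sums_unique2[of "\<lambda>_. 0" "Im ?B" 0]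
        by (auto simp only: complex_is_Real_iff sums_zero)
    qed
    then show "positive_matrix H n (\<lambda>i j. \<Psi> (T i j))"
    proof (rule positive_matrix_sum[OF pos, where f = "\<lambda>h. (R h, 0, 0)" and g = "\<lambda>h. h"])
      fix i j x y assume "i < n" "j < n" and xy: "x \<in> H" "y \<in> H"
      then have "T i j \<in> bop ?M ?M" using T by simp
      then show "cinner (\<Psi> (T i j) x) y = cinner (T i j (R x, 0, 0)) (R y, 0, 0) + cinner (e (T i j) *\<^sub>C \<Delta> x) y"
        using xy by (simp add: \<Psi>_def Rs_cinner XK RD cinner_prod_def)
    qed (simp_all add: in_M RD(1) L0)
  qed
  then show ?thesis by (simp only: \<Psi>_def[abs_def] e_def)
qed

end

text \<open>Both sides of the identity are UCP in \<open>a\<close>, and they agree on \<open>G\<close> because \<open>\<chi>\<close> vanishes there. The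
  right-hand side is the compression above, evaluated at \<open>\<rho> \<oplus> \<chi> \<oplus> \<tau>\<close> with \<open>\<tau>\<close> faithful.\<close>

lemma hyperrigid_dilation_formula:
  assumes G: "hyperrigid G" and chi: "character chi" and ker: "G \<subseteq> {a. chi a = 0}"
    and H: "separable_hilbert H" and K: "separable_hilbert K"
    and \<pi>: "star_representation H \<pi>" and \<rho>: "star_representation K \<rho>"
    and R: "contraction H K R"
    and on_G: "\<forall>g\<in>G. \<forall>h\<in>H. \<pi> g h = adj H K R (\<rho> g (R h))"
    and h: "h \<in> H"
  shows "\<pi> a h = adj H K R (\<rho> a (R h)) + chi a *\<^sub>C defect H K R h"
proof -
  have hH: "hilbert H" and hK: "hilbert K" using H K by (auto simp: separable_hilbert_def)
  interpret contraction_between H K R by unfold_locales fact+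
  have "countable G" "generates G" using G by (auto simp: hyperrigid_def)
  then obtain D :: "'a set" where D: "countable D" "closure D = UNIV"
    by (rule countable_dense_if_generates)
  obtain L :: "ell2 set" and \<tau> :: "'a \<Rightarrow> ell2 \<Rightarrow> ell2"
    where L: "separable_hilbert L" and \<tau>: "faithful_representation L \<tau>"
    by (rule faithful_separable_representation[OF D])
  have hL: "hilbert L" using L by (simp add: separable_hilbert_def)
  let ?C = "UNIV :: complex set"
  have hC: "hilbert ?C" using separable_hilbert_complex by (simp add: separable_hilbert_def)
  define \<sigma> where "\<sigma> a = direct_sum K (?C \<times> L) (\<rho> a) (direct_sum ?C L (\<lambda>z\<in>?C. chi a * z) (\<tau> a))" for a
  have CL: "separable_hilbert (?C \<times> L)" by (intro separable_hilbert_Times separable_hilbert_complex L)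
  then have hCL: "hilbert (?C \<times> L)" by (simp add: separable_hilbert_def)
  have \<sigma>: "faithful_representation (K \<times> ?C \<times> L) \<sigma>"
    unfolding \<sigma>_def
    by (intro faithful_representation_direct_sum hK hC hL hCL \<rho> \<tau> star_representation_character chi)
  define \<Psi> where "\<Psi> X = (\<lambda>h\<in>H. Rs (fst (X (R h, 0, 0))) + fst (snd (X (0, 1, 0))) *\<^sub>C \<Delta> h)"
    for X :: "'c \<times> complex \<times> ell2 \<Rightarrow> 'c \<times> complex \<times> ell2"
  have ucp: "ucp_map (K \<times> ?C \<times> L) H \<Psi>"
    unfolding \<Psi>_def[abs_def] by (rule ucp_map_compression[OF H hilbertD(1)[OF hL]])
  have \<Psi>\<sigma>: "\<Psi> (\<sigma> a) h = Rs (\<rho> a (R h)) + chi a *\<^sub>C \<Delta> h" if "h \<in> H" for a h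
    using that csubspaceD(1)[OF Ks] csubspaceD(1)[OF hilbertD(1)[OF hL]] RD(1)
    by (simp add: \<Psi>_def \<sigma>_def direct_sum_def)
  have \<sigma>b: "\<sigma> a \<in> bop (K \<times> ?C \<times> L) (K \<times> ?C \<times> L)" for a
    using \<sigma> star_representationD(1) unfolding faithful_representation_def by blast
  have "\<Psi> (\<sigma> a) = \<pi> a"
  proof (rule unique_extension_property[OF G H separable_hilbert_Times[OF K CL] \<pi> \<sigma> ucp])
    fix g assume g: "g \<in> G"
    show "\<Psi> (\<sigma> g) = \<pi> g"
    proof (rule bop_eqI[OF ucp_mapD(1)[OF ucp \<sigma>b] star_representationD(1)[OF \<pi>]])
      fix h assume "h \<in> H"
      moreover have "chi g = 0" using g ker by blast
      ultimately show "\<Psi> (\<sigma> g) h = \<pi> g h" using on_G g by (simp add: \<Psi>\<sigma>)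
    qed
  qed
  then show ?thesis using \<Psi>\<sigma>[OF h, of a] by simp
qed


section \<open>The isometric decomposition\<close>

text \<open>The situation once hyperrigidity has been used; what remains is operator theory.\<close>

locale intertwining_dilation = contraction_between H K R
  for H :: "'h::complex_inner set" and K :: "'k::complex_inner set" and R +
  fixes chi :: "'a::cstar_algebra \<Rightarrow> complex" and \<pi> \<rho>
  assumes chi: "character chi"
    and \<pi>: "star_representation H \<pi>" and \<rho>: "star_representation K \<rho>"
    and formula: "\<And>a h. h \<in> H \<Longrightarrow> \<pi> a h = adj H K R (\<rho> a (R h)) + chi a *\<^sub>C defect H K R h"
begin

lemmas \<pi>D = star_representationD[OF \<pi>] and \<rho>D = star_representationD[OF \<rho>]
lemmas \<pi>_in = bopD(1)[OF \<pi>D(1)] and \<rho>_in = bopD(1)[OF \<rho>D(1)]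
lemmas \<pi>_cinner = star_representation_cinner[OF \<pi> hH] and \<rho>_cinner = star_representation_cinner[OF \<rho> hK]

lemma chiD: "chi (a * b) = chi a * chi b" "chi (star a) = cnj (chi a)"
  using chi by (auto simp: character_def)

text \<open>The map \<open>h \<mapsto> (R h, sqrt \<Delta> h)\<close> is an isometry \<open>V\<close> with \<open>\<pi> = V* (\<rho> \<oplus> \<chi>) V\<close>. Since \<open>\<pi>\<close> is
  multiplicative, \<open>V\<close> intertwines \<open>\<pi>\<close> and \<open>\<rho> \<oplus> \<chi>\<close>; the two components of this statement
  amount to the two conclusions, and the two non-negative terms below are the squared
  norms of the components of \<open>(\<rho> \<oplus> \<chi>) V h - V \<pi> h\<close>.\<close>

lemma
  assumes h: "h \<in> H"
  shows intertwine: "\<rho> a (R h) = R (\<pi> a h)"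
    and defect_rep: "\<Delta> (\<pi> a h) = chi a *\<^sub>C \<Delta> h"
proof -
  let ?p = "\<pi> a h" and ?q = "\<rho> a (R h)" and ?c = "chi a"
  let ?x = "?q - R ?p" and ?y = "?c *\<^sub>C h - ?p"
  note p = \<pi>_in[OF h, of a] and Rh = RD(1)[OF h]
  note q = \<rho>_in[OF Rh, of a]
  have y: "?y \<in> H" using p h csubspaceD[OF Hs] by blast
  have qp: "cinner ?q (R ?p) = cinner ?p ?p - ?c * cinner (\<Delta> h) ?p"
  proof -
    have "cinner ?q (R ?p) = cinner (Rs ?q) ?p" by (rule Rs_cinner[OF p q, symmetric])
    also have "Rs ?q = ?p - ?c *\<^sub>C \<Delta> h" using formula[OF h, of a] by simp
    finally show ?thesis by simp
  qed
  have pq: "cinner (R ?p) ?q = cinner ?p ?p - cnj ?c * cinner (\<Delta> ?p) h"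
    using arg_cong[OF qp, of cnj] cinner_commute[of "R ?p" ?q] cinner_commute[of ?p ?p]
      defect.herm[OF p h] by simp
  have qq: "cinner ?q ?q = cinner ?p ?p - ?c * cnj ?c * cinner (\<Delta> h) h"
  proof -
    have "cinner ?q ?q = cinner (R h) (\<rho> (star a) ?q)" by (rule \<rho>_cinner[OF Rh q])
    also have "\<dots> = cinner (R h) (\<rho> (star a * a) (R h))" using \<rho>D(4)[OF Rh] by simp
    also have "\<dots> = cinner h (Rs (\<rho> (star a * a) (R h)))"
      by (rule adjD(2)[OF hH Ks R_bop h \<rho>_in[OF Rh]])
    also have "Rs (\<rho> (star a * a) (R h)) = \<pi> (star a * a) h - (cnj ?c * ?c) *\<^sub>C \<Delta> h"
      using formula[OF h, of "star a * a"] by (simp add: chiD)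
    also have "cinner h \<dots> = cinner h (\<pi> (star a) ?p) - ?c * cnj ?c * cinner h (\<Delta> h)"
      by (simp add: \<pi>D(4)[OF h])
    also have "cinner h (\<pi> (star a) ?p) = cinner ?p ?p" by (rule \<pi>_cinner[OF h p, symmetric])
    finally show ?thesis by (simp add: defect_adjoint[OF h h])
  qed
  have pp: "cinner (R ?p) (R ?p) = cinner ?p ?p - cinner (\<Delta> ?p) ?p"
    using defect_cinner[OF p p] by simp
  have \<Delta>y: "\<Delta> ?y = ?c *\<^sub>C \<Delta> h - \<Delta> ?p"
    using bop_diff[OF defect_bop Hs csubspaceD(3)[OF Hs h] p, of ?c] defectD(3)[OF h] by simp
  have "cinner ?x ?x = - cinner (\<Delta> ?y) ?y"
    unfolding \<Delta>y by (simp add: qp pq qq pp algebra_simps)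
  then have "(norm ?x)\<^sup>2 + Re (cinner (\<Delta> ?y) ?y) = 0" by (simp only: norm_eq_Re_cinner) simp
  then have "(norm ?x)\<^sup>2 = 0" "Re (cinner (\<Delta> ?y) ?y) = 0"
    using defect.nonneg[OF y] zero_le_power2[of "norm ?x"] by linarith+
  then show "?q = R ?p" "\<Delta> ?p = ?c *\<^sub>C \<Delta> h" using defect_eq_0[OF y] \<Delta>y by simp_all
qed

lemma rep_defect:
  assumes h: "h \<in> H"
  shows "\<pi> a (\<Delta> h) = chi a *\<^sub>C \<Delta> h"
proof -
  note \<Delta>h = defectD(1)[OF h]
  have "cinner k (\<pi> a (\<Delta> h)) = cinner k (chi a *\<^sub>C \<Delta> h)" if k: "k \<in> H" for k
  proof -
    have "cinner k (\<pi> a (\<Delta> h)) = cinner (\<pi> (star a) k) (\<Delta> h)"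
      using \<pi>_cinner[OF k \<Delta>h, of "star a"] by simp
    also have "\<dots> = cinner (\<Delta> (\<pi> (star a) k)) h" by (rule defect_adjoint[OF \<pi>_in[OF k] h, symmetric])
    also have "\<dots> = cinner k (chi a *\<^sub>C \<Delta> h)"
      by (simp add: defect_rep[OF k] chiD defect_adjoint[OF k h])
    finally show ?thesis .
  qed
  then show ?thesis
    by (intro cinner_eq_imp_eq[OF Hs]) (auto intro: \<pi>_in \<Delta>h csubspaceD(3)[OF Hs])
qed

lemma Rs_intertwine:
  assumes k: "k \<in> K"
  shows "Rs (\<rho> a k) = \<pi> a (Rs k)"
proof -
  have "cinner x (Rs (\<rho> a k)) = cinner x (\<pi> a (Rs k))" if x: "x \<in> H" for x
  proof -
    note adj = adjD(2)[OF hH Ks R_bop, symmetric]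
    have "cinner x (Rs (\<rho> a k)) = cinner (R x) (\<rho> a k)" by (rule adj[OF x \<rho>_in[OF k]])
    also have "\<dots> = cinner (\<rho> (star a) (R x)) k" using \<rho>_cinner[OF RD(1)[OF x] k, of "star a"] by simp
    also have "\<dots> = cinner (R (\<pi> (star a) x)) k" by (simp add: intertwine[OF x])
    also have "\<dots> = cinner (\<pi> (star a) x) (Rs k)" by (rule adj[OF \<pi>_in[OF x] k, symmetric])
    also have "\<dots> = cinner x (\<pi> a (Rs k))" using \<pi>_cinner[OF x RsD(1)[OF k], of "star a"] by simp
    finally show ?thesis .
  qed
  then show ?thesis
    by (intro cinner_eq_imp_eq[OF Hs]) (auto intro: \<pi>_in \<rho>_in RsD(1) k)
qed

lemma defect_commutes: "commutes_with H \<Delta> \<pi>"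
  by (simp add: commutes_with_def defect_rep rep_defect)

lemma codefect_commutes: "commutes_with K (codefect H K R) \<rho>"
  unfolding commutes_with_def
proof (intro allI ballI)
  fix a k assume k: "k \<in> K"
  have "codefect H K R (\<rho> a k) = \<rho> a k - \<rho> a (R (Rs k))"
    by (simp add: codefect_def \<rho>_in k Rs_intertwine intertwine RsD(1))
  also have "\<dots> = \<rho> a (k - R (Rs k))"
    by (rule bop_diff[OF \<rho>D(1) Ks k RD(1)[OF RsD(1)[OF k]], symmetric])
  finally show "codefect H K R (\<rho> a k) = \<rho> a (codefect H K R k)" by (simp add: codefect_def k)
qed

definition "H1 = closure (\<Delta> ` H)"
definition "H0 = orth_compl H H1"
definition "K1 = closure ((\<lambda>h. codefect H K R (R h)) ` H)"
definition "K0 = orth_compl K K1"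

lemma K1_eq: "K1 = closure ((\<lambda>h. R (\<Delta> h)) ` H)"
  unfolding K1_def by (simp add: codefect_R cong: image_cong)

lemma H1: "csubspace H1" "closed H1" "H1 \<subseteq> H"
proof -
  show "csubspace H1" unfolding H1_def by (intro csubspace_closure csubspace_bop_image[OF defect_bop Hs])
  show "closed H1" by (simp add: H1_def)
  show "H1 \<subseteq> H" unfolding H1_def by (rule closure_minimal) (auto intro: defectD(1) hilbertD(3)[OF hH])
qed

lemma K1: "csubspace K1" "closed K1" "K1 \<subseteq> K"
proof -
  have "csubspace ((\<lambda>h\<in>H. R (\<Delta> h)) ` H)"
    by (rule csubspace_bop_image[OF bop_comp[OF Hs defect_bop R_bop] Hs])
  then show "csubspace K1" unfolding K1_eq by (intro csubspace_closure) simp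
  show "closed K1" by (simp add: K1_def)
  show "K1 \<subseteq> K" unfolding K1_eq by (rule closure_minimal) (auto intro: defectD(1) RD(1) hilbertD(3)[OF hK])
qed

lemma H0_iff: "h \<in> H0 \<longleftrightarrow> h \<in> H \<and> \<Delta> h = 0"
proof
  assume "h \<in> H0"
  then have h: "h \<in> H" "\<And>k. k \<in> H \<Longrightarrow> cinner h (\<Delta> k) = 0"
    unfolding H0_def H1_def orth_compl_closure by (auto simp: orth_compl_def)
  then show "h \<in> H \<and> \<Delta> h = 0"
    using defect_adjoint[OF h(1)] by (intro conjI cinner_zero_imp_zero[OF defectD(1)]) auto
next
  assume h: "h \<in> H \<and> \<Delta> h = 0"
  then have "cinner h (\<Delta> k) = 0" if "k \<in> H" for k using defect_adjoint[of h k] that by simp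
  then show "h \<in> H0" using h unfolding H0_def H1_def orth_compl_closure by (auto simp: orth_compl_def)
qed

lemma K0_iff: "k \<in> K0 \<longleftrightarrow> k \<in> K \<and> (\<forall>h\<in>H. cinner k (R (\<Delta> h)) = 0)"
  unfolding K0_def K1_eq orth_compl_closure by (auto simp: orth_compl_def)

lemma R_H0:
  assumes "h \<in> H0"
  shows "Rs (R h) = h" "R h \<in> K0"
proof -
  have h: "h \<in> H" "\<Delta> h = 0" using assms H0_iff by auto
  then show *: "Rs (R h) = h" by (simp add: defect_def)
  have "cinner (R h) (R (\<Delta> k)) = 0" if k: "k \<in> H" for k
    using Rs_cinner[OF defectD(1)[OF k] RD(1)[OF h(1)]] defect_adjoint[OF h(1) k] h(2) by (simp add: *)
  then show "R h \<in> K0" using h RD(1) by (simp add: K0_iff)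
qed

lemma Rs_K0:
  assumes "k \<in> K0"
  shows "Rs k \<in> H0"
proof -
  have k: "k \<in> K" "\<And>h. h \<in> H \<Longrightarrow> cinner k (R (\<Delta> h)) = 0" using assms K0_iff by auto
  have "cinner (\<Delta> (Rs k)) h = 0" if h: "h \<in> H" for h
    using defect_adjoint[OF RsD(1)[OF k(1)] h] Rs_cinner[OF defectD(1)[OF h] k(1)] k(2)[OF h] by simp
  then have "\<Delta> (Rs k) = 0" by (rule cinner_zero_imp_zero[OF defectD(1)[OF RsD(1)[OF k(1)]]])
  then show ?thesis using RsD(1)[OF k(1)] by (simp add: H0_iff)
qed

lemma R_H1: "R ` H1 \<subseteq> K1"
  unfolding H1_def K1_eq
proof (rule bop_closure_subset[OF R_bop Hs])
  have "R ` \<Delta> ` H = (\<lambda>h. R (\<Delta> h)) ` H" by (rule image_image)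
  then show "R ` \<Delta> ` H \<subseteq> closure ((\<lambda>h. R (\<Delta> h)) ` H)" by (simp add: closure_subset)
qed (auto intro: defectD(1) hilbertD(3)[OF hH])

lemma rep_H1: "h \<in> H1 \<Longrightarrow> \<pi> a h = chi a *\<^sub>C h"
  unfolding H1_def
proof (rule limit_identity[of h "\<Delta> ` H"])
  assume h: "h \<in> closure (\<Delta> ` H)"
  fix u assume u: "\<And>n. u n \<in> \<Delta> ` H" "u \<longlonglongrightarrow> h"
  have "\<Delta> ` H \<subseteq> H" using defectD(1) by auto
  then have "u n \<in> H" for n using u(1) by (rule subsetD)
  moreover have "h \<in> H" using h H1(3) by (auto simp: H1_def)
  ultimately show "(\<lambda>n. \<pi> a (u n)) \<longlonglongrightarrow> \<pi> a h" by (intro bop_tendsto[OF \<pi>D(1) Hs] u(2))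
qed (auto intro: tendsto_scaleC rep_defect)

lemma rep_K1: "k \<in> K1 \<Longrightarrow> \<rho> a k = chi a *\<^sub>C k"
  unfolding K1_eq
proof (rule limit_identity[of k "(\<lambda>h. R (\<Delta> h)) ` H"])
  assume k: "k \<in> closure ((\<lambda>h. R (\<Delta> h)) ` H)"
  fix u assume u: "\<And>n. u n \<in> (\<lambda>h. R (\<Delta> h)) ` H" "u \<longlonglongrightarrow> k"
  have "(\<lambda>h. R (\<Delta> h)) ` H \<subseteq> K" using defectD(1) RD(1) by auto
  then have "u n \<in> K" for n using u(1) by (rule subsetD)
  moreover have "k \<in> K" using k K1(3) by (auto simp: K1_eq)
  ultimately show "(\<lambda>n. \<rho> a (u n)) \<longlonglongrightarrow> \<rho> a k" by (intro bop_tendsto[OF \<rho>D(1) Ks] u(2))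
next
  fix y assume "y \<in> (\<lambda>h. R (\<Delta> h)) ` H"
  then show "\<rho> a y = chi a *\<^sub>C y"
    by (auto simp: intertwine defectD(1) rep_defect RD(3))
qed (auto intro: tendsto_scaleC)

text \<open>On \<open>H0\<close>, the kernel of \<open>\<Delta>\<close>, the operator \<open>R* R\<close> is the identity, and the adjoint of the restriction
  of \<open>R\<close> is the restriction of \<open>R*\<close>, since \<open>R*\<close> maps \<open>K0\<close> to \<open>H0\<close>.\<close>

lemma isometric_component:
  defines "R0 \<equiv> (\<lambda>h\<in>H0. R h)"
  shows "R0 \<in> bop H0 K0" "isometric H0 K0 R0" "\<And>a h. h \<in> H0 \<Longrightarrow> \<pi> a h = adj H0 K0 R0 (\<rho> a (R0 h))"
proof -
  have H0s: "csubspace H0" unfolding H0_def by (rule csubspace_orth_compl[OF Hs])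
  have K0s: "csubspace K0" unfolding K0_def by (rule csubspace_orth_compl[OF Ks])
  have H0H: "H0 \<subseteq> H" using H0_iff by blast
  have K0K: "K0 \<subseteq> K" using K0_iff by blast
  show bop: "R0 \<in> bop H0 K0"
    unfolding R0_def by (rule bop_restrict_subspace[OF R_bop H0s H0H]) (use R_H0 in auto)
  have adj: "adj H0 K0 R0 = (\<lambda>k\<in>K0. Rs k)"
  proof (rule adj_eqI[OF H0s])
    show "(\<lambda>k\<in>K0. Rs k) \<in> bop K0 H0"
      by (rule bop_restrict_subspace[OF Rs_bop K0s K0K]) (use Rs_K0 in auto)
    fix x y assume "x \<in> H0" "y \<in> K0"
    then show "cinner (R0 x) y = cinner x ((\<lambda>k\<in>K0. Rs k) y)"
      using adjD(2)[OF hH Ks R_bop, of x y] H0H K0K by (auto simp: R0_def)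
  qed
  show "isometric H0 K0 R0" unfolding isometric_def adj using bop by (simp add: R_H0 R0_def)
  fix a h assume h: "h \<in> H0"
  then have hH: "h \<in> H" and "\<Delta> h = 0" using H0_iff by auto
  then have "\<pi> a h \<in> H0" using \<pi>_in[OF hH] by (simp add: H0_iff defect_rep)
  then show "\<pi> a h = adj H0 K0 R0 (\<rho> a (R0 h))"
    unfolding adj using h by (simp add: R0_def intertwine[OF hH] R_H0)
qed

theorem decomposition: "isometric_decomposition chi H K \<pi> \<rho> R H0 H1 K0 K1"
  unfolding isometric_decomposition_def
proof (intro conjI)
  have H0H: "H0 \<subseteq> H" using H0_iff by blast
  have K0K: "K0 \<subseteq> K" using K0_iff by blast
  show "closed_csubspace H H0" "closed_csubspace K K0"
    using csubspace_orth_compl[OF Hs, of H1] csubspace_orth_compl[OF Ks, of K1] H0H K0K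
      closed_orth_compl[OF hilbertD(3)[OF hH], of H1] closed_orth_compl[OF hilbertD(3)[OF hK], of K1]
    by (auto simp: closed_csubspace_def H0_def K0_def)
  show "closed_csubspace H H1" "closed_csubspace K K1"
    using H1 K1 by (auto simp: closed_csubspace_def)
  show "orth_sum H H0 H1" "orth_sum K K0 K1"
    unfolding H0_def K0_def by (intro orth_sum_orth_compl hH hK H1 K1)+
  show "reduces H H1 \<pi>" "reduces H H0 \<pi>"
    unfolding H0_def using rep_H1 csubspaceD(3)[OF H1(1)]
    by (auto intro!: star_representation_reduces[OF hH \<pi> H1])
  show "reduces K K1 \<rho>" "reduces K K0 \<rho>"
    unfolding K0_def using rep_K1 csubspaceD(3)[OF K1(1)]
    by (auto intro!: star_representation_reduces[OF hK \<rho> K1])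
  show "\<forall>a. \<forall>h\<in>H1. \<pi> a h = chi a *\<^sub>C h" "\<forall>a. \<forall>k\<in>K1. \<rho> a k = chi a *\<^sub>C k"
    using rep_H1 rep_K1 by auto
  have "(\<lambda>h\<in>H1. R h) \<in> bop H1 K1" by (rule bop_restrict_subspace[OF R_bop H1(1,3) R_H1])
  then have "op_direct_sum H0 H1 K0 K1 R (\<lambda>h\<in>H0. R h) (\<lambda>h\<in>H1. R h)"
    using isometric_component(1) H0H H1(3) RD(2) by (auto simp: op_direct_sum_def)
  then show "\<exists>R0 R1. op_direct_sum H0 H1 K0 K1 R R0 R1 \<and> isometric H0 K0 R0 \<and>
      (\<forall>a. \<forall>h\<in>H0. \<pi> a h = adj H0 K0 R0 (\<rho> a (R0 h)))"
    using isometric_component(2,3) by blast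
qed

text \<open>A vector with \<open>norm (R h) = norm h\<close> lies in the kernel of \<open>\<Delta>\<close>, which meets \<open>H1\<close> only in zero.\<close>

theorem pure_component:
  assumes "op_direct_sum H0 H1 K0 K1 R R0 R1"
  shows "pure_contraction H1 K1 R1" "closure (R1 ` H1) = K1"
proof -
  have bop: "R0 \<in> bop H0 K0" "R1 \<in> bop H1 K1" and sum: "\<And>x y. x \<in> H0 \<Longrightarrow> y \<in> H1 \<Longrightarrow> R (x + y) = R0 x + R1 y"
    using assms by (auto simp: op_direct_sum_def)
  have H0s: "csubspace H0" unfolding H0_def by (rule csubspace_orth_compl[OF Hs])
  have R1: "R1 h = R h" if "h \<in> H1" for h
    using sum[OF csubspaceD(1)[OF H0s] that] bop_zero[OF bop(1) H0s] by simp
  have le: "norm (R1 h) \<le> 1 * norm h" if "h \<in> H1" for h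
    using R_norm_le[of h] H1(3) that by (auto simp: R1)
  have "norm (R1 h) < norm h" if h: "h \<in> H1" "h \<noteq> 0" for h
  proof (rule ccontr)
    have hH: "h \<in> H" using h(1) H1(3) by blast
    assume "\<not> norm (R1 h) < norm h"
    then have "norm (R h) = norm h" using R_norm_le[OF hH] by (simp add: R1[OF h(1)])
    then have "cinner (\<Delta> h) h = 0" by (simp add: defect_cinner[OF hH hH] cinner_self)
    then have "\<Delta> h = 0" using defect_eq_0[OF hH] by simp
    then have "h \<in> H0" using hH by (simp add: H0_iff)
    then have "cinner h h = 0" using h(1) unfolding H0_def by (simp add: orth_compl_def)
    then show False using h(2) by (simp add: cinner_self)
  qed
  moreover have "op_norm H1 R1 \<le> 1" by (rule op_norm_le[OF H1(1) _ le]) simp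
  ultimately show "pure_contraction H1 K1 R1"
    using bop(2) by (simp add: pure_contraction_def contraction_def)
  show "closure (R1 ` H1) = K1"
  proof (rule antisym)
    show "closure (R1 ` H1) \<subseteq> K1" using R_H1 R1 K1(2) by (intro closure_minimal) auto
    have "\<Delta> ` H \<subseteq> H1" unfolding H1_def by (rule closure_subset)
    then have "(\<lambda>h. R (\<Delta> h)) ` H \<subseteq> R1 ` H1" using R1 by (auto simp: image_subset_iff image_iff)
    then show "K1 \<subseteq> closure (R1 ` H1)" unfolding K1_eq by (rule closure_mono)
  qed
qed

end

theorem theorem2p7:
  fixes G :: "'a::cstar_algebra set" and chi :: "'a \<Rightarrow> complex"
    and H :: "'h::complex_inner set" and K :: "'k::complex_inner set"
    and \<pi> :: "'a \<Rightarrow> 'h \<Rightarrow> 'h" and \<rho> :: "'a \<Rightarrow> 'k \<Rightarrow> 'k" and R :: "'h \<Rightarrow> 'k"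
  assumes "hyperrigid G"
    and "character chi" and "G \<subseteq> {a. chi a = 0}"
    and "separable_hilbert H" and "separable_hilbert K"
    and "star_representation H \<pi>" and "star_representation K \<rho>"
    and "contraction H K R" and "\<not> isometric H K R"
    and "\<forall>g\<in>G. \<forall>h\<in>H. \<pi> g h = adj H K R (\<rho> g (R h))"
  shows "commutes_with H (defect H K R) \<pi> \<and> commutes_with K (codefect H K R) \<rho> \<and>
    (let H1 = closure (defect H K R ` H);
         H0 = orth_compl H H1;
         K1 = closure ((\<lambda>h. codefect H K R (R h)) ` H);
         K0 = orth_compl K K1
     in isometric_decomposition chi H K \<pi> \<rho> R H0 H1 K0 K1 \<and>
        (\<forall>R0 R1. op_direct_sum H0 H1 K0 K1 R R0 R1 \<longrightarrow>
           pure_contraction H1 K1 R1 \<and> closure (R1 ` H1) = K1))"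
proof -
  interpret D: intertwining_dilation H K R chi \<pi> \<rho>
  proof
    show "hilbert H" "hilbert K" using assms(4,5) by (auto simp: separable_hilbert_def)
    show "\<pi> a h = adj H K R (\<rho> a (R h)) + chi a *\<^sub>C defect H K R h" if "h \<in> H" for a h
      using assms that by (intro hyperrigid_dilation_formula[of G])
  qed (use assms in auto)
  show ?thesis
    unfolding Let_def D.H1_def[symmetric] D.H0_def[symmetric] D.K1_def[symmetric] D.K0_def[symmetric]
    using D.defect_commutes D.codefect_commutes D.decomposition D.pure_component by blast
qed

end
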